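(* Let $G$ be a second-countable, locally compact group. Let $(\alpha,\mathfrak u):G\curvearrowright A$ and $(\beta,\mathfrak v):G\curvearrowright B$ be two twisted actions on separable C*-algebras. Suppose that $(\phi,\mathsf u):(A,\alpha,\mathfrak u)\to(B,\beta,\mathfrak v)$ and $(\psi,\mathsf v):(B,\beta,\mathfrak v)\to(A,\alpha,\mathfrak u)$ are two non-degenerate cocycle morphisms such that $(\psi,\mathsf v)\circ(\phi,\mathsf u)$ is asymptotically unitarily equivalent to $\mathrm{id}_A$ and $(\phi,\mathsf u)\circ(\psi,\mathsf v)$ is asymptotically unitarily equivalent to $\mathrm{id}_B$. Then there exist mutually inverse cocycle conjugacies $(\phi_0,\mathsf u^{(0)}):(A,\alpha,\mathfrak u)\to(B,\beta,\mathfrak v)$ and $(\psi_0,\mathsf v^{(0)}):(B,\beta,\mathfrak v)\to(A,\alpha,\mathfrak u)$ such that $(\phi,\mathsf u)$ is asymptotically unitarily equivalent to $(\phi_0,\mathsf u^{(0)})$ and $(\psi,\mathsf v)$ is asymptotically unitarily equivalent to $(\psi_0,\mathsf v^{(0)})$.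
   Context: $\mathcal M(A)$ denotes the multiplier algebra, $\mathcal U(\cdot)$ the unitary group, $\mathrm{Ad}(u)=u(\cdot)u^*$; automorphisms of $A$ are extended canonically to $\mathcal M(A)$. A twisted action $(\alpha,\mathfrak u):G\curvearrowright A$ consists of a point-norm continuous map $\alpha:G\to\mathrm{Aut}(A)$ and a strictly continuous map $\mathfrak u:G\times G\to\mathcal U(\mathcal M(A))$ with $\alpha_1=\mathrm{id}_A$, $\alpha_s\circ\alpha_t=\mathrm{Ad}(\mathfrak u_{s,t})\circ\alpha_{st}$, $\mathfrak u_{s,1}=\mathfrak u_{1,s}=\mathbf 1$ and $\alpha_r(\mathfrak u_{s,t})\mathfrak u_{r,st}=\mathfrak u_{r,s}\mathfrak u_{rs,t}$ for all $r,s,t\in G$. A non-degenerate cocycle morphism $(\psi,\mathsf v):(A,\alpha,\mathfrak u)\to(B,\beta,\mathfrak v)$ is a pair of a non-degenerate $*$-homomorphism $\psi:A\to B$ (extended to a unital $*$-homomorphism $\mathcal M(A)\to\mathcal M(B)$) and a strictly continuous map $\mathsf v:G\to\mathcal U(\mathcal M(B))$ with $\mathrm{Ad}(\mathsf v_g)\circ\beta_g\circ\psi=\psi\circ\alpha_g$ and $\psi(\mathfrak u_{g,h})=\mathsf v_g\beta_g(\mathsf v_h)\mathfrak v_{g,h}\mathsf v_{gh}^*$ for all $g,h\in G$. Composition is $(\psi,\mathsf v)\circ(\phi,\mathsf u)=(\psi\circ\phi,\psi(\mathsf u_\bullet)\mathsf v_\bullet)$; $\mathrm{id}_A$ abbreviates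 $(\mathrm{id}_A,\mathbf 1)$. A cocycle conjugacy is a cocycle morphism $(\phi,\mathsf u)$ with $\phi$ an isomorphism; its inverse is $(\phi^{-1},\phi^{-1}(\mathsf u_\bullet)^* )$. For cocycle morphisms $(\phi,\mathsf u),(\psi,\mathsf v):(A,\alpha,\mathfrak u)\to(B,\beta,\mathfrak v)$, say that $(\psi,\mathsf v)$ is an asymptotic unitary conjugate of $(\phi,\mathsf u)$ if there is a strictly continuous map $v:[0,\infty)\to\mathcal U(\mathcal M(B))$ with $\psi(a)=\lim_{t\to\infty}v_t\phi(a)v_t^*$ for all $a\in A$ and $\max_{g\in K}\|b(\mathsf v_g-v_t\mathsf u_g\beta_g(v_t)^* )\|\to0$ as $t\to\infty$ for all $b\in B$ and compact $K\subseteq G$. They are asymptotically unitarily equivalent if each is an asymptotic unitary conjugate of the other. *)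

theory Defs
  imports "HOL-Analysis.Analysis"
begin

section \<open>C*-algebras\<close>

class scaleC =
  fixes scaleC :: "complex \<Rightarrow> 'a \<Rightarrow> 'a"  (infixr "*\<^sub>C" 75)

class star =
  fixes star :: "'a \<Rightarrow> 'a"

text \<open>Complex *-algebras, not necessarily unital.\<close>

class complex_star_algebra = real_algebra + scaleC + star +
  assumes scaleR_scaleC: "r *\<^sub>R x = complex_of_real r *\<^sub>C x"
    and scaleC_add_right: "c *\<^sub>C (x + y) = c *\<^sub>C x + c *\<^sub>C y"
    and scaleC_add_left: "(c + d) *\<^sub>C x = c *\<^sub>C x + d *\<^sub>C x"
    and scaleC_scaleC: "c *\<^sub>C d *\<^sub>C x = (c * d) *\<^sub>C x"
    and scaleC_one: "1 *\<^sub>C x = x"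
    and mult_scaleC_left: "(c *\<^sub>C x) * y = c *\<^sub>C (x * y)"
    and mult_scaleC_right: "x * (c *\<^sub>C y) = c *\<^sub>C (x * y)"
    and star_star: "star (star x) = x"
    and star_add: "star (x + y) = star x + star y"
    and star_scaleC: "star (c *\<^sub>C x) = cnj c *\<^sub>C star x"
    and star_mult: "star (x * y) = star y * star x"

text \<open>No unit is assumed, and the zero algebra is allowed.\<close>

class cstar_algebra = complex_star_algebra + real_normed_algebra + banach +
  assumes norm_scaleC: "norm (c *\<^sub>C x) = cmod c * norm x"
    and norm_star_mult_self: "norm (star x * x) = (norm x)\<^sup>2"

definition star_hom :: "('a::complex_star_algebra \<Rightarrow> 'b::complex_star_algebra) \<Rightarrow> bool" where
  "star_hom f \<longleftrightarrow>
     (\<forall>x y. f (x + y) = f x + f y) \<and>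
     (\<forall>c x. f (c *\<^sub>C x) = c *\<^sub>C f x) \<and>
     (\<forall>x y. f (x * y) = f x * f y) \<and>
     (\<forall>x. f (star x) = star (f x))"

definition star_automorphism :: "('a::complex_star_algebra \<Rightarrow> 'a) \<Rightarrow> bool" where
  "star_automorphism f \<longleftrightarrow> star_hom f \<and> bij f"

text \<open>
  The generating set is closed under complex scalars (absorb them into \<open>a\<close>), so its real span is
  its complex span.
\<close>

definition nondegenerate :: "('a::cstar_algebra \<Rightarrow> 'b::cstar_algebra) \<Rightarrow> bool" where
  "nondegenerate \<psi> \<longleftrightarrow> closure (span {\<psi> a * b | a b. True}) = UNIV"


section \<open>Multiplier algebras\<close>

definition bounded_clinear :: "('a::cstar_algebra \<Rightarrow> 'a) \<Rightarrow> bool" where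
  "bounded_clinear f \<longleftrightarrow> bounded_linear f \<and> (\<forall>c x. f (c *\<^sub>C x) = c *\<^sub>C f x)"

text \<open>
  \<open>\<M>(A)\<close> is the algebra of double centralizers \<open>(L, R)\<close> of \<open>A\<close>: \<open>L\<close> and \<open>R\<close> are left and right
  multiplication by the multiplier.
\<close>

definition double_centralizer :: "('a::cstar_algebra \<Rightarrow> 'a) \<times> ('a \<Rightarrow> 'a) \<Rightarrow> bool" where
  "double_centralizer = (\<lambda>(L, R). bounded_clinear L \<and> bounded_clinear R \<and>
     (\<forall>a b. L (a * b) = L a * b) \<and> (\<forall>a b. R (a * b) = a * R b) \<and> (\<forall>a b. R a * b = a * L b))"

lemma bounded_clinear_zero: "bounded_clinear (\<lambda>_. 0)"
  unfolding bounded_clinear_def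
  by (metis bounded_linear_zero add_cancel_right_right scaleC_add_right)

lemma bounded_clinear_id: "bounded_clinear (\<lambda>x. x)"
  by (simp add: bounded_clinear_def bounded_linear_ident)

lemma bounded_clinear_add:
  "bounded_clinear f \<Longrightarrow> bounded_clinear g \<Longrightarrow> bounded_clinear (\<lambda>x. f x + g x)"
  by (simp add: bounded_clinear_def bounded_linear_add scaleC_add_right)

lemma scaleC_minus_right: "c *\<^sub>C (- x) = - (c *\<^sub>C (x :: 'a::complex_star_algebra))"
  by (metis add.right_inverse add_cancel_right_right add_eq_0_iff scaleC_add_right)

lemma bounded_clinear_minus: "bounded_clinear f \<Longrightarrow> bounded_clinear (\<lambda>x. - f x)"
  by (simp add: bounded_clinear_def bounded_linear_minus scaleC_minus_right)

lemma bounded_linear_scaleC: "bounded_linear (\<lambda>x :: 'a::cstar_algebra. c *\<^sub>C x)"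
proof (rule bounded_linear_intro[where K = "cmod c"])
  show "c *\<^sub>C (r *\<^sub>R x) = r *\<^sub>R (c *\<^sub>C x)" for r and x :: 'a
    by (simp add: scaleR_scaleC scaleC_scaleC mult.commute)
qed (auto simp: scaleC_add_right norm_scaleC mult.commute)

lemma bounded_clinear_scaleC: "bounded_clinear f \<Longrightarrow> bounded_clinear (\<lambda>x. c *\<^sub>C f x)"
  by (auto simp: bounded_clinear_def scaleC_scaleC mult.commute
      intro: bounded_linear_compose[OF bounded_linear_scaleC])

lemma bounded_clinear_comp:
  "bounded_clinear f \<Longrightarrow> bounded_clinear g \<Longrightarrow> bounded_clinear (\<lambda>x. f (g x))"
  by (auto simp: bounded_clinear_def intro: bounded_linear_compose)

lemma norm_star: "norm (star x) = norm (x :: 'a::cstar_algebra)"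
proof -
  have le: "norm y \<le> norm (star y)" for y :: 'a
  proof (cases "norm y = 0")
    case False
    have "norm y * norm y \<le> norm (star y) * norm y"
      using norm_mult_ineq[of "star y" y] by (simp add: norm_star_mult_self power2_eq_square)
    then show ?thesis using False by (simp add: mult_le_cancel_right)
  qed simp
  show ?thesis using le[of x] le[of "star x"] by (simp add: star_star)
qed

lemma bounded_clinear_star:
  assumes "bounded_clinear f"
  shows "bounded_clinear (\<lambda>x. star (f (star x)))"
proof -
  interpret f: bounded_linear f using assms by (simp add: bounded_clinear_def)
  have c: "star (f (star (c *\<^sub>C x))) = c *\<^sub>C star (f (star x))" for c x
    using assms by (simp add: bounded_clinear_def star_scaleC)
  obtain K where K: "\<And>x. norm (f x) \<le> norm x * K" using f.bounded by blast
  have "bounded_linear (\<lambda>x. star (f (star x)))"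
  proof (rule bounded_linear_intro[where K = K])
    show "norm (star (f (star x))) \<le> norm x * K" for x
      using K[of "star x"] by (simp add: norm_star)
  qed (simp_all add: star_add f.add c scaleR_scaleC)
  then show ?thesis by (simp add: bounded_clinear_def c)
qed

lemma bounded_clinear_mult_left: "bounded_clinear (\<lambda>x. a * x)"
  by (simp add: bounded_clinear_def bounded_linear_mult_right mult_scaleC_right)

lemma bounded_clinear_mult_right: "bounded_clinear (\<lambda>x. x * a)"
  by (simp add: bounded_clinear_def bounded_linear_mult_left mult_scaleC_left)

lemmas bounded_clinear_intros =
  bounded_clinear_zero bounded_clinear_id bounded_clinear_add bounded_clinear_minus
  bounded_clinear_scaleC bounded_clinear_comp bounded_clinear_star
  bounded_clinear_mult_left bounded_clinear_mult_right

typedef (overloaded) 'a::cstar_algebra multiplier =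
  "{(L :: 'a \<Rightarrow> 'a, R). double_centralizer (L, R)}"
  by (rule exI[of _ "(\<lambda>x. x, \<lambda>x. x)"])
    (simp add: double_centralizer_def bounded_clinear_id)

definition lact :: "'a::cstar_algebra multiplier \<Rightarrow> 'a \<Rightarrow> 'a" where
  "lact m = fst (Rep_multiplier m)"

definition ract :: "'a::cstar_algebra \<Rightarrow> 'a multiplier \<Rightarrow> 'a" where
  "ract a m = snd (Rep_multiplier m) a"

lemma double_centralizer_acts: "double_centralizer (lact m, \<lambda>a. ract a m)"
  using Rep_multiplier[of m] by (auto simp: lact_def ract_def eta_contract_eq split: prod.splits)

lemma
  shows bounded_clinear_lact: "bounded_clinear (lact m)"
    and bounded_clinear_ract: "bounded_clinear (\<lambda>a. ract a m)"
    and lact_mult: "lact m (a * b) = lact m a * b"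
    and ract_mult: "ract (a * b) m = a * ract b m"
    and ract_mult_lact: "ract a m * b = a * lact m b"
  using double_centralizer_acts[of m] by (simp_all add: double_centralizer_def)

lemma
  shows lact_add: "lact m (x + y) = lact m x + lact m y"
    and lact_scaleC: "lact m (c *\<^sub>C x) = c *\<^sub>C lact m x"
    and ract_add: "ract (x + y) m = ract x m + ract y m"
    and ract_scaleC: "ract (c *\<^sub>C x) m = c *\<^sub>C ract x m"
  using bounded_clinear_lact[of m] bounded_clinear_ract[of m]
  by (auto simp: bounded_clinear_def dest: linear_simps(1))

lemma multiplier_eqI:
  "(\<And>a. lact m a = lact n a) \<Longrightarrow> (\<And>a. ract a m = ract a n) \<Longrightarrow> m = n"
  by (metis Rep_multiplier_inject ext lact_def prod.expand ract_def)

lemma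
  assumes "double_centralizer (L, R)"
  shows lact_Abs: "lact (Abs_multiplier (L, R)) = L"
    and ract_Abs: "ract a (Abs_multiplier (L, R)) = R a"
  using assms by (simp_all add: lact_def ract_def Abs_multiplier_inverse)

instantiation multiplier :: (cstar_algebra) "{complex_star_algebra, monoid_mult}"
begin

definition "0 = Abs_multiplier (\<lambda>_. 0 :: 'a, \<lambda>_. 0)"
definition "1 = Abs_multiplier (\<lambda>a. a :: 'a, \<lambda>a. a)"
definition "m + n = Abs_multiplier (\<lambda>a :: 'a. lact m a + lact n a, \<lambda>a. ract a m + ract a n)"
definition "- m = Abs_multiplier (\<lambda>a :: 'a. - lact m a, \<lambda>a. - ract a m)"
definition "m - n = m + - (n :: 'a multiplier)"
definition "m * n = Abs_multiplier (\<lambda>a :: 'a. lact m (lact n a), \<lambda>a. ract (ract a m) n)"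
definition "c *\<^sub>C m = Abs_multiplier (\<lambda>a :: 'a. c *\<^sub>C lact m a, \<lambda>a. c *\<^sub>C ract a m)"
definition "r *\<^sub>R m = complex_of_real r *\<^sub>C (m :: 'a multiplier)"
definition "star m = Abs_multiplier (\<lambda>a :: 'a. star (ract (star a) m), \<lambda>a. star (lact m (star a)))"

lemma
  shows lact_zero': "lact 0 (a :: 'a) = 0" and ract_zero': "ract a 0 = 0"
    and lact_one': "lact 1 a = a" and ract_one': "ract a 1 = a"
proof -
  have "double_centralizer (\<lambda>_. 0 :: 'a, \<lambda>_. 0)" "double_centralizer (\<lambda>x. x :: 'a, \<lambda>x. x)"
    by (simp_all add: double_centralizer_def bounded_clinear_intros)
  note dc = this[THEN lact_Abs] this[THEN ract_Abs]
  show "lact 0 (a :: 'a) = 0" "ract a 0 = 0" "lact 1 a = a" "ract a 1 = a"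
    by (simp_all add: zero_multiplier_def one_multiplier_def dc)
qed

lemma
  shows lact_add': "lact (m + n) (a :: 'a) = lact m a + lact n a"
    and ract_add': "ract a (m + n) = ract a m + ract a n"
proof -
  have "double_centralizer (\<lambda>a :: 'a. lact m a + lact n a, \<lambda>a. ract a m + ract a n)"
    by (simp add: double_centralizer_def bounded_clinear_intros bounded_clinear_lact
        bounded_clinear_ract lact_mult ract_mult ract_mult_lact algebra_simps)
  note dc = this[THEN lact_Abs] this[THEN ract_Abs]
  show "lact (m + n) (a :: 'a) = lact m a + lact n a" "ract a (m + n) = ract a m + ract a n"
    by (simp_all add: plus_multiplier_def dc)
qed

lemma
  shows lact_uminus': "lact (- m) (a :: 'a) = - lact m a"
    and ract_uminus': "ract a (- m) = - ract a m"
proof -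
  have "double_centralizer (\<lambda>a :: 'a. - lact m a, \<lambda>a. - ract a m)"
    by (simp add: double_centralizer_def bounded_clinear_intros bounded_clinear_lact
        bounded_clinear_ract lact_mult ract_mult ract_mult_lact)
  note dc = this[THEN lact_Abs] this[THEN ract_Abs]
  show "lact (- m) (a :: 'a) = - lact m a" "ract a (- m) = - ract a m"
    by (simp_all add: uminus_multiplier_def dc)
qed

lemma
  shows lact_times': "lact (m * n) (a :: 'a) = lact m (lact n a)"
    and ract_times': "ract a (m * n) = ract (ract a m) n"
proof -
  have "double_centralizer (\<lambda>a :: 'a. lact m (lact n a), \<lambda>a. ract (ract a m) n)"
    by (simp add: double_centralizer_def bounded_clinear_comp bounded_clinear_lact
        bounded_clinear_comp[OF bounded_clinear_ract bounded_clinear_ract]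
        lact_mult ract_mult ract_mult_lact)
  note dc = this[THEN lact_Abs] this[THEN ract_Abs]
  show "lact (m * n) (a :: 'a) = lact m (lact n a)" "ract a (m * n) = ract (ract a m) n"
    by (simp_all add: times_multiplier_def dc)
qed

lemma
  shows lact_scaleC': "lact (c *\<^sub>C m) (a :: 'a) = c *\<^sub>C lact m a"
    and ract_scaleC': "ract a (c *\<^sub>C m) = c *\<^sub>C ract a m"
proof -
  have "double_centralizer (\<lambda>a :: 'a. c *\<^sub>C lact m a, \<lambda>a. c *\<^sub>C ract a m)"
    by (simp add: double_centralizer_def bounded_clinear_intros bounded_clinear_lact
        bounded_clinear_ract lact_mult ract_mult ract_mult_lact mult_scaleC_left mult_scaleC_right)
  note dc = this[THEN lact_Abs] this[THEN ract_Abs]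
  show "lact (c *\<^sub>C m) (a :: 'a) = c *\<^sub>C lact m a" "ract a (c *\<^sub>C m) = c *\<^sub>C ract a m"
    by (simp_all add: scaleC_multiplier_def dc)
qed

lemma
  shows lact_star': "lact (star m) (a :: 'a) = star (ract (star a) m)"
    and ract_star': "ract a (star m) = star (lact m (star a))"
proof -
  have *: "star (lact m (star a)) * b = a * star (ract (star b) m)" for a b
    by (metis ract_mult_lact star_mult star_star)
  have "double_centralizer (\<lambda>a :: 'a. star (ract (star a) m), \<lambda>a. star (lact m (star a)))"
    by (simp add: double_centralizer_def bounded_clinear_star bounded_clinear_lact
        bounded_clinear_star[OF bounded_clinear_ract] lact_mult ract_mult star_mult star_star *)
  note dc = this[THEN lact_Abs] this[THEN ract_Abs]
  show "lact (star m) (a :: 'a) = star (ract (star a) m)" "ract a (star m) = star (lact m (star a))"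
    by (simp_all add: star_multiplier_def dc)
qed

instance
  by standard
    (auto intro!: multiplier_eqI simp: lact_zero' ract_zero' lact_one' ract_one' lact_add' ract_add'
      lact_uminus' ract_uminus' lact_times' ract_times' lact_scaleC' ract_scaleC' lact_star'
      ract_star' lact_add ract_add lact_scaleC ract_scaleC minus_multiplier_def
      scaleR_multiplier_def scaleC_add_right scaleC_add_left scaleC_scaleC scaleC_one star_star
      star_add star_scaleC algebra_simps)

end

lemmas lact_simps [simp] =
  lact_zero' lact_one' lact_add' lact_uminus' lact_times' lact_scaleC' lact_star'

lemmas ract_simps [simp] =
  ract_zero' ract_one' ract_add' ract_uminus' ract_times' ract_scaleC' ract_star'

text \<open>The canonical embedding of \<open>A\<close> into \<open>\<M>(A)\<close>.\<close>

definition embed :: "'a::cstar_algebra \<Rightarrow> 'a multiplier" where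
  "embed a = Abs_multiplier (\<lambda>b. a * b, \<lambda>b. b * a)"

lemma
  shows lact_embed [simp]: "lact (embed a) b = a * b"
    and ract_embed [simp]: "ract b (embed a) = b * a"
proof -
  have "double_centralizer (\<lambda>b. a * b, \<lambda>b. b * a)"
    by (simp add: double_centralizer_def bounded_clinear_intros mult.assoc)
  note dc = this[THEN lact_Abs] this[THEN ract_Abs]
  show "lact (embed a) b = a * b" "ract b (embed a) = b * a"
    by (simp_all add: embed_def dc)
qed

definition unitary :: "'a::cstar_algebra multiplier \<Rightarrow> bool" where
  "unitary u \<longleftrightarrow> star u * u = 1 \<and> u * star u = 1"

definition Ad :: "'a::cstar_algebra multiplier \<Rightarrow> 'a \<Rightarrow> 'a" where
  "Ad u a = ract (lact u a) (star u)"

lemma zero_if_right_mult_zero: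
  fixes x :: "'a::cstar_algebra"
  assumes "\<And>b. x * b = 0"
  shows "x = 0"
  using norm_star_mult_self[of "star x"] assms by (simp add: star_star norm_star)

lemma embed_Ad: "embed (Ad u a) = u * embed a * star u"
proof (rule multiplier_eqI)
  show 1: "lact (embed (Ad u a)) b = lact (u * embed a * star u) b" for b
    by (simp add: Ad_def ract_mult_lact lact_mult del: lact_star' ract_star')
  show "ract b (embed (Ad u a)) = ract b (u * embed a * star u)" for b
  proof -
    have "(ract b (embed (Ad u a)) - ract b (u * embed a * star u)) * c = 0" for c
      by (simp only: left_diff_distrib ract_mult_lact 1) simp
    then show ?thesis using zero_if_right_mult_zero eq_iff_diff_eq_0 by blast
  qed
qed

text \<open>
  The strict topology, i.e. the topology of the seminorms \<open>m \<mapsto> \<parallel>m a\<parallel>\<close> and \<open>m \<mapsto> \<parallel>a m\<parallel>\<close>: it is the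
  initial topology of the maps \<open>m \<mapsto> m a\<close> and \<open>m \<mapsto> a m\<close> into \<open>A\<close> with its norm topology.
\<close>

definition strict_topology :: "'a::cstar_algebra multiplier topology" where
  "strict_topology = topology_generated_by
     ({{m. lact m a \<in> U} | a U. open U} \<union> {{m. ract a m \<in> U} | a U. open U})"

definition strictly_continuous_on ::
    "'x::topological_space set \<Rightarrow> ('x \<Rightarrow> 'a::cstar_algebra multiplier) \<Rightarrow> bool" where
  "strictly_continuous_on S f \<longleftrightarrow> continuous_map (top_of_set S) strict_topology f"

lemma strictly_continuous_on_iff:
  "strictly_continuous_on S f \<longleftrightarrow>
     (\<forall>a. continuous_on S (\<lambda>x. lact (f x) a) \<and> continuous_on S (\<lambda>x. ract a (f x)))"
proof
  assume L: "strictly_continuous_on S f"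
  have gen: "openin (top_of_set S) (S \<inter> f -` W)" if "openin strict_topology W" for W
    using L that unfolding strictly_continuous_on_def continuous_map_def
    by (simp add: Int_def vimage_def)
  have "openin strict_topology {m. lact m a \<in> U}" "openin strict_topology {m. ract a m \<in> U}"
    if "open U" for a :: 'b and U
    unfolding strict_topology_def
    by (rule topology_generated_by_Basis; use that in blast)+
  from gen[OF this(1)] gen[OF this(2)]
  show "\<forall>a. continuous_on S (\<lambda>x. lact (f x) a) \<and> continuous_on S (\<lambda>x. ract a (f x))"
    by (simp add: continuous_on_open_gen[of _ _ UNIV] vimage_def)
next
  assume R: "\<forall>a. continuous_on S (\<lambda>x. lact (f x) a) \<and> continuous_on S (\<lambda>x. ract a (f x))"
  show "strictly_continuous_on S f"
    unfolding strictly_continuous_on_def strict_topology_def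
  proof (rule continuous_on_generated_topo)
    fix W :: "'b multiplier set"
    assume "W \<in> {{m. lact m a \<in> U} | a U. open U} \<union> {{m. ract a m \<in> U} | a U. open U}"
    then show "openin (top_of_set S) (f -` W \<inter> topspace (top_of_set S))"
      using R by (auto simp: continuous_on_open_gen[of _ _ UNIV] vimage_def Int_def conj_commute)
  next
    show "f ` topspace (top_of_set S) \<subseteq>
      \<Union> ({{m. lact m a \<in> U} | a U. open U} \<union> {{m. ract a m \<in> U} | a U. open U})"
      by (rule order_trans[OF subset_UNIV]) (force intro: exI[of _ UNIV])
  qed
qed

text \<open>
  The extension of a non-degenerate *-homomorphism \<open>\<psi> : A \<rightarrow> B\<close> to \<open>\<M>(A) \<rightarrow> \<M>(B)\<close>.
  Non-degeneracy guarantees existence and uniqueness; for degenerate \<open>\<psi>\<close> the value is unspecified.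
\<close>

definition mext ::
    "('a::cstar_algebra \<Rightarrow> 'b::cstar_algebra) \<Rightarrow> 'a multiplier \<Rightarrow> 'b multiplier" where
  "mext \<psi> = (THE \<Psi>. star_hom \<Psi> \<and> \<Psi> 1 = 1 \<and> (\<forall>a. \<Psi> (embed a) = embed (\<psi> a)))"


section \<open>Twisted actions and cocycle morphisms\<close>

text \<open>
  Groups are written additively (\<open>s + t\<close> is the product \<open>st\<close>, \<open>0\<close> the neutral element), following
  the library class \<open>topological_group_add\<close>; this class does not assume commutativity.
\<close>

type_synonym ('g, 'a) twisted_pair = "('g \<Rightarrow> 'a \<Rightarrow> 'a) \<times> ('g \<Rightarrow> 'g \<Rightarrow> 'a multiplier)"

type_synonym ('g, 'a, 'b) cocycle_pair = "('a \<Rightarrow> 'b) \<times> ('g \<Rightarrow> 'b multiplier)"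

fun twisted_action ::
    "('g::topological_group_add, 'a::cstar_algebra) twisted_pair \<Rightarrow> bool" where
  "twisted_action (\<alpha>, \<uu>) \<longleftrightarrow>
     (\<forall>g. star_automorphism (\<alpha> g)) \<and>
     (\<forall>a. continuous_on UNIV (\<lambda>g. \<alpha> g a)) \<and>
     (\<forall>s t. unitary (\<uu> s t)) \<and>
     strictly_continuous_on UNIV (\<lambda>(s, t). \<uu> s t) \<and>
     \<alpha> 0 = id \<and>
     (\<forall>s t. \<alpha> s \<circ> \<alpha> t = Ad (\<uu> s t) \<circ> \<alpha> (s + t)) \<and>
     (\<forall>s. \<uu> s 0 = 1 \<and> \<uu> 0 s = 1) \<and>
     (\<forall>r s t. mext (\<alpha> r) (\<uu> s t) * \<uu> r (s + t) = \<uu> r s * \<uu> (r + s) t)"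

fun cocycle_morphism ::
    "('g::topological_group_add, 'a::cstar_algebra) twisted_pair \<Rightarrow>
     ('g, 'b::cstar_algebra) twisted_pair \<Rightarrow> ('g, 'a, 'b) cocycle_pair \<Rightarrow> bool" where
  "cocycle_morphism (\<alpha>, \<uu>) (\<beta>, \<vv>) (\<psi>, v) \<longleftrightarrow>
     star_hom \<psi> \<and> nondegenerate \<psi> \<and>
     (\<forall>g. unitary (v g)) \<and>
     strictly_continuous_on UNIV v \<and>
     (\<forall>g. Ad (v g) \<circ> \<beta> g \<circ> \<psi> = \<psi> \<circ> \<alpha> g) \<and>
     (\<forall>g h. mext \<psi> (\<uu> g h) = v g * mext (\<beta> g) (v h) * \<vv> g h * star (v (g + h)))"

fun cocycle_comp ::
    "('g, 'b::cstar_algebra, 'c::cstar_algebra) cocycle_pair \<Rightarrow>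
     ('g, 'a::cstar_algebra, 'b) cocycle_pair \<Rightarrow> ('g, 'a, 'c) cocycle_pair" where
  "cocycle_comp (\<psi>, v) (\<phi>, u) = (\<psi> \<circ> \<phi>, \<lambda>g. mext \<psi> (u g) * v g)"

definition cocycle_id :: "('g, 'a::cstar_algebra, 'a) cocycle_pair" where
  "cocycle_id = (id, \<lambda>_. 1)"

fun cocycle_conjugacy ::
    "('g::topological_group_add, 'a::cstar_algebra) twisted_pair \<Rightarrow>
     ('g, 'b::cstar_algebra) twisted_pair \<Rightarrow> ('g, 'a, 'b) cocycle_pair \<Rightarrow> bool" where
  "cocycle_conjugacy \<A> \<B> (\<phi>, u) \<longleftrightarrow> cocycle_morphism \<A> \<B> (\<phi>, u) \<and> bij \<phi>"

fun cocycle_inverse ::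
    "('g, 'a::cstar_algebra, 'b::cstar_algebra) cocycle_pair \<Rightarrow> ('g, 'b, 'a) cocycle_pair" where
  "cocycle_inverse (\<phi>, u) = (inv \<phi>, \<lambda>g. star (mext (inv \<phi>) (u g)))"

text \<open>
  \<open>asymptotic_unitary_conjugate \<B> (\<psi>, v) (\<phi>, u)\<close>: the cocycle morphism \<open>(\<psi>, v)\<close> into \<open>\<B>\<close> is an
  asymptotic unitary conjugate of \<open>(\<phi>, u)\<close>. Only nonempty \<open>K\<close> are considered because \<open>Sup {}\<close> has
  no meaningful value in the reals; the norms in question are bounded by 2 times the norm of \<open>b\<close>.
\<close>

fun asymptotic_unitary_conjugate ::
    "('g::topological_group_add, 'b::cstar_algebra) twisted_pair \<Rightarrow>
     ('g, 'a::cstar_algebra, 'b) cocycle_pair \<Rightarrow> ('g, 'a, 'b) cocycle_pair \<Rightarrow> bool" where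
  "asymptotic_unitary_conjugate (\<beta>, \<vv>) (\<psi>, v) (\<phi>, u) \<longleftrightarrow>
     (\<exists>w :: real \<Rightarrow> 'b multiplier.
        (\<forall>t\<ge>0. unitary (w t)) \<and>
        strictly_continuous_on {0..} w \<and>
        (\<forall>a. ((\<lambda>t. Ad (w t) (\<phi> a)) \<longlongrightarrow> \<psi> a) at_top) \<and>
        (\<forall>b K. compact K \<and> K \<noteq> {} \<longrightarrow>
           ((\<lambda>t. SUP g\<in>K. norm (ract b (v g - w t * u g * star (mext (\<beta> g) (w t)))))
              \<longlongrightarrow> 0) at_top))"

definition asymptotically_unitarily_equivalent ::
    "('g::topological_group_add, 'b::cstar_algebra) twisted_pair \<Rightarrow>
     ('g, 'a::cstar_algebra, 'b) cocycle_pair \<Rightarrow> ('g, 'a, 'b) cocycle_pair \<Rightarrow> bool" where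
  "asymptotically_unitarily_equivalent \<B> \<Phi> \<Psi> \<longleftrightarrow>
     asymptotic_unitary_conjugate \<B> \<Psi> \<Phi> \<and> asymptotic_unitary_conjugate \<B> \<Phi> \<Psi>"

end

theory Submission
  imports Defs
begin

text \<open>
  Encode a cocycle morphism \<open>(\<phi>, u)\<close> by the contractions \<open>\<Phi>\<^sub>g(a) = \<phi>(a) u\<^sub>g\<close>. Composition becomes pointwise
  composition, conjugation by a unitary \<open>w\<close> becomes composition with the isometries \<open>b \<mapsto> w b \<beta>\<^sub>g(w)\<^sup>*\<close>, and,
  by non-degeneracy, asymptotic conjugacy becomes convergence of these maps, pointwise in \<open>a\<close> and uniformly
  for \<open>g\<close> in compact sets. The equivariant problem thus reduces to an Elliott intertwining of contractions.
  Unitary paths need not start at \<open>1\<close>; but if \<open>Ad(z\<^sub>t)\<Phi>\<Psi> \<rightarrow> id\<close> and \<open>Ad(w\<^sub>t)\<Psi>\<Phi> \<rightarrow> id\<close> with \<open>w\<^sub>0 = 1\<close>, then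
  \<open>z\<^sub>s\<^sub>+\<^sub>t \<phi>(w\<^sub>t) z\<^sub>s\<^sub>+\<^sub>t\<^sup>*\<close> starts at \<open>1\<close>, also conjugates \<open>\<Phi>\<Psi>\<close> to the identity, and hardly moves \<open>\<Phi>\<close> on the finite
  sets where \<open>Ad(w\<^sub>t)\<Psi>\<Phi>\<close> is close to the identity for all \<open>t\<close>. Alternating between \<open>\<Phi>\<close> and \<open>\<Psi>\<close> and concatenating
  the paths yields mutually inverse limits, from which the unitary cocycles are read off.
\<close>

text \<open>\<open>mext\<close> is a definite description, so existence and uniqueness of extensions
  must come before everything else. Spectral theory is avoided: contractivity of *-homomorphisms
  rests on a fixed point equation for a square root, the extension on iterated Cauchy-Schwarz
  estimates, and nondegeneracy does the work of approximate units. The unitaries \<open>u g\<close>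
  are awkward in limits, being controlled only strictly. The values \<open>\<phi>(a) u g\<close> lie
  in the algebra itself, so completeness produces limit maps before any limit cocycle is known;
  multiplicativity over a Fell bundle and bijectivity then suffice to recover one. Paths must start
  at \<open>1\<close> because each new path is multiplied onto the unitary accumulated so far, and
  the concatenation has to be continuous at integer times. Smallness on finite sets is required
  along whole paths, not only at their ends, since asymptotic conjugacy sees all times; tolerances
  \<open>1 / 2 ^ n\<close> make the total movement summable.\<close>

lemma star_zero [simp]: "star (0 :: 'a::complex_star_algebra) = 0"
  using star_add[of "0 :: 'a" 0] by simp

lemma star_minus: "star (- x) = - star (x :: 'a::complex_star_algebra)"
  using star_add[of x "- x"] by (simp add: eq_neg_iff_add_eq_0 add.commute)

lemma star_diff: "star (x - y) = star x - star (y :: 'a::complex_star_algebra)"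
  using star_add[of x "- y"] by (simp add: star_minus)

lemma star_scaleR: "star (r *\<^sub>R x) = r *\<^sub>R star (x :: 'a::complex_star_algebra)"
  by (simp add: scaleR_scaleC star_scaleC)

lemma star_one [simp]: "star (1 :: 'a::cstar_algebra multiplier) = 1"
  by (intro multiplier_eqI) (simp_all add: star_star)

lemma scaleC_minus_left: "(- c) *\<^sub>C x = - (c *\<^sub>C (x :: 'a::complex_star_algebra))"
proof -
  have "0 *\<^sub>C x = 0" by (metis add_cancel_right_right scaleC_add_left add_0)
  then have "(- c) *\<^sub>C x + c *\<^sub>C x = 0" by (simp flip: scaleC_add_left)
  then show ?thesis by (simp add: eq_neg_iff_add_eq_0)
qed

lemma bounded_linear_star: "bounded_linear (star :: 'a::cstar_algebra \<Rightarrow> 'a)"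
  by (rule bounded_linear_intro[where K = 1]) (simp_all add: star_add star_scaleR norm_star)

lemmas continuous_on_star [continuous_intros] =
  bounded_linear.continuous_on[OF bounded_linear_star]

lemmas tendsto_star [tendsto_intros] = bounded_linear.tendsto[OF bounded_linear_star]

lemma dist_star: "dist (star x) (star y) = dist x (y :: 'a::cstar_algebra)"
  by (simp add: dist_norm norm_star flip: star_diff)

lemma norm_mult_star_self: "norm (x * star x) = (norm (x :: 'a::cstar_algebra))\<^sup>2"
  using norm_star_mult_self[of "star x"] by (simp add: star_star norm_star)

lemma right_cancel:
  fixes x y :: "'a::cstar_algebra"
  assumes "\<And>b. x * b = y * b"
  shows "x = y"
proof -
  have "x - y = 0" by (rule zero_if_right_mult_zero) (simp add: left_diff_distrib assms)
  then show ?thesis by simp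
qed

lemma left_cancel:
  fixes x y :: "'a::cstar_algebra"
  assumes "\<And>b. b * x = b * y"
  shows "x = y"
proof -
  have "star x = star y"
    by (rule right_cancel) (metis assms star_mult star_star)
  then show ?thesis by (metis star_star)
qed

section \<open>Contractivity of *-homomorphisms\<close>

lemma
  assumes "star_hom f"
  shows star_hom_add: "f (x + y) = f x + f y"
    and star_hom_scaleC: "f (c *\<^sub>C x) = c *\<^sub>C f x"
    and star_hom_mult: "f (x * y) = f x * f y"
    and star_hom_star: "f (star x) = star (f x)"
    and star_hom_scaleR: "f (r *\<^sub>R x) = r *\<^sub>R f x"
  using assms by (simp_all add: star_hom_def scaleR_scaleC)

lemma star_hom_linear: "star_hom f \<Longrightarrow> linear f"
  by (intro linearI) (simp_all add: star_hom_add star_hom_scaleR)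

lemma star_hom_diff:
  assumes "star_hom f"
  shows "f (x - y) = f x - f y"
  using star_hom_linear[OF assms] by (rule linear_diff)

text \<open>The element \<open>1 - y\<close> of the unitization is a square root of \<open>1 - h\<^sup>2\<close>.\<close>

lemma sqrt_one_minus_square:
  fixes h :: "'a::cstar_algebra"
  assumes h: "star h = h" "norm h < 1"
  obtains y where "star y = y" "y * h = h * y" "y + y - y * y = h * h"
proof -
  define S where "S = {y. norm y \<le> norm h \<and> star y = y \<and> y * h = h * y}"
  \<comment> \<open>Expanding \<open>(1 - y)^2 = 1 - h^2\<close> gives
    \<open>y = (h^2 + y^2) / 2\<close>, the fixed point equation solved here. On the ball of radius
    \<open>norm h\<close> the Lipschitz constant is \<open>norm h\<close>. Self-adjointness and
    commuting with \<open>h\<close> are closed conditions preserved by \<open>T\<close>, so the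
    fixed point inherits them.\<close>
  define T where "T y = (1/2) *\<^sub>R (h * h + y * y)" for y
  have "closed S" unfolding S_def
    by (intro closed_Collect_conj closed_Collect_le closed_Collect_eq continuous_intros)
  have nn: "norm (y * z) \<le> norm h * norm h" if "norm y \<le> norm h" "norm z \<le> norm h" for y z :: 'a
    by (rule order_trans[OF norm_mult_ineq mult_mono[OF that]]) auto
  have hh: "norm h * norm h \<le> norm h" using h(2) by (simp add: mult_left_le)
  have "\<exists>!y\<in>S. T y = y"
  proof (rule Banach_fix)
    show "complete S" using \<open>closed S\<close> by (simp add: complete_eq_closed)
    show "S \<noteq> {}" by (auto simp: S_def intro!: exI[of _ 0])
    show "0 \<le> norm h" "norm h < 1" using h by auto
    show "T ` S \<subseteq> S"
    proof
      fix z assume "z \<in> T ` S"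
      then obtain y where y: "y \<in> S" "z = T y" by auto
      have c: "y * h = h * y" and s: "star y = y" and n: "norm y \<le> norm h"
        using y by (auto simp: S_def)
      have "norm (h * h + y * y) \<le> norm h * norm h + norm h * norm h"
        by (rule order_trans[OF norm_triangle_ineq add_mono[OF nn nn]]) (use n in auto)
      then have "norm z \<le> norm h" using hh y by (simp add: T_def)
      moreover have "star z = z" using s h y
        by (simp add: T_def star_scaleR star_add star_mult)
      moreover have "y * y * h = h * (y * y)" by (metis c mult.assoc)
      then have "z * h = h * z" using y by (simp add: T_def algebra_simps)
      ultimately show "z \<in> S" by (simp add: S_def)
    qed
    fix x y assume "x \<in> S" "y \<in> S"
    then have n: "norm x \<le> norm h" "norm y \<le> norm h" by (auto simp: S_def)
    have e: "T x - T y = (1/2) *\<^sub>R (x * (x - y) + (x - y) * y)"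
      by (simp add: T_def algebra_simps flip: scaleR_diff_right)
    have "norm (x * (x - y) + (x - y) * y) \<le> norm h * norm (x - y) + norm (x - y) * norm h"
      by (rule order_trans[OF norm_triangle_ineq add_mono])
        (rule order_trans[OF norm_mult_ineq], intro mult_mono n order_refl norm_ge_zero)+
    then show "dist (T x) (T y) \<le> norm h * dist x y"
      by (simp add: dist_norm e)
  qed
  then obtain y where y: "y \<in> S" "T y = y" by auto
  have "h * h + y * y = 2 *\<^sub>R T y" by (simp add: T_def)
  also have "\<dots> = y + y" using y by (simp add: scaleR_2)
  finally have "y + y - y * y = h * h" by (simp add: algebra_simps)
  with y show ?thesis using that[of y] by (simp add: S_def)
qed

text \<open>
  If \<open>k\<close> is the image of \<open>h\<close> and \<open>s\<close> that of the square root, then \<open>k \<plusminus> i s\<close> are unitary, and \<open>k\<close>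
  is their mean.
\<close>

lemma star_hom_contractive_self_adjoint:
  fixes f :: "'a::cstar_algebra \<Rightarrow> 'b::cstar_algebra"
  assumes f: "star_hom f" and h: "star h = h" "norm h < 1"
  shows "norm (f h) \<le> 1"
proof -
  obtain y where y: "star y = y" "y * h = h * y" "y + y - y * y = h * h"
    using sqrt_one_minus_square[OF h] by blast
  define k z where "k = f h" and "z = f y"
  have ks: "star k = k" "star z = z" "z * k = k * z" "z + z - z * z = k * k"
    unfolding k_def z_def
    by (metis f h(1) star_hom_star, metis f y(1) star_hom_star, metis f y(2) star_hom_mult,
      metis f y(3) star_hom_mult star_hom_add star_hom_diff)
  \<comment> \<open>With \<open>s = 1 - z\<close> the vector is \<open>(k + c s) b\<close>, where
    \<open>c\<close> is \<open>\<i>\<close> or \<open>- \<i>\<close>. As there is no unit, unitarity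
    is replaced by isometry of left multiplication.\<close>
  have iso: "norm (k * b + c *\<^sub>C (b - z * b)) = norm b" if c: "cnj c = - c" "c * c = -1" for b c
  proof -
    define d X W where "d = b - z * b" and "X = k * b" and "W = c *\<^sub>C d"
    have sd: "star d = star b - star b * z" and sX: "star X = star b * k"
      by (simp_all add: d_def X_def star_diff star_mult ks)
    have sW: "star W = - (c *\<^sub>C star d)" by (simp add: W_def star_scaleC c scaleC_minus_left)
    have "star W * W = - (c *\<^sub>C c *\<^sub>C (star d * d))"
      unfolding sW mult_minus_left mult_scaleC_left by (simp add: W_def mult_scaleC_right)
    then have 1: "star W * W = star d * d"
      by (simp add: scaleC_scaleC c scaleC_minus_left scaleC_one)
    have "k * (z * b) = z * (k * b)" by (metis ks(3) mult.assoc)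
    then have "star b * (k * d) = star d * (k * b)"
      unfolding sd by (simp add: d_def left_diff_distrib right_diff_distrib mult.assoc)
    then have 2: "star X * W + star W * X = 0"
      by (simp only: sW sX mult_minus_left mult_scaleC_left) (simp add: X_def W_def mult_scaleC_right mult.assoc)
    have "star X * X + star d * d = star b * (k * k - (z + z - z * z)) * b + star b * b"
      unfolding sX sd by (simp add: d_def X_def algebra_simps)
    then have 3: "star X * X + star d * d = star b * b" by (simp add: ks)
    have "star (X + W) * (X + W) = (star X * X + star W * W) + (star X * W + star W * X)"
      by (simp add: star_add algebra_simps)
    then have "star (X + W) * (X + W) = star b * b" by (simp add: 1 2 3)
    then have "(norm (X + W))\<^sup>2 = (norm b)\<^sup>2" by (metis norm_star_mult_self)
    then show ?thesis by (simp add: d_def X_def W_def)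
  qed
  have "norm (k * b) \<le> norm b" for b
  proof -
    let ?d = "b - z * b"
    have "2 *\<^sub>R (k * b) = (k * b + \<i> *\<^sub>C ?d) + (k * b + (- \<i>) *\<^sub>C ?d)"
      by (simp add: scaleR_2 scaleC_minus_left)
    then have "norm (2 *\<^sub>R (k * b)) \<le> norm b + norm b"
      using norm_triangle_ineq[of "k * b + \<i> *\<^sub>C ?d" "k * b + (- \<i>) *\<^sub>C ?d"] iso[of \<i> b] iso[of "- \<i>" b]
      by simp
    then show ?thesis by simp
  qed
  \<comment> \<open>The bound on left multiplication, applied to \<open>k\<close> itself, becomes a
    bound on \<open>norm k\<close> by the C*-identity.\<close>
  from this[of k] have "norm k * norm k \<le> norm k"
    using norm_star_mult_self[of k] by (simp add: ks power2_eq_square)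
  then have "norm k \<le> 1" by (cases "norm k = 0") auto
  then show ?thesis by (simp add: k_def)
qed

text \<open>The C*-identity reduces the claim to the self-adjoint element \<open>star b * b\<close>.
  The previous lemma needs norm strictly below 1, so \<open>a\<close> is scaled by an arbitrary
  \<open>r > norm a\<close>.\<close>

lemma star_hom_norm_le:
  fixes f :: "'a::cstar_algebra \<Rightarrow> 'b::cstar_algebra"
  assumes f: "star_hom f"
  shows "norm (f a) \<le> norm a"
proof (rule dense_ge)
  fix r assume r: "norm a < r"
  then have r0: "r > 0" using norm_ge_zero[of a] by linarith
  define b where "b = (1/r) *\<^sub>R a"
  have "norm b < 1" using r r0 by (simp add: b_def)
  then have "norm (star b * b) < 1" by (simp add: norm_star_mult_self power_less_one_iff)
  then have "norm (f (star b * b)) \<le> 1"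
    by (intro star_hom_contractive_self_adjoint f) (simp_all add: star_mult star_star)
  then have "(norm (f b))\<^sup>2 \<le> 1"
    by (simp add: star_hom_mult[OF f] star_hom_star[OF f] norm_star_mult_self)
  then have "norm (f b) \<le> 1" by (simp add: power_le_one_iff abs_square_le_1)
  moreover have "f b = (1/r) *\<^sub>R f a" by (simp add: b_def star_hom_scaleR[OF f])
  ultimately show "norm (f a) \<le> r" using r0 by (simp add: field_simps)
qed

lemma star_hom_bounded_linear: "star_hom f \<Longrightarrow> bounded_linear f"
  for f :: "'a::cstar_algebra \<Rightarrow> 'b::cstar_algebra"
  by (rule bounded_linear_intro[where K = 1])
    (auto simp: star_hom_add star_hom_scaleR star_hom_norm_le)

lemma star_hom_dist_le: "star_hom f \<Longrightarrow> dist (f x) (f y) \<le> dist x y"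
  for f :: "'a::cstar_algebra \<Rightarrow> 'b::cstar_algebra"
  by (metis dist_norm star_hom_diff star_hom_norm_le)

lemma star_hom_inv:
  assumes "star_hom f" "bij f"
  shows "star_hom (inv f)"
proof -
  note i = bij_is_inj[OF assms(2)] and s = bij_is_surj[OF assms(2)]
  have "inv f (x + y) = inv f x + inv f y" "inv f (c *\<^sub>C x) = c *\<^sub>C inv f x"
    "inv f (x * y) = inv f x * inv f y" "inv f (star x) = star (inv f x)" for x y c
    by (simp_all add: inv_f_eq[OF i] star_hom_add[OF assms(1)] star_hom_scaleC[OF assms(1)]
        star_hom_mult[OF assms(1)] star_hom_star[OF assms(1)] surj_f_inv_f[OF s])
  then show ?thesis by (simp add: star_hom_def)
qed

section \<open>Extension of non-degenerate *-homomorphisms to multipliers\<close>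

lemma dense_closed_induct:
  assumes "closure X = UNIV" "closed {x. P x}" "\<And>x. x \<in> X \<Longrightarrow> P x"
  shows "P x"
  using closure_minimal[of X "{x. P x}"] assms by auto

text \<open>The map is given by its graph \<open>V\<close>, because a formula on generators need not
  be single-valued. The bound, applied to differences, makes \<open>V\<close> single-valued and
  Lipschitz, hence extendable by completeness of the target.\<close>

lemma bounded_linear_extension_dense:
  fixes V :: "('x::real_normed_vector \<times> 'y::banach) set"
  assumes V: "subspace V" and bd: "\<And>x y. (x, y) \<in> V \<Longrightarrow> norm y \<le> K * norm x"
    and dense: "closure (fst ` V) = UNIV"
  obtains L where "bounded_linear L" "\<And>x y. (x, y) \<in> V \<Longrightarrow> L x = y"
proof -
  \<comment> \<open>\<open>K\<close> may be negative, a Lipschitz constant may not.\<close>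
  define C where "C = max K 0"
  have bd': "norm y \<le> C * norm x" if "(x, y) \<in> V" for x y
    using bd[OF that] mult_right_mono[of K C "norm x"] by (simp add: C_def)
  have sub: "(x - x', y - y') \<in> V" if "(x, y) \<in> V" "(x', y') \<in> V" for x x' y y'
    using subspace_diff[OF V that] by simp
  define f where "f x = (SOME y. (x, y) \<in> V)" for x
  have fV: "(x, f x) \<in> V" if "x \<in> fst ` V" for x
    using that unfolding f_def by (auto intro: someI)
  have feq: "f x = y" if "(x, y) \<in> V" for x y
    using bd'[OF sub[OF fV that]] that by force
  have "uniformly_continuous_on (fst ` V) f"
  proof (rule lipschitz_on_uniformly_continuous)
    show "C-lipschitz_on (fst ` V) f"
      by (rule lipschitz_onI) (use bd'[OF sub[OF fV fV]] in \<open>auto simp: dist_norm C_def\<close>)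
  qed
  then obtain g where g: "uniformly_continuous_on (closure (fst ` V)) g"
      "\<And>x. x \<in> fst ` V \<Longrightarrow> f x = g x"
    using uniformly_continuous_on_extension_on_closure by (metis (no_types, lifting))
  have cg: "continuous_on UNIV g"
    using uniformly_continuous_imp_continuous[OF g(1)] dense by simp
  note cc = continuous_on_compose2[OF cg]
  have gV: "g x = y" if "(x, y) \<in> V" for x y
    using feq[OF that] g(2)[of x] that by force
  have "g (fst p + snd p) = g (fst p) + g (snd p)" for p
  proof (rule dense_closed_induct[of "fst ` V \<times> fst ` V"])
    show "closure (fst ` V \<times> fst ` V) = UNIV" by (simp add: closure_Times dense)
    show "closed {p. g (fst p + snd p) = g (fst p) + g (snd p)}"
      by (intro closed_Collect_eq continuous_intros cc) auto
    fix p assume "p \<in> fst ` V \<times> fst ` V"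
    then obtain y y' where "(fst p, y) \<in> V" "(snd p, y') \<in> V" by auto
    then show "g (fst p + snd p) = g (fst p) + g (snd p)"
      using subspace_add[OF V, of "(fst p, y)" "(snd p, y')"] by (auto simp: gV)
  qed
  from this[of "(_, _)"] have add: "g (x + y) = g x + g y" for x y by simp
  have scale: "g (r *\<^sub>R x) = r *\<^sub>R g x" for r x
  proof (rule dense_closed_induct[OF dense])
    show "closed {x. g (r *\<^sub>R x) = r *\<^sub>R g x}"
      by (intro closed_Collect_eq continuous_intros cc) auto
    fix x assume "x \<in> fst ` V"
    then show "g (r *\<^sub>R x) = r *\<^sub>R g x"
      using subspace_scale[OF V] by (force simp: gV)
  qed
  have "norm (g x) \<le> C * norm x" for x
  proof (rule dense_closed_induct[OF dense])
    show "closed {x. norm (g x) \<le> C * norm x}"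
      by (intro closed_Collect_le continuous_intros cc) auto
    fix x assume "x \<in> fst ` V"
    then show "norm (g x) \<le> C * norm x" using bd' by (force simp: gV)
  qed
  then have "bounded_linear g"
    by (intro bounded_linear_intro[where K = C]) (simp_all add: add scale mult.commute)
  then show ?thesis using that gV by blast
qed

lemma multiplier_eq_lactI:
  assumes "\<And>a. lact m a = lact n a"
  shows "m = n"
proof (rule multiplier_eqI[OF assms])
  show "ract a m = ract a n" for a by (rule right_cancel) (simp add: ract_mult_lact assms)
qed

lemma bounded_linear_lact: "bounded_linear (lact m)"
  using bounded_clinear_lact[of m] by (simp add: bounded_clinear_def)

lemma bounded_linear_ract: "bounded_linear (\<lambda>a. ract a m)"
  using bounded_clinear_ract[of m] by (simp add: bounded_clinear_def)

lemma star_lact: "star (lact m a) = ract (star a) (star m)"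
  by (simp add: star_star)

lemma star_ract: "star (ract a m) = lact (star m) (star a)"
  by (simp add: star_star)

lemma nondegenerate_eqI:
  fixes f g :: "'b::cstar_algebra \<Rightarrow> 'c::real_normed_vector"
  assumes "nondegenerate \<psi>" "bounded_linear f" "bounded_linear g"
    and "\<And>a b. f (\<psi> a * b) = g (\<psi> a * b)"
  shows "f x = g x"
proof (rule dense_closed_induct[where P = "\<lambda>x. f x = g x"])
  show "closure (span {\<psi> a * b |a b. True}) = UNIV"
    using assms(1) by (simp add: nondegenerate_def)
  show "closed {x. f x = g x}"
    using assms(2,3) by (intro closed_Collect_eq linear_continuous_on)
  have l: "linear f" "linear g" using assms(2,3) by (simp_all add: bounded_linear.linear)
  show "f x = g x" if "x \<in> span {\<psi> a * b |a b. True}" for x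
    by (rule linear_eq_on[OF l that]) (use assms(4) in auto)
qed

text \<open>Put \<open>s n = r n / (x * H ^ (2 ^ n))\<close>. Then
  \<open>(s n)^2 \<le> s (Suc n)\<close>, so \<open>s 0 ^ (2 ^ n) \<le> s n \<le> C / x\<close> for
  all \<open>n\<close>, which is impossible if \<open>s 0 > 1\<close>. However large
  \<open>C\<close> is, it drops out.\<close>

lemma geometric_growth_bound:
  fixes r :: "nat \<Rightarrow> real"
  assumes r0: "\<And>n. 0 \<le> r n" and x: "0 \<le> x" and H: "0 < H"
    and sq: "\<And>n. (r n)\<^sup>2 \<le> x * r (Suc n)" and bd: "\<And>n. r n \<le> C * H ^ (2 ^ n)"
  shows "r 0 \<le> H * x"
proof (cases "x = 0")
  case True
  then show ?thesis using sq[of 0] by simp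
next
  case False
  with x have x: "x > 0" by simp
  define s where "s n = r n / (x * H ^ (2 ^ n))" for n
  have s0: "s n \<ge> 0" for n using r0 x H by (simp add: s_def)
  have step: "(s n)\<^sup>2 \<le> s (Suc n)" for n
  proof -
    have "(s n)\<^sup>2 = (r n)\<^sup>2 / (x\<^sup>2 * H ^ (2 ^ Suc n))"
      by (simp add: s_def power_divide power_mult_distrib power_mult[symmetric] mult.commute)
    also have "\<dots> \<le> (x * r (Suc n)) / (x\<^sup>2 * H ^ (2 ^ Suc n))"
      using sq x H by (intro divide_right_mono) auto
    also have "\<dots> = s (Suc n)" using x by (simp add: s_def power2_eq_square)
    finally show ?thesis .
  qed
  have pow: "s 0 ^ (2 ^ n) \<le> s n" for n
  proof (induction n)
    case (Suc n)
    have "s 0 ^ (2 ^ Suc n) = (s 0 ^ (2 ^ n))\<^sup>2" by (simp add: power_mult[symmetric] mult.commute)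
    also have "\<dots> \<le> (s n)\<^sup>2" using Suc s0 by (intro power_mono) auto
    finally show ?case using step[of n] by linarith
  qed simp
  have bds: "s n \<le> C / x" for n
    using bd[of n] x H by (simp add: s_def divide_simps)
  have "s 0 \<le> 1"
  proof (rule ccontr)
    assume "\<not> s 0 \<le> 1"
    then have s1: "s 0 > 1" by simp
    obtain n where "C / x < s 0 ^ n" using real_arch_pow[OF s1] by blast
    also have "\<dots> \<le> s 0 ^ (2 ^ n)" using s1 by (intro power_increasing) (auto intro: less_imp_le)
    finally show False using pow[of n] bds[of n] by linarith
  qed
  then show ?thesis using x H by (simp add: s_def field_simps)
qed

text \<open>The value that the extension of \<open>\<psi>\<close> at \<open>m\<close> must take on
  \<open>lact_sum \<psi> 1 l\<close>. A list records one way of writing an element as a sum of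
  products; independence of that choice is what has to be proved.\<close>

definition lact_sum ::
    "('a::cstar_algebra \<Rightarrow> 'b::cstar_algebra) \<Rightarrow> 'a multiplier \<Rightarrow> ('a \<times> 'b) list \<Rightarrow> 'b" where
  "lact_sum \<psi> m l = (\<Sum>(a, b)\<leftarrow>l. \<psi> (lact m a) * b)"

lemma lact_sum_simps [simp]:
  "lact_sum \<psi> m [] = 0"
  "lact_sum \<psi> m ((a, b) # l) = \<psi> (lact m a) * b + lact_sum \<psi> m l"
  "lact_sum \<psi> m (k @ l) = lact_sum \<psi> m k + lact_sum \<psi> m l"
  by (simp_all add: lact_sum_def)

text \<open>A multiplier moves across the product,
  \<open>star (m a) * n a' = star a * (star m * n) a'\<close>, so only \<open>star m * n\<close> is
  seen. This trades \<open>(h, h)\<close> for \<open>(1, h^2)\<close> when \<open>h\<close> is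
  self-adjoint, and \<open>(m, m)\<close> for \<open>(1, star m * m)\<close>.\<close>

lemma lact_sum_inner_eq:
  assumes \<psi>: "star_hom \<psi>" and eq: "star m * n = star p * q"
  shows "star (lact_sum \<psi> m k) * lact_sum \<psi> n l = star (lact_sum \<psi> p k) * lact_sum \<psi> q l"
proof -
  have gen: "star (\<psi> (lact m a) * b) * (\<psi> (lact n a') * b') =
      star b * \<psi> (star a * lact (star m * n) a') * b'" for m n a b a' b'
  proof -
    have "star (lact m a) * lact n a' = star a * lact (star m * n) a'"
      unfolding star_lact ract_mult_lact by (simp add: lact_times' del: lact_star')
    then have "\<psi> (star (lact m a)) * \<psi> (lact n a') = \<psi> (star a * lact (star m * n) a')"
      by (metis \<psi> star_hom_mult)
    then show ?thesis by (simp add: star_mult star_hom_star[OF \<psi>] mult.assoc) (metis mult.assoc)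
  qed
  have one: "star (\<psi> (lact m a) * b) * lact_sum \<psi> n l = star (\<psi> (lact p a) * b) * lact_sum \<psi> q l"
    for a b
  proof (induction l)
    case (Cons c l)
    then show ?case by (cases c) (simp only: lact_sum_simps distrib_left gen eq)
  qed simp
  show ?thesis
  proof (induction k)
    case (Cons c k)
    then show ?case by (cases c) (simp only: lact_sum_simps distrib_right star_add one)
  qed simp
qed

text \<open>
  Iterating the Cauchy--Schwarz inequality \<open>\<parallel>S h\<parallel>\<^sup>2 \<le> \<parallel>S 1\<parallel> \<parallel>S (h\<^sup>2)\<parallel>\<close> for the self-adjoint multiplier
  \<open>h = m\<^sup>* m\<close> makes the dependence of the crude estimate on the list of summands disappear.
\<close>

lemma lact_sum_bound:
  assumes \<psi>: "star_hom \<psi>"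
  obtains K where "\<And>l. norm (lact_sum \<psi> m l) \<le> K * norm (lact_sum \<psi> 1 l)"
proof -
  define h where "h = star m * m"
  have hs: "star h = h" by (simp add: h_def star_mult star_star)
  obtain H where H: "H > 0" "\<And>a. norm (lact h a) \<le> norm a * H"
    using bounded_linear.pos_bounded[OF bounded_linear_lact] by blast
  have pw: "norm (lact (h ^ n) a) \<le> H ^ n * norm a" for n a
  proof (induction n)
    case (Suc n)
    have "norm (lact (h ^ Suc n) a) \<le> norm (lact (h ^ n) a) * H" using H by simp
    also have "\<dots> \<le> (H ^ n * norm a) * H" using Suc H by (intro mult_right_mono) auto
    finally show ?case by (simp add: mult_ac)
  qed simp
  have main: "norm (lact_sum \<psi> h l) \<le> H * norm (lact_sum \<psi> 1 l)" for l
  proof -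
    define C where "C = (\<Sum>(a, b)\<leftarrow>l. norm a * norm b)"
    have crude: "norm (lact_sum \<psi> (h ^ n) l) \<le> C * H ^ n" for n
      unfolding C_def
    proof (induction l)
      case (Cons c l)
      obtain a b where c: "c = (a, b)" by (cases c)
      have "norm (\<psi> (lact (h ^ n) a) * b) \<le> (H ^ n * norm a) * norm b"
        by (rule order_trans[OF norm_mult_ineq mult_right_mono])
          (auto intro: order_trans[OF star_hom_norm_le[OF \<psi>] pw])
      then show ?case using Cons c norm_triangle_ineq[of "\<psi> (lact (h ^ n) a) * b" "lact_sum \<psi> (h ^ n) l"]
        by (simp add: algebra_simps)
    qed simp
    have "norm (lact_sum \<psi> (h ^ 2 ^ 0) l) \<le> H * norm (lact_sum \<psi> 1 l)"
    proof (rule geometric_growth_bound[where C = C])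
      fix n :: nat
      have p: "star (h ^ k) = h ^ k" for k by (induction k) (simp_all add: star_mult hs power_commutes)
      have "h ^ 2 ^ n * h ^ 2 ^ n = h ^ 2 ^ Suc n" by (simp add: mult_2 flip: power_add)
      then have "star (lact_sum \<psi> (h ^ 2 ^ n) l) * lact_sum \<psi> (h ^ 2 ^ n) l =
          star (lact_sum \<psi> 1 l) * lact_sum \<psi> (h ^ 2 ^ Suc n) l"
        by (intro lact_sum_inner_eq \<psi>) (simp add: p)
      then show "(norm (lact_sum \<psi> (h ^ 2 ^ n) l))\<^sup>2 \<le>
          norm (lact_sum \<psi> 1 l) * norm (lact_sum \<psi> (h ^ 2 ^ Suc n) l)"
        by (metis norm_star_mult_self norm_mult_ineq norm_star)
    qed (use H crude in auto)
    then show ?thesis by simp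
  qed
  have "norm (lact_sum \<psi> m l) \<le> sqrt H * norm (lact_sum \<psi> 1 l)" for l
  proof -
    have "star (lact_sum \<psi> m l) * lact_sum \<psi> m l = star (lact_sum \<psi> 1 l) * lact_sum \<psi> h l"
      by (intro lact_sum_inner_eq \<psi>) (simp add: h_def)
    then have "(norm (lact_sum \<psi> m l))\<^sup>2 \<le> norm (lact_sum \<psi> 1 l) * norm (lact_sum \<psi> h l)"
      by (metis norm_star_mult_self norm_mult_ineq norm_star)
    also have "\<dots> \<le> norm (lact_sum \<psi> 1 l) * (H * norm (lact_sum \<psi> 1 l))"
      using main by (intro mult_left_mono) auto
    also have "\<dots> = (sqrt H * norm (lact_sum \<psi> 1 l))\<^sup>2"
      using H by (simp add: power_mult_distrib power2_eq_square)
    finally show ?thesis by (rule power2_le_imp_le) (use H in auto)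
  qed
  then show ?thesis using that by blast
qed

text \<open>Pairs of sums over a common list form a linear relation, as lists can be appended and
  scaled. \<open>lact_sum_bound\<close> makes it bounded and nondegeneracy makes its domain
  dense.\<close>

lemma lact_extension:
  assumes \<psi>: "star_hom \<psi>" "nondegenerate \<psi>"
  shows "\<exists>L. bounded_linear L \<and> (\<forall>a b. L (\<psi> a * b) = \<psi> (lact m a) * b)"
proof -
  define V where "V = range (\<lambda>l. (lact_sum \<psi> 1 l, lact_sum \<psi> m l))"
  have V: "(\<psi> a * b, \<psi> (lact m a) * b) \<in> V" for a b
    unfolding V_def by (rule range_eqI[of _ _ "[(a, b)]"]) simp
  have "subspace V"
  proof (rule subspaceI)
    show "0 \<in> V" unfolding V_def by (rule range_eqI[of _ _ "[]"]) (simp add: zero_prod_def)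
    show "x + y \<in> V" if xy: "x \<in> V" "y \<in> V" for x y
    proof -
      obtain k l where "x = (lact_sum \<psi> 1 k, lact_sum \<psi> m k)" "y = (lact_sum \<psi> 1 l, lact_sum \<psi> m l)"
        using xy by (auto simp: V_def)
      then show ?thesis unfolding V_def by (intro range_eqI[of _ _ "k @ l"]) simp
    qed
    show "r *\<^sub>R x \<in> V" if x: "x \<in> V" for r x
    proof -
      obtain l where x: "x = (lact_sum \<psi> 1 l, lact_sum \<psi> m l)" using x by (auto simp: V_def)
      have "lact_sum \<psi> n (map (\<lambda>(a, b). (a, r *\<^sub>R b)) l) = r *\<^sub>R lact_sum \<psi> n l" for n
        by (induction l) (auto simp: scaleR_add_right)
      then show ?thesis unfolding V_def x
        by (intro range_eqI[of _ _ "map (\<lambda>(a, b). (a, r *\<^sub>R b)) l"]) simp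
    qed
  qed
  moreover have "closure (fst ` V) = UNIV"
  proof -
    have "span {\<psi> a * b |a b. True} \<subseteq> fst ` V"
    proof (rule span_minimal)
      show "{\<psi> a * b |a b. True} \<subseteq> fst ` V" using V by (force intro: rev_image_eqI)
      show "subspace (fst ` V)"
        by (rule linear_subspace_image[OF bounded_linear.linear[OF bounded_linear_fst] \<open>subspace V\<close>])
    qed
    then show ?thesis using closure_mono \<psi>(2) unfolding nondegenerate_def by blast
  qed
  moreover obtain K where "\<And>l. norm (lact_sum \<psi> m l) \<le> K * norm (lact_sum \<psi> 1 l)"
    using lact_sum_bound[OF \<psi>(1)] by blast
  then have "norm y \<le> K * norm x" if "(x, y) \<in> V" for x y using that by (auto simp: V_def)
  ultimately obtain L where "bounded_linear L" "\<And>x y. (x, y) \<in> V \<Longrightarrow> L x = y"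
    using bounded_linear_extension_dense by (metis (no_types, lifting))
  then show ?thesis using V by blast
qed

text \<open>Only left multiplication has to be extended: right multiplication is forced to be
  \<open>R m x = star (L (star m) (star x))\<close>, and the centralizer condition is adjointness of
  \<open>L m\<close> and \<open>L (star m)\<close>. All identities compare bounded linear maps and
  are checked on products \<open>\<psi> a * b\<close>.\<close>

lemma mext_exists:
  fixes \<psi> :: "'a::cstar_algebra \<Rightarrow> 'b::cstar_algebra"
  assumes \<psi>: "star_hom \<psi>" "nondegenerate \<psi>"
  shows "\<exists>\<Psi>. star_hom \<Psi> \<and> \<Psi> 1 = 1 \<and> (\<forall>a. \<Psi> (embed a) = embed (\<psi> a))"
proof -
  obtain L where Lbl: "\<And>m. bounded_linear (L m)"
    and L: "\<And>m a b. L m (\<psi> a * b) = \<psi> (lact m a) * b"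
    using lact_extension[OF \<psi>] by metis
  note bl = bounded_linear_compose[OF Lbl] bounded_linear_compose[OF bounded_linear_mult_left]
    bounded_linear_compose[OF bounded_linear_mult_right] bounded_linear_compose[OF bounded_linear_scaleC]
    bounded_linear_compose[OF bounded_linear_star] bounded_linear_ident bounded_linear_add
    bounded_linear_mult_left bounded_linear_mult_right bounded_linear_scaleC bounded_linear_star Lbl
  note eqI = nondegenerate_eqI[OF \<psi>(2)]
  have Lc: "bounded_clinear (L m)" for m
  proof -
    have "L m (c *\<^sub>C x) = c *\<^sub>C L m x" for c x
      by (rule eqI[of "\<lambda>x. L m (c *\<^sub>C x)" "\<lambda>x. c *\<^sub>C L m x"])
        (intro bl, intro bl, simp flip: mult_scaleC_right add: L)
    then show ?thesis using Lbl by (simp add: bounded_clinear_def)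
  qed
  have Lm: "L m (x * y) = L m x * y" for m x y
    by (rule eqI[of "\<lambda>x. L m (x * y)" "\<lambda>x. L m x * y"]) (intro bl, intro bl, simp add: L mult.assoc)
  \<comment> \<open>Adjointness takes two rounds, since both arguments must be reduced to
    generators: first \<open>y\<close>, with the other one in the range of \<open>\<psi>\<close>,
    then \<open>x\<close>.\<close>
  have adj1: "star (\<psi> (lact (star m) a)) * y = star (\<psi> a) * L m y" for m a y
  proof (rule eqI[of "\<lambda>y. star (\<psi> (lact (star m) a)) * y" "\<lambda>y. star (\<psi> a) * L m y"])
    fix e f
    have "star (lact (star m) a) * e = star a * lact m e"
      unfolding star_lact star_star ract_mult_lact ..
    then have "star (\<psi> (lact (star m) a)) * \<psi> e = star (\<psi> a) * \<psi> (lact m e)"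
      by (metis \<psi>(1) star_hom_mult star_hom_star)
    then show "star (\<psi> (lact (star m) a)) * (\<psi> e * f) = star (\<psi> a) * L m (\<psi> e * f)"
      by (simp only: L mult.assoc[symmetric])
  qed (intro bl)+
  have adj2: "star (L (star m) x) * y = star x * L m y" for m x y
    by (rule eqI[of "\<lambda>x. star (L (star m) x) * y" "\<lambda>x. star x * L m y"])
      (intro bl, intro bl, simp add: L star_mult adj1 mult.assoc del: lact_star')
  define R where "R m x = star (L (star m) (star x))" for m x
  have dc: "double_centralizer (L m, R m)" for m
    unfolding double_centralizer_def R_def
    using Lc bounded_clinear_star[OF Lc] adj2[of m "star _"] by (simp add: Lm star_mult star_star)
  define \<Psi> where "\<Psi> m = Abs_multiplier (L m, R m)" for m
  have lact: "lact (\<Psi> m) = L m" and ract: "ract x (\<Psi> m) = R m x" for m x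
    unfolding \<Psi>_def using lact_Abs[OF dc] ract_Abs[OF dc] by auto
  have "star_hom \<Psi>" unfolding star_hom_def
  proof (intro conjI allI; rule multiplier_eq_lactI)
    fix m n c x
    show "lact (\<Psi> (m + n)) x = lact (\<Psi> m + \<Psi> n) x"
      unfolding lact lact_add'
      by (rule eqI) (intro bl, intro bl, simp add: L star_hom_add[OF \<psi>(1)] distrib_right)
    show "lact (\<Psi> (c *\<^sub>C m)) x = lact (c *\<^sub>C \<Psi> m) x"
      unfolding lact lact_scaleC'
      by (rule eqI) (intro bl, intro bl, simp add: L star_hom_scaleC[OF \<psi>(1)] mult_scaleC_left)
    show "lact (\<Psi> (m * n)) x = lact (\<Psi> m * \<Psi> n) x"
      unfolding lact lact_times'
      by (rule eqI) (intro bl, intro bl, simp add: L)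
    show "lact (\<Psi> (star m)) x = lact (star (\<Psi> m)) x"
      by (simp add: lact ract R_def star_star)
  qed
  moreover have "\<Psi> 1 = 1"
    by (rule multiplier_eq_lactI, unfold lact lact_one', rule eqI) (intro bl, intro bl, simp add: L)
  moreover have "\<Psi> (embed a) = embed (\<psi> a)" for a
    by (rule multiplier_eq_lactI, unfold lact lact_embed, rule eqI)
      (intro bl, intro bl, simp add: L star_hom_mult[OF \<psi>(1)] mult.assoc)
  ultimately show ?thesis by blast
qed

section \<open>Uniqueness of the extension and its action on the range of
  \<open>\<psi>\<close>\<close>

lemma embed_eq_iff: "embed a = embed b \<longleftrightarrow> a = b"
  by (metis lact_embed right_cancel)

text \<open>The algebra is an ideal in its multipliers, so \<open>m * embed a\<close> is again
  embedded; applying \<open>\<Psi>\<close> to it fixes how \<open>\<Psi> m\<close> acts on the range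
  of \<open>\<psi>\<close>.\<close>

lemma extension_lact:
  assumes \<Psi>: "star_hom \<Psi>" "\<And>a. \<Psi> (embed a) = embed (\<psi> a)"
  shows "lact (\<Psi> m) (\<psi> a) = \<psi> (lact m a)"
proof -
  have "m * embed a = embed (lact m a)"
    by (rule multiplier_eq_lactI) (simp add: lact_mult)
  then have "\<Psi> m * embed (\<psi> a) = embed (\<psi> (lact m a))"
    by (simp flip: \<Psi>(2) star_hom_mult[OF \<Psi>(1)])
  moreover have "\<Psi> m * embed (\<psi> a) = embed (lact (\<Psi> m) (\<psi> a))"
    by (rule multiplier_eq_lactI) (simp add: lact_mult)
  ultimately show ?thesis by (simp add: embed_eq_iff)
qed

lemma
  assumes "star_hom \<psi>" "nondegenerate \<psi>"
  shows mext_star_hom: "star_hom (mext \<psi>)"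
    and mext_one: "mext \<psi> 1 = 1"
    and mext_embed: "mext \<psi> (embed a) = embed (\<psi> a)"
proof -
  have "\<exists>!\<Psi>. star_hom \<Psi> \<and> \<Psi> 1 = 1 \<and> (\<forall>a. \<Psi> (embed a) = embed (\<psi> a))"
  proof (rule ex_ex1I[OF mext_exists[OF assms]])
    fix \<Psi> \<Psi>'
    assume \<Psi>: "star_hom \<Psi> \<and> \<Psi> 1 = 1 \<and> (\<forall>a. \<Psi> (embed a) = embed (\<psi> a))"
      "star_hom \<Psi>' \<and> \<Psi>' 1 = 1 \<and> (\<forall>a. \<Psi>' (embed a) = embed (\<psi> a))"
    have "lact (\<Psi> m) x = lact (\<Psi>' m) x" for m x
      by (rule nondegenerate_eqI[OF assms(2) bounded_linear_lact bounded_linear_lact])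
        (use \<Psi> in \<open>simp add: lact_mult extension_lact[of _ \<psi>]\<close>)
    then show "\<Psi> = \<Psi>'" by (intro ext multiplier_eq_lactI)
  qed
  from theI'[OF this] show "star_hom (mext \<psi>)" "mext \<psi> 1 = 1" "mext \<psi> (embed a) = embed (\<psi> a)"
    unfolding mext_def by blast+
qed

lemma
  assumes "star_hom \<psi>" "nondegenerate \<psi>"
  shows lact_mext: "lact (mext \<psi> m) (\<psi> a) = \<psi> (lact m a)"
    and ract_mext: "ract (\<psi> a) (mext \<psi> m) = \<psi> (ract a m)"
proof -
  show l: "lact (mext \<psi> m) (\<psi> a) = \<psi> (lact m a)" for m a
    by (rule extension_lact) (simp_all add: mext_star_hom mext_embed assms)
  have "star (ract (\<psi> a) (mext \<psi> m)) = star (\<psi> (ract a m))"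
    using l[of "star m" "star a"]
    by (simp only: star_ract star_hom_star[OF assms(1), symmetric] star_hom_star[OF mext_star_hom[OF assms]])
  then show "ract (\<psi> a) (mext \<psi> m) = \<psi> (ract a m)" by (metis star_star)
qed

text \<open>If \<open>d\<close> is a difference of left actions, then
  \<open>\<psi> a * d = 0\<close> for all \<open>a\<close>. Taking adjoints gives
  \<open>star d * (\<psi> a * b) = 0\<close>, and density yields \<open>star d = 0\<close>.\<close>

lemma multiplier_eq_nondegenerateI:
  assumes \<psi>: "star_hom \<psi>" "nondegenerate \<psi>" and eq: "\<And>a. ract (\<psi> a) m = ract (\<psi> a) n"
  shows "m = n"
proof (rule multiplier_eq_lactI)
  fix c
  let ?d = "lact m c - lact n c"
  have "\<psi> a * ?d = 0" for a by (simp add: right_diff_distrib eq flip: ract_mult_lact)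
  then have "star (\<psi> (star a) * ?d) = 0" for a by simp
  then have z: "star ?d * \<psi> a = 0" for a by (simp add: star_mult star_hom_star[OF \<psi>(1)] star_star)
  have "star ?d * y = (\<lambda>_. 0) y" for y
    by (rule nondegenerate_eqI[OF \<psi>(2) bounded_linear_mult_right bounded_linear_zero])
      (simp add: z flip: mult.assoc)
  then have "star ?d = 0" by (metis right_cancel mult_zero_left)
  then have "?d = 0" by (metis star_star star_zero)
  then show "lact m c = lact n c" by simp
qed

lemma unitary_mext:
  assumes "star_hom \<psi>" "nondegenerate \<psi>" "unitary w"
  shows "unitary (mext \<psi> w)"
  using assms(3)
  by (simp add: unitary_def mext_one[OF assms(1,2)] flip: star_hom_mult[OF mext_star_hom[OF assms(1,2)]]
      star_hom_star[OF mext_star_hom[OF assms(1,2)]])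

text \<open>That products span a dense subspace of the target is inherited from
  \<open>\<psi>\<close>, so no approximate unit has to be constructed.\<close>

lemma nondegenerate_surj:
  fixes \<psi> :: "'a::cstar_algebra \<Rightarrow> 'b::cstar_algebra" and f :: "'c::cstar_algebra \<Rightarrow> 'b"
  assumes "nondegenerate \<psi>" "surj f"
  shows "nondegenerate f"
proof -
  have "{\<psi> a * b |a b. True} \<subseteq> {f a * b |a b. True}"
  proof clarify
    fix a b
    obtain c where "\<psi> a = f c" using surjD[OF assms(2)] by blast
    then show "\<exists>a' b'. \<psi> a * b = f a' * b' \<and> True" by auto
  qed
  then show ?thesis
    using assms(1) closure_mono[OF span_mono] unfolding nondegenerate_def by blast
qed

lemma nondegenerate_induct:
  assumes "nondegenerate \<psi>" "subspace {x. P x}" "closed {x. P x}" "\<And>a b. P (\<psi> a * b)"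
  shows "P x"
proof (rule dense_closed_induct[of "span {\<psi> a * b |a b. True}"])
  show "closure (span {\<psi> a * b |a b. True}) = UNIV" using assms(1) by (simp add: nondegenerate_def)
  show "P x" if "x \<in> span {\<psi> a * b |a b. True}" for x
    using span_minimal[of "{\<psi> a * b |a b. True}" "{x. P x}"] that assms(2,4) by blast
qed (rule assms)

lemma nondegenerate_induct_right:
  fixes \<psi> :: "'a::cstar_algebra \<Rightarrow> 'b::cstar_algebra"
  assumes \<psi>: "star_hom \<psi>" "nondegenerate \<psi>"
    and P: "subspace {x. P x}" "closed {x. P x}" "\<And>a b. P (b * \<psi> a)"
  shows "P x"
proof -
  have "P (star x)" for x
  proof (rule nondegenerate_induct[OF \<psi>(2), where P = "\<lambda>x. P (star x)"])
    show "subspace {x. P (star x)}"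
      using linear_subspace_vimage[OF bounded_linear.linear[OF bounded_linear_star] P(1)]
      by (simp add: vimage_def)
    show "closed {x. P (star x)}"
      using continuous_closed_vimage[OF P(2) linear_continuous_at[OF bounded_linear_star]]
      by (simp add: vimage_def)
    show "P (star (\<psi> a * b))" for a b
      using P(3)[of "star b" "star a"] by (simp add: star_mult star_hom_star[OF \<psi>(1)])
  qed
  from this[of "star x"] show ?thesis by (simp add: star_star)
qed

section \<open>Continuity for families of nonexpansive maps\<close>

lemma dist_triangle4: "dist a d \<le> dist a b + dist b c + dist c (d :: 'a::metric_space)"
  using dist_triangle[of a d b] dist_triangle[of b d c] by linarith

lemma continuous_on_nonexpansive:
  fixes f :: "'x::topological_space \<Rightarrow> 'a::metric_space \<Rightarrow> 'b::metric_space"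
  assumes ne: "\<And>x a b. x \<in> S \<Longrightarrow> dist (f x a) (f x b) \<le> dist a b"
    and f: "\<And>a. continuous_on S (\<lambda>x. f x a)" and h: "continuous_on S h"
  shows "continuous_on S (\<lambda>x. f x (h x))"
  unfolding continuous_on_def
proof
  fix x assume x: "x \<in> S"
  show "((\<lambda>x. f x (h x)) \<longlongrightarrow> f x (h x)) (at x within S)"
  proof (rule metric_tendsto_imp_tendsto)
    have "((\<lambda>y. dist (h y) (h x) + dist (f y (h x)) (f x (h x))) \<longlongrightarrow> dist (h x) (h x) + dist (f x (h x)) (f x (h x)))
        (at x within S)"
      using f[of "h x"] h x unfolding continuous_on_def by (intro tendsto_intros) auto
    then show "((\<lambda>y. dist (h y) (h x) + dist (f y (h x)) (f x (h x))) \<longlongrightarrow> 0) (at x within S)" by simp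
    have "dist (f y (h y)) (f x (h x)) \<le> dist (h y) (h x) + dist (f y (h x)) (f x (h x))" if "y \<in> S" for y
      using ne[OF that, of "h y" "h x"] dist_triangle[of "f y (h y)" "f x (h x)" "f y (h x)"] by linarith
    then show "\<forall>\<^sub>F y in at x within S. dist (f y (h y)) (f x (h x)) \<le>
        dist (dist (h y) (h x) + dist (f y (h x)) (f x (h x))) 0"
      by (auto simp: eventually_at_topological dist_real_def)
  qed
qed

lemma closed_continuous_on_nonexpansive:
  fixes f :: "'x::topological_space \<Rightarrow> 'a::metric_space \<Rightarrow> 'b::metric_space"
  assumes ne: "\<And>x a b. x \<in> S \<Longrightarrow> dist (f x a) (f x b) \<le> dist a b"
  shows "closed {a. continuous_on S (\<lambda>x. f x a)}"
proof -
  have "continuous_on S (\<lambda>x. f x a)"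
    if a: "a \<in> closure {a. continuous_on S (\<lambda>x. f x a)}" for a
    unfolding continuous_on_def
  proof (intro ballI tendstoI)
    fix x and e :: real assume x: "x \<in> S" and e: "0 < e"
    obtain b where b: "continuous_on S (\<lambda>x. f x b)" "dist b a < e / 3"
      using a e closure_approachable[of a] by (metis (mono_tags, lifting) mem_Collect_eq zero_less_divide_iff zero_less_numeral)
    have "\<forall>\<^sub>F y in at x within S. dist (f y b) (f x b) < e / 3"
      using b(1) x e unfolding continuous_on_def by (intro tendstoD) auto
    moreover have "\<forall>\<^sub>F y in at x within S. y \<in> S" by (auto simp: eventually_at_topological)
    ultimately show "\<forall>\<^sub>F y in at x within S. dist (f y a) (f x a) < e"
    proof eventually_elim
      case (elim y)
      have "dist (f y a) (f x a) \<le> dist (f y a) (f y b) + dist (f y b) (f x b) + dist (f x b) (f x a)"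
        by (rule dist_triangle4)
      then show ?case using ne[OF elim(2), of a b] ne[OF x, of b a] b(2) elim(1)
        by (simp add: dist_commute)
    qed
  qed
  then have "closure {a. continuous_on S (\<lambda>x. f x a)} \<subseteq> {a. continuous_on S (\<lambda>x. f x a)}" by blast
  then show ?thesis by (rule closure_subset_eq[THEN iffD1])
qed

section \<open>Unitary multipliers\<close>

lemma lact_ract: "lact m (ract a n) = ract (lact m a) n"
  by (rule left_cancel) (simp flip: ract_mult_lact ract_mult)

lemma unitary_one [simp]: "unitary 1"
  by (simp add: unitary_def)

lemma unitary_star: "unitary u \<Longrightarrow> unitary (star u)"
  by (simp add: unitary_def star_star)

lemma unitary_mult: "unitary u \<Longrightarrow> unitary v \<Longrightarrow> unitary (u * v)"
proof -
  assume "unitary u" "unitary v"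
  then have "star u * u = 1" "u * star u = 1" "star v * (star u * (u * v)) = star v * v"
    "u * (v * (star v * star u)) = u * star u" "star v * v = 1"
    unfolding unitary_def by (metis mult.assoc mult_1_left)+
  then show ?thesis by (simp add: unitary_def star_mult mult.assoc)
qed

lemma
  assumes "unitary u"
  shows ract_star_unitary: "ract (ract a (star u)) u = a"
    and lact_unitary_star: "lact u (lact (star u) a) = a"
    and lact_star_unitary: "lact (star u) (lact u a) = a"
  using assms unfolding unitary_def
  by (simp_all flip: ract_times' lact_times' del: lact_star' ract_star')

lemma
  shows lact_diff: "lact m (a - b) = lact m a - lact m b"
    and ract_diff: "ract (a - b) m = ract a m - ract b m"
  by (simp_all add: linear_simps(2)[OF bounded_linear_lact] linear_simps(2)[OF bounded_linear_ract])

lemma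
  assumes u: "unitary u"
  shows norm_ract_unitary: "norm (ract a u) = norm a"
    and norm_lact_unitary: "norm (lact u a) = norm a"
proof -
  have r: "norm (ract a u) = norm a" if u: "unitary u" for u and a :: 'a
  proof -
    have "ract a u * star (ract a u) = a * star a"
      unfolding star_ract ract_mult_lact lact_unitary_star[OF u] ..
    then have "(norm (ract a u))\<^sup>2 = (norm a)\<^sup>2" by (metis norm_mult_star_self)
    then show ?thesis by simp
  qed
  show "norm (ract a u) = norm a" by (rule r[OF u])
  show "norm (lact u a) = norm a"
    using r[OF unitary_star[OF u], of "star a"] by (simp only: norm_star flip: star_lact)
qed

lemma
  assumes "unitary u"
  shows dist_ract_unitary: "dist (ract a u) (ract b u) = dist a b"
    and dist_lact_unitary: "dist (lact u a) (lact u b) = dist a b"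
  using norm_ract_unitary[OF assms] norm_lact_unitary[OF assms]
  by (simp_all add: dist_norm flip: ract_diff lact_diff)

text \<open>After taking adjoints, right multiplication by the isometry \<open>m\<close> turns
  \<open>star a * star m\<close> into \<open>star a\<close> and \<open>star a * star n\<close> into
  \<open>star a * star n * m\<close>; moreover \<open>star a = star a * star n * n\<close>. So the
  left action at \<open>a\<close> is controlled by the right action at the single element
  \<open>star a * star n\<close>.\<close>

lemma dist_lact_ract_unitary:
  assumes "unitary m" "unitary n"
  shows "dist (lact m a) (lact n a) =
    dist (ract (ract (star a) (star n)) m) (ract (ract (star a) (star n)) n)"
proof -
  have "dist (lact m a) (lact n a) = dist (ract (star a) (star m)) (ract (star a) (star n))"
    by (simp only: dist_star star_lact[symmetric])
  also have "\<dots> = dist (star a) (ract (ract (star a) (star n)) m)"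
    unfolding dist_ract_unitary[OF assms(1), of "ract (star a) (star m)", symmetric]
      ract_star_unitary[OF assms(1)] ..
  finally show ?thesis by (simp only: ract_star_unitary[OF assms(2)] dist_commute)
qed

definition unitary_path :: "'x::topological_space set \<Rightarrow> ('x \<Rightarrow> 'a::cstar_algebra multiplier) \<Rightarrow> bool" where
  "unitary_path S w \<longleftrightarrow> (\<forall>x\<in>S. unitary (w x)) \<and> strictly_continuous_on S w"

lemma
  assumes "unitary_path S w"
  shows unitary_path_unitary: "x \<in> S \<Longrightarrow> unitary (w x)"
    and unitary_path_ract: "continuous_on S (\<lambda>x. ract a (w x))"
    and unitary_path_lact: "continuous_on S (\<lambda>x. lact (w x) a)"
  using assms by (auto simp: unitary_path_def strictly_continuous_on_iff)

text \<open>On unitaries one half of the strict topology suffices: near \<open>x\<close>, the left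
  distance at \<open>a\<close> equals the right distance at \<open>?c\<close>, which depends on
  \<open>x\<close> but not on the nearby point.\<close>

lemma unitary_pathI_ract:
  assumes u: "\<And>x. x \<in> S \<Longrightarrow> unitary (w x)" and r: "\<And>a. continuous_on S (\<lambda>x. ract a (w x))"
  shows "unitary_path S w"
proof -
  have "continuous_on S (\<lambda>x. lact (w x) a)" for a
    unfolding continuous_on_def
  proof
    fix x assume x: "x \<in> S"
    let ?c = "ract (star a) (star (w x))"
    have "((\<lambda>y. ract ?c (w y)) \<longlongrightarrow> ract ?c (w x)) (at x within S)"
      using r x unfolding continuous_on_def by blast
    then show "((\<lambda>y. lact (w y) a) \<longlongrightarrow> lact (w x) a) (at x within S)"
      by (rule metric_tendsto_imp_tendsto)
        (auto simp: eventually_at_topological dist_lact_ract_unitary[OF u u[OF x]] simp del: ract_star')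
  qed
  then show ?thesis using u r by (simp add: unitary_path_def strictly_continuous_on_iff)
qed

lemma unitary_path_star:
  assumes "unitary_path S w"
  shows "unitary_path S (\<lambda>x. star (w x))"
proof (rule unitary_pathI_ract)
  show "continuous_on S (\<lambda>x. ract a (star (w x)))" for a
    using unitary_path_lact[OF assms] by (simp add: continuous_on_star)
qed (simp add: unitary_star unitary_path_unitary[OF assms])

lemma unitary_pathI_lact:
  assumes u: "\<And>x. x \<in> S \<Longrightarrow> unitary (w x)" and l: "\<And>a. continuous_on S (\<lambda>x. lact (w x) a)"
  shows "unitary_path S w"
proof -
  have "unitary_path S (\<lambda>x. star (w x))"
    using u l by (intro unitary_pathI_ract) (simp_all add: unitary_star continuous_on_star)
  from unitary_path_star[OF this] show ?thesis by (simp add: star_star)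
qed

lemma unitary_path_const: "unitary u \<Longrightarrow> unitary_path S (\<lambda>_. u)"
  by (rule unitary_pathI_ract) auto

lemma continuous_on_ract_unitary_path:
  assumes "unitary_path S w" "continuous_on S h"
  shows "continuous_on S (\<lambda>x. ract (h x) (w x))"
  by (rule continuous_on_nonexpansive[where f = "\<lambda>x a. ract a (w x)"])
    (use assms in \<open>auto simp: dist_ract_unitary unitary_path_unitary unitary_path_ract\<close>)

lemma unitary_path_mult:
  assumes "unitary_path S w" "unitary_path S z"
  shows "unitary_path S (\<lambda>x. w x * z x)"
  by (rule unitary_pathI_ract)
    (use assms in \<open>auto simp: unitary_mult unitary_path_unitary unitary_path_ract
      intro!: continuous_on_ract_unitary_path\<close>)

lemma unitary_path_compose:
  assumes "unitary_path S w" "continuous_on T r" "r ` T \<subseteq> S"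
  shows "unitary_path T (\<lambda>x. w (r x))"
  by (rule unitary_pathI_ract)
    (use assms in \<open>auto simp: unitary_path_unitary
      intro: continuous_on_compose2[OF unitary_path_ract[OF assms(1)]]\<close>)

text \<open>The vectors with continuous orbit form a closed subspace because unitaries act
  isometrically, and on \<open>\<psi> a * b\<close> the orbit is
  \<open>\<psi> (lact (w x) a) * b\<close>.\<close>

lemma unitary_path_mext:
  assumes \<psi>: "star_hom \<psi>" "nondegenerate \<psi>" and w: "unitary_path S w"
  shows "unitary_path S (\<lambda>x. mext \<psi> (w x))"
proof (rule unitary_pathI_lact)
  show u: "unitary (mext \<psi> (w x))" if "x \<in> S" for x
    using unitary_mext[OF \<psi>] unitary_path_unitary[OF w that] by blast
  show "continuous_on S (\<lambda>x. lact (mext \<psi> (w x)) b)" for b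
  proof (rule nondegenerate_induct[OF \<psi>(2), where P = "\<lambda>b. continuous_on S (\<lambda>x. lact (mext \<psi> (w x)) b)"])
    show "subspace {b. continuous_on S (\<lambda>x. lact (mext \<psi> (w x)) b)}"
      by (auto intro!: subspaceI continuous_intros
          simp: linear_simps[OF bounded_linear_lact])
    show "closed {b. continuous_on S (\<lambda>x. lact (mext \<psi> (w x)) b)}"
      by (rule closed_continuous_on_nonexpansive) (simp add: dist_lact_unitary u)
    show "continuous_on S (\<lambda>x. lact (mext \<psi> (w x)) (\<psi> a * b))" for a b
      by (simp add: lact_mult lact_mext[OF \<psi>])
        (intro continuous_intros bounded_linear.continuous_on[OF star_hom_bounded_linear[OF \<psi>(1)]]
          unitary_path_lact w)
  qed
qed

section \<open>Cocycle pairs as families of contractions\<close>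

text \<open>
  A cocycle pair \<open>(\<phi>, u)\<close> is encoded by the maps \<open>a \<mapsto> \<phi>(a) u\<^sub>g\<close>. Composition of cocycle pairs becomes
  pointwise composition, and conjugation by a unitary \<open>w\<close> becomes composition with the isometries
  \<open>b \<mapsto> w b \<beta>\<^sub>g(w)\<^sup>*\<close>.
\<close>

definition cocycle_map :: "('g, 'a::cstar_algebra, 'b::cstar_algebra) cocycle_pair \<Rightarrow> 'g \<Rightarrow> 'a \<Rightarrow> 'b" where
  "cocycle_map = (\<lambda>(\<phi>, u) g a. ract (\<phi> a) (u g))"

definition ad_map :: "('g \<Rightarrow> 'a::cstar_algebra \<Rightarrow> 'a) \<Rightarrow> 'a multiplier \<Rightarrow> 'g \<Rightarrow> 'a \<Rightarrow> 'a" where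
  "ad_map \<beta> w g b = ract (lact w b) (star (mext (\<beta> g) w))"

lemma cocycle_map_apply: "cocycle_map (\<phi>, u) g a = ract (\<phi> a) (u g)"
  by (simp add: cocycle_map_def)

text \<open>Nondegeneracy is included so that \<open>mext (\<beta> g)\<close>, which enters
  \<open>ad_map\<close>, is the extension and not an unspecified map.\<close>

definition nondegenerate_action :: "('g::topological_space \<Rightarrow> 'a::cstar_algebra \<Rightarrow> 'a) \<Rightarrow> bool" where
  "nondegenerate_action \<beta> \<longleftrightarrow> (\<forall>g. star_hom (\<beta> g) \<and> bij (\<beta> g) \<and> nondegenerate (\<beta> g)) \<and>
     (\<forall>a. continuous_on UNIV (\<lambda>g. \<beta> g a))"

lemma
  assumes "nondegenerate_action \<beta>"
  shows nondegenerate_action_star_hom: "star_hom (\<beta> g)"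
    and nondegenerate_action_bij: "bij (\<beta> g)"
    and nondegenerate_action_nondegenerate: "nondegenerate (\<beta> g)"
    and nondegenerate_action_continuous: "continuous_on UNIV (\<lambda>g. \<beta> g a)"
  using assms by (simp_all add: nondegenerate_action_def)

lemma twisted_action_nondegenerate:
  fixes \<psi> :: "'b::cstar_algebra \<Rightarrow> 'a::cstar_algebra" and \<alpha> :: "'g::topological_group_add \<Rightarrow> 'a \<Rightarrow> 'a"
  assumes "twisted_action (\<alpha>, \<uu>)" "nondegenerate \<psi>"
  shows "nondegenerate_action \<alpha>"
proof -
  have "nondegenerate (\<alpha> g)" for g
    by (rule nondegenerate_surj[OF assms(2) bij_is_surj])
      (use assms(1) in \<open>simp add: star_automorphism_def\<close>)
  then show ?thesis using assms(1) by (simp add: nondegenerate_action_def star_automorphism_def)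
qed

context
  fixes \<beta> :: "'g::topological_space \<Rightarrow> 'b::cstar_algebra \<Rightarrow> 'b"
  assumes \<beta>: "nondegenerate_action \<beta>"
begin

lemmas action_hom = nondegenerate_action_star_hom[OF \<beta>] nondegenerate_action_nondegenerate[OF \<beta>]

lemma ad_map_one [simp]: "ad_map \<beta> 1 g b = b"
  by (simp add: ad_map_def mext_one action_hom del: ract_star')

lemma ad_map_mult: "ad_map \<beta> (w * z) g b = ad_map \<beta> w g (ad_map \<beta> z g b)"
  by (simp add: ad_map_def star_hom_mult[OF mext_star_hom[OF action_hom]] star_mult lact_ract del: ract_star')

lemma ad_map_star:
  assumes "unitary w"
  shows "ad_map \<beta> w g (ad_map \<beta> (star w) g b) = b" "ad_map \<beta> (star w) g (ad_map \<beta> w g b) = b"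
  using assms by (simp_all add: unitary_def flip: ad_map_mult)

lemma dist_ad_map: "unitary w \<Longrightarrow> dist (ad_map \<beta> w g a) (ad_map \<beta> w g b) = dist a b"
  unfolding ad_map_def
  by (simp only: dist_ract_unitary dist_lact_unitary unitary_star unitary_mext action_hom)

lemma dist_ad_map_star:
  "unitary w \<Longrightarrow> dist (ad_map \<beta> (star w) g a) b = dist a (ad_map \<beta> w g b)"
  by (metis dist_ad_map ad_map_star(1))

text \<open>Write \<open>b = \<beta> g a\<close> at the point \<open>g\<close>. For \<open>h\<close>
  near \<open>g\<close>, replacing \<open>b\<close> by \<open>\<beta> h a\<close> costs at most
  \<open>dist (\<beta> g a) (\<beta> h a)\<close> since unitaries are isometric, and the multiplier
  sends \<open>\<beta> h a\<close> to \<open>\<beta> h (lact w a)\<close>. Both are governed by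
  point-norm continuity.\<close>

lemma unitary_path_mext_action:
  assumes w: "unitary w"
  shows "unitary_path UNIV (\<lambda>g. mext (\<beta> g) w)"
proof (rule unitary_pathI_lact)
  show u: "unitary (mext (\<beta> g) w)" for g by (intro unitary_mext action_hom w)
  show "continuous_on UNIV (\<lambda>g. lact (mext (\<beta> g) w) b)" for b
    unfolding continuous_on_def
  proof
    fix g
    obtain a where b: "b = \<beta> g a" using nondegenerate_action_bij[OF \<beta>] by (metis bij_pointE)
    have lim: "((\<lambda>h. \<beta> h c) \<longlongrightarrow> \<beta> g c) (at g)" for c
      using nondegenerate_action_continuous[OF \<beta>, of c] by (auto simp: continuous_on_def)
    have "((\<lambda>h. dist (\<beta> g a) (\<beta> h a) + dist (\<beta> h (lact w a)) (\<beta> g (lact w a))) \<longlongrightarrow>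
        dist (\<beta> g a) (\<beta> g a) + dist (\<beta> g (lact w a)) (\<beta> g (lact w a))) (at g)"
      by (intro tendsto_intros lim)
    then have "((\<lambda>h. dist (\<beta> g a) (\<beta> h a) + dist (\<beta> h (lact w a)) (\<beta> g (lact w a))) \<longlongrightarrow> 0) (at g)"
      by simp
    then show "((\<lambda>h. lact (mext (\<beta> h) w) b) \<longlongrightarrow> lact (mext (\<beta> g) w) b) (at g within UNIV)"
    proof (rule metric_tendsto_imp_tendsto)
      have "dist (lact (mext (\<beta> h) w) b) (lact (mext (\<beta> g) w) b) \<le>
          dist (\<beta> g a) (\<beta> h a) + dist (\<beta> h (lact w a)) (\<beta> g (lact w a))" for h
      proof -
        have "dist (lact (mext (\<beta> h) w) b) (lact (mext (\<beta> h) w) (\<beta> h a)) = dist (\<beta> g a) (\<beta> h a)"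
          unfolding b by (rule dist_lact_unitary[OF u])
        moreover have "lact (mext (\<beta> h) w) (\<beta> h a) = \<beta> h (lact w a)" "lact (mext (\<beta> g) w) b = \<beta> g (lact w a)"
          unfolding b by (simp_all add: lact_mext action_hom)
        ultimately show ?thesis by (metis dist_triangle)
      qed
      then show "\<forall>\<^sub>F h in at g. dist (lact (mext (\<beta> h) w) b) (lact (mext (\<beta> g) w) b) \<le>
          dist (dist (\<beta> g a) (\<beta> h a) + dist (\<beta> h (lact w a)) (\<beta> g (lact w a))) 0"
        by (auto simp: dist_real_def)
    qed
  qed
qed

lemma continuous_on_ad_map:
  assumes "unitary w" "continuous_on UNIV h"
  shows "continuous_on UNIV (\<lambda>g. ad_map \<beta> w g (h g))"
  unfolding ad_map_def
  by (intro continuous_on_ract_unitary_path unitary_path_star unitary_path_mext_action assms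
      bounded_linear.continuous_on[OF bounded_linear_lact])

end

section \<open>The intertwining argument\<close>

text \<open>Bounding each \<open>g\<close> separately, not a supremum, makes the empty compact set
  harmless; \<open>T \<ge> 0\<close> keeps to the times at which paths on \<open>{0..}\<close> are
  controlled.\<close>

definition ucc_lim ::
    "(real \<Rightarrow> 'g::topological_space \<Rightarrow> 'a \<Rightarrow> 'b::metric_space) \<Rightarrow> ('g \<Rightarrow> 'a \<Rightarrow> 'b) \<Rightarrow> bool" where
  "ucc_lim \<Theta> \<Theta>\<^sub>0 \<longleftrightarrow> (\<forall>a K \<epsilon>. compact K \<longrightarrow> 0 < \<epsilon> \<longrightarrow>
     (\<exists>T\<ge>0. \<forall>t\<ge>T. \<forall>g\<in>K. dist (\<Theta> t g a) (\<Theta>\<^sub>0 g a) \<le> \<epsilon>))"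

lemma ucc_limD:
  assumes "ucc_lim \<Theta> \<Theta>\<^sub>0" "compact K" "0 < \<epsilon>"
  shows "\<exists>T\<ge>0. \<forall>t\<ge>T. \<forall>g\<in>K. dist (\<Theta> t g a) (\<Theta>\<^sub>0 g a) \<le> \<epsilon>"
  using assms unfolding ucc_lim_def by blast

lemma ucc_lim_shift:
  fixes \<Theta> :: "real \<Rightarrow> 'g::topological_space \<Rightarrow> 'a \<Rightarrow> 'b::metric_space"
  assumes "ucc_lim \<Theta> \<Theta>\<^sub>0" "0 \<le> S"
  shows "ucc_lim (\<lambda>t. \<Theta> (S + t)) \<Theta>\<^sub>0"
  unfolding ucc_lim_def
proof (intro allI impI)
  fix a and K :: "'g set" and \<epsilon> :: real assume "compact K" "0 < \<epsilon>"
  then obtain T where "T \<ge> 0" "\<forall>t\<ge>T. \<forall>g\<in>K. dist (\<Theta> t g a) (\<Theta>\<^sub>0 g a) \<le> \<epsilon>"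
    using ucc_limD[OF assms(1)] by blast
  then show "\<exists>T\<ge>0. \<forall>t\<ge>T. \<forall>g\<in>K. dist (\<Theta> (S + t) g a) (\<Theta>\<^sub>0 g a) \<le> \<epsilon>"
    using assms(2) by (intro exI[of _ T]) auto
qed

lemma finite_threshold:
  fixes P :: "'i \<Rightarrow> real \<Rightarrow> bool"
  assumes "finite I" "\<And>i. i \<in> I \<Longrightarrow> \<exists>T\<ge>0. \<forall>t\<ge>T. P i t"
  shows "\<exists>T\<ge>0. \<forall>t\<ge>T. \<forall>i\<in>I. P i t"
  using assms
proof (induction I)
  case (insert i I)
  then obtain T where "T \<ge> 0" "\<forall>t\<ge>T. \<forall>i\<in>I. P i t" by auto
  moreover obtain T' where "T' \<ge> 0" "\<forall>t\<ge>T'. P i t" using insert.prems by auto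
  ultimately show ?case by (intro exI[of _ "max T T'"]) auto
qed auto

text \<open>The convergence is needed at arguments such as \<open>\<Phi> g a\<close>, which move
  with \<open>g\<close>. The image of \<open>K\<close> under \<open>f\<close> is totally bounded, so
  finitely many fixed arguments suffice up to nonexpansive errors.\<close>

lemma ucc_lim_section:
  fixes \<Theta> :: "real \<Rightarrow> 'g::topological_space \<Rightarrow> 'a::metric_space \<Rightarrow> 'b::metric_space"
  assumes lim: "ucc_lim \<Theta> \<Theta>\<^sub>0"
    and ne: "\<And>t g a b. 0 \<le> t \<Longrightarrow> dist (\<Theta> t g a) (\<Theta> t g b) \<le> dist a b"
    and ne0: "\<And>g a b. dist (\<Theta>\<^sub>0 g a) (\<Theta>\<^sub>0 g b) \<le> dist a b"
    and K: "compact K" and f: "continuous_on K f" and \<epsilon>: "0 < \<epsilon>"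
  shows "\<exists>T\<ge>0. \<forall>t\<ge>T. \<forall>g\<in>K. dist (\<Theta> t g (f g)) (\<Theta>\<^sub>0 g (f g)) \<le> \<epsilon>"
proof -
  have "compact (f ` K)" by (rule compact_continuous_image[OF f K])
  then obtain k where k: "finite k" "f ` K \<subseteq> (\<Union>x\<in>k. ball x (\<epsilon> / 3))"
    using \<epsilon> unfolding compact_eq_totally_bounded by (metis zero_less_divide_iff zero_less_numeral)
  have "\<exists>T\<ge>0. \<forall>t\<ge>T. \<forall>a\<in>k. \<forall>g\<in>K. dist (\<Theta> t g a) (\<Theta>\<^sub>0 g a) \<le> \<epsilon> / 3"
    by (rule finite_threshold[OF k(1)]) (rule ucc_limD[OF lim K], use \<epsilon> in simp)
  then obtain T where T: "T \<ge> 0" "\<And>t a g. t \<ge> T \<Longrightarrow> a \<in> k \<Longrightarrow> g \<in> K \<Longrightarrow> dist (\<Theta> t g a) (\<Theta>\<^sub>0 g a) \<le> \<epsilon> / 3"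
    by blast
  have "dist (\<Theta> t g (f g)) (\<Theta>\<^sub>0 g (f g)) \<le> \<epsilon>" if t: "t \<ge> T" and g: "g \<in> K" for t g
  proof -
    obtain a where a: "a \<in> k" "dist a (f g) < \<epsilon> / 3" using k(2) g by force
    have "dist (\<Theta> t g (f g)) (\<Theta>\<^sub>0 g (f g)) \<le>
        dist (\<Theta> t g (f g)) (\<Theta> t g a) + dist (\<Theta> t g a) (\<Theta>\<^sub>0 g a) + dist (\<Theta>\<^sub>0 g a) (\<Theta>\<^sub>0 g (f g))"
      by (rule dist_triangle4)
    then show ?thesis
      using ne[of t g "f g" a] ne0[of g a "f g"] T(2)[OF t a(1) g] a(2) T(1) t by (simp add: dist_commute)
  qed
  then show ?thesis using T(1) by blast
qed

text \<open>An interface for the pair \<open>cocycle_map (\<phi>, u)\<close> and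
  \<open>mext \<phi>\<close>: what the intertwining uses, in a form that passes to conjugates by
  unitaries without returning to cocycles.\<close>

definition equivariant ::
    "('g::topological_space \<Rightarrow> 'a::cstar_algebra \<Rightarrow> 'a) \<Rightarrow> ('g \<Rightarrow> 'b::cstar_algebra \<Rightarrow> 'b) \<Rightarrow>
     ('g \<Rightarrow> 'a \<Rightarrow> 'b) \<Rightarrow> ('a multiplier \<Rightarrow> 'b multiplier) \<Rightarrow> bool" where
  "equivariant \<alpha> \<beta> \<Phi> \<theta> \<longleftrightarrow> nondegenerate_action \<alpha> \<and> nondegenerate_action \<beta> \<and>
     (\<forall>g a b. dist (\<Phi> g a) (\<Phi> g b) \<le> dist a b) \<and> (\<forall>a. continuous_on UNIV (\<lambda>g. \<Phi> g a)) \<and>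
     \<theta> 1 = 1 \<and> (\<forall>w. unitary w \<longrightarrow> unitary (\<theta> w)) \<and>
     (\<forall>w :: real \<Rightarrow> 'a multiplier. unitary_path {0..} w \<longrightarrow> unitary_path {0..} (\<lambda>t. \<theta> (w t))) \<and>
     (\<forall>w g a. unitary w \<longrightarrow> \<Phi> g (ad_map \<alpha> w g a) = ad_map \<beta> (\<theta> w) g (\<Phi> g a))"

lemma
  assumes "equivariant \<alpha> \<beta> \<Phi> \<theta>"
  shows equivariant_domain: "nondegenerate_action \<alpha>"
    and equivariant_codomain: "nondegenerate_action \<beta>"
    and equivariant_dist: "dist (\<Phi> g a) (\<Phi> g b) \<le> dist a b"
    and equivariant_continuous: "continuous_on UNIV h \<Longrightarrow> continuous_on UNIV (\<lambda>g. \<Phi> g (h g))"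
    and equivariant_one: "\<theta> 1 = 1"
    and equivariant_unitary: "unitary w \<Longrightarrow> unitary (\<theta> w)"
    and equivariant_path: "unitary_path {0..} z \<Longrightarrow> unitary_path {0..} (\<lambda>t :: real. \<theta> (z t))"
    and equivariant_ad: "unitary w \<Longrightarrow> \<Phi> g (ad_map \<alpha> w g a) = ad_map \<beta> (\<theta> w) g (\<Phi> g a)"
  using assms continuous_on_nonexpansive[of UNIV \<Phi> h] by (simp_all add: equivariant_def)

lemma equivariant_conjugate:
  assumes \<Phi>: "equivariant \<alpha> \<beta> \<Phi> \<theta>" and x: "unitary x"
  shows "equivariant \<alpha> \<beta> (\<lambda>g a. ad_map \<beta> x g (\<Phi> g a)) (\<lambda>w. x * \<theta> w * star x)"
  unfolding equivariant_def
proof (intro conjI allI impI)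
  note \<beta> = equivariant_codomain[OF \<Phi>]
  show "continuous_on UNIV (\<lambda>g. ad_map \<beta> x g (\<Phi> g a))" for a
    by (intro continuous_on_ad_map \<beta> x equivariant_continuous[OF \<Phi>]) simp
  show "unitary_path {0..} (\<lambda>t. x * \<theta> (w t) * star x)" if "unitary_path {0..} w" for w :: "real \<Rightarrow> _"
    by (intro unitary_path_mult unitary_path_const unitary_star x equivariant_path[OF \<Phi>] that)
  show "ad_map \<beta> x g (\<Phi> g (ad_map \<alpha> w g a)) =
      ad_map \<beta> (x * \<theta> w * star x) g (ad_map \<beta> x g (\<Phi> g a))" if "unitary w" for w g a
    by (simp only: ad_map_mult[OF \<beta>] ad_map_star[OF \<beta> x] equivariant_ad[OF \<Phi> that])
qed (use \<Phi> x in \<open>auto simp: equivariant_def dist_ad_map unitary_mult unitary_star unitary_def[of x]\<close>)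

text \<open>The state before \<open>\<Phi>\<close> is moved. The two paths have different duties:
  \<open>z\<close> conjugates to the identity only in the limit, while \<open>w\<close> starts at
  \<open>1\<close> and satisfies its estimate from time 0 on. Moving \<open>\<Phi>\<close> swaps the
  roles of the two algebras.\<close>

definition intertwined ::
    "('g::topological_space \<Rightarrow> 'a::cstar_algebra \<Rightarrow> 'a) \<Rightarrow> ('g \<Rightarrow> 'b::cstar_algebra \<Rightarrow> 'b) \<Rightarrow>
     ('g \<Rightarrow> 'a \<Rightarrow> 'b) \<Rightarrow> ('g \<Rightarrow> 'b \<Rightarrow> 'a) \<Rightarrow> 'a set \<Rightarrow> 'g set \<Rightarrow> real \<Rightarrow>
     (real \<Rightarrow> 'a multiplier) \<Rightarrow> (real \<Rightarrow> 'b multiplier) \<Rightarrow> bool" where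
  "intertwined \<alpha> \<beta> \<Phi> \<Psi> F K \<epsilon> w z \<longleftrightarrow>
     unitary_path {0..} z \<and> ucc_lim (\<lambda>t g b. ad_map \<beta> (z t) g (\<Phi> g (\<Psi> g b))) (\<lambda>g b. b) \<and>
     unitary_path {0..} w \<and> ucc_lim (\<lambda>t g a. ad_map \<alpha> (w t) g (\<Psi> g (\<Phi> g a))) (\<lambda>g a. a) \<and> w 0 = 1 \<and>
     (\<forall>t\<ge>0. \<forall>a\<in>F. \<forall>g\<in>K. dist (ad_map \<alpha> (w t) g (\<Psi> g (\<Phi> g a))) a \<le> \<epsilon>)"

lemma unitary_path_shift: "unitary_path {0..} w \<Longrightarrow> 0 \<le> S \<Longrightarrow> unitary_path {0..} (\<lambda>t. w (S + t))"
  for w :: "real \<Rightarrow> _"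
  by (rule unitary_path_compose) (auto intro!: continuous_intros)

text \<open>
  The remainder of a path that is cut at time \<open>S\<close> starts at \<open>1\<close>. Replacing \<open>\<Phi>\<close> by \<open>Ad(p\<^sub>S)\<Phi>\<close> has to be
  compensated in \<open>w\<close> by \<open>\<eta>(p\<^sub>S)\<^sup>*\<close>.
\<close>

lemma intertwined_cut:
  fixes \<alpha> :: "'g::topological_space \<Rightarrow> 'a::cstar_algebra \<Rightarrow> 'a" and \<beta> :: "'g \<Rightarrow> 'b::cstar_algebra \<Rightarrow> 'b"
  assumes \<Phi>: "equivariant \<alpha> \<beta> \<Phi> \<theta>" and \<Psi>: "equivariant \<beta> \<alpha> \<Psi> \<eta>"
    and p: "unitary_path {0..} p" "ucc_lim (\<lambda>t g b. ad_map \<beta> (p t) g (\<Phi> g (\<Psi> g b))) (\<lambda>g b. b)"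
    and w: "unitary_path {0..} w" "ucc_lim (\<lambda>t g a. ad_map \<alpha> (w t) g (\<Psi> g (\<Phi> g a))) (\<lambda>g a. a)"
    and S: "0 \<le> S" "\<And>t b g. S \<le> t \<Longrightarrow> b \<in> G \<Longrightarrow> g \<in> L \<Longrightarrow> dist (ad_map \<beta> (p t) g (\<Phi> g (\<Psi> g b))) b \<le> \<delta>"
  shows "intertwined \<beta> \<alpha> \<Psi> (\<lambda>g a. ad_map \<beta> (p S) g (\<Phi> g a)) G L \<delta>
    (\<lambda>t. p (S + t) * star (p S)) (\<lambda>t. w t * star (\<eta> (p S)))"
proof -
  note \<alpha> = equivariant_domain[OF \<Phi>] and \<beta> = equivariant_codomain[OF \<Phi>]
  have u: "unitary (p S)" using unitary_path_unitary[OF p(1)] S(1) by simp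
  note \<eta>u = equivariant_unitary[OF \<Psi> u]
  have e: "ad_map \<beta> (p (S + t) * star (p S)) g (ad_map \<beta> (p S) g b) = ad_map \<beta> (p (S + t)) g b" for t g b
    by (simp only: ad_map_mult[OF \<beta>] ad_map_star[OF \<beta> u])
  have f: "ad_map \<alpha> (w t * star (\<eta> (p S))) g (\<Psi> g (ad_map \<beta> (p S) g (\<Phi> g a))) =
      ad_map \<alpha> (w t) g (\<Psi> g (\<Phi> g a))" for t g a
    by (simp only: ad_map_mult[OF \<alpha>] ad_map_star[OF \<alpha> \<eta>u] equivariant_ad[OF \<Psi> u])
  show ?thesis
    unfolding intertwined_def
  proof (intro conjI)
    show "unitary_path {0..} (\<lambda>t. w t * star (\<eta> (p S)))"
      by (intro unitary_path_mult unitary_path_const unitary_star \<eta>u w)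
    show "unitary_path {0..} (\<lambda>t. p (S + t) * star (p S))"
      by (intro unitary_path_mult unitary_path_const unitary_star u unitary_path_shift p S)
    show "ucc_lim (\<lambda>t g b. ad_map \<beta> (p (S + t) * star (p S)) g (ad_map \<beta> (p S) g (\<Phi> g (\<Psi> g b)))) (\<lambda>g b. b)"
      unfolding e by (rule ucc_lim_shift[OF p(2) S(1)])
    show "ucc_lim (\<lambda>t g a. ad_map \<alpha> (w t * star (\<eta> (p S))) g (\<Psi> g (ad_map \<beta> (p S) g (\<Phi> g a)))) (\<lambda>g a. a)"
      unfolding f by (rule w)
  qed (use u S in \<open>auto simp: e unitary_def\<close>)
qed

text \<open>
  The path \<open>z\<^sub>s \<theta>(w\<^sub>t) z\<^sub>s\<^sup>*\<close> starts at \<open>1\<close> whatever \<open>z\<close> is. It still conjugates \<open>\<Phi>\<Psi>\<close> to the identity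
  because \<open>Ad(z\<^sub>s\<^sup>*)\<Phi>\<Psi>\<close> is asymptotically \<open>\<Phi>\<Psi>\<Phi>\<Psi>\<close>, and if \<open>s\<close> is kept large, it almost fixes \<open>\<Phi>\<close> on
  the elements that \<open>Ad(w\<^sub>t)\<Psi>\<Phi>\<close> almost fixes.
\<close>

lemma intertwined_path:
  fixes \<alpha> :: "'g::topological_space \<Rightarrow> 'a::cstar_algebra \<Rightarrow> 'a" and \<beta> :: "'g \<Rightarrow> 'b::cstar_algebra \<Rightarrow> 'b"
  assumes \<Phi>: "equivariant \<alpha> \<beta> \<Phi> \<theta>" and \<Psi>: "equivariant \<beta> \<alpha> \<Psi> \<eta>"
    and I: "intertwined \<alpha> \<beta> \<Phi> \<Psi> F K \<epsilon> w z"
    and F: "finite F" "compact K" "0 < \<epsilon>"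
  obtains p where "unitary_path {0..} p" "p 0 = 1"
    "ucc_lim (\<lambda>t g b. ad_map \<beta> (p t) g (\<Phi> g (\<Psi> g b))) (\<lambda>g b. b)"
    "\<And>t a g. 0 \<le> t \<Longrightarrow> a \<in> F \<Longrightarrow> g \<in> K \<Longrightarrow> dist (ad_map \<beta> (p t) g (\<Phi> g a)) (\<Phi> g a) \<le> 4 * \<epsilon>"
proof -
  note \<alpha> = equivariant_domain[OF \<Phi>] and \<beta> = equivariant_codomain[OF \<Phi>]
  have z: "unitary_path {0..} z" "ucc_lim (\<lambda>t g b. ad_map \<beta> (z t) g (\<Phi> g (\<Psi> g b))) (\<lambda>g b. b)"
    and w: "unitary_path {0..} w" "ucc_lim (\<lambda>t g a. ad_map \<alpha> (w t) g (\<Psi> g (\<Phi> g a))) (\<lambda>g a. a)" "w 0 = 1"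
    and good: "\<And>t a g. 0 \<le> t \<Longrightarrow> a \<in> F \<Longrightarrow> g \<in> K \<Longrightarrow> dist (ad_map \<alpha> (w t) g (\<Psi> g (\<Phi> g a))) a \<le> \<epsilon>"
    using I by (auto simp: intertwined_def)
  note zu = unitary_path_unitary[OF z(1)] and wu = unitary_path_unitary[OF w(1)]
  note \<theta>u = equivariant_unitary[OF \<Phi> wu] and dist\<Phi> = equivariant_dist[OF \<Phi>] and dist\<Psi> = equivariant_dist[OF \<Psi>]
  have cont: "continuous_on K (\<lambda>g. \<Phi> g a)" "continuous_on K (\<lambda>g. \<Psi> g b)"
    "continuous_on K (\<lambda>g. \<Phi> g (\<Psi> g b))" for a b K
    by (rule continuous_on_subset[OF _ subset_UNIV], intro equivariant_continuous[OF \<Phi>]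
        equivariant_continuous[OF \<Psi>] continuous_on_const)+
  have neB: "dist (ad_map \<beta> (z t) g (\<Phi> g (\<Psi> g b))) (ad_map \<beta> (z t) g (\<Phi> g (\<Psi> g b'))) \<le> dist b b'"
    if "0 \<le> t" for t g b b'
    using order_trans[OF dist\<Phi> dist\<Psi>] zu[of t] that by (simp add: dist_ad_map[OF \<beta>])
  have neA: "dist (ad_map \<alpha> (w t) g (\<Psi> g (\<Phi> g a))) (ad_map \<alpha> (w t) g (\<Psi> g (\<Phi> g a'))) \<le> dist a a'"
    if "0 \<le> t" for t g a a'
    using order_trans[OF dist\<Psi> dist\<Phi>] wu[of t] that by (simp add: dist_ad_map[OF \<alpha>])
  note secB = ucc_lim_section[OF z(2) neB order_refl] and secA = ucc_lim_section[OF w(2) neA order_refl]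
  have "\<exists>T\<ge>0. \<forall>t\<ge>T. \<forall>a\<in>F. \<forall>g\<in>K. dist (ad_map \<beta> (z t) g (\<Phi> g (\<Psi> g (\<Phi> g a)))) (\<Phi> g a) \<le> \<epsilon>"
    by (rule finite_threshold[OF F(1)], rule secB[OF _ F(2) cont(1) F(3)])
  then obtain s where s: "0 \<le> s" "\<And>t a g. s \<le> t \<Longrightarrow> a \<in> F \<Longrightarrow> g \<in> K \<Longrightarrow>
      dist (ad_map \<beta> (z t) g (\<Phi> g (\<Psi> g (\<Phi> g a)))) (\<Phi> g a) \<le> \<epsilon>" by blast
  define p where "p t = z (s + t) * \<theta> (w t) * star (z (s + t))" for t
  have zs: "unitary (z (s + t))" if "0 \<le> t" for t using zu[of "s + t"] s(1) that by simp
  have ad_p: "ad_map \<beta> (p t) g b = ad_map \<beta> (z (s + t)) g (ad_map \<beta> (\<theta> (w t)) g (ad_map \<beta> (star (z (s + t))) g b))"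
    for t g b by (simp add: p_def ad_map_mult[OF \<beta>])
  \<comment> \<open>Every factor of \<open>ad_map \<beta> (p t)\<close> is isometric and can be
    peeled off at the cost of one comparison: the adjoint of \<open>z\<close> against
    \<open>b'\<close>, \<open>\<theta> (w t)\<close> against \<open>b''\<close>, and
    \<open>z\<close> against \<open>d\<close>.\<close>
  have est: "dist (ad_map \<beta> (p t) g b) d \<le> dist b (ad_map \<beta> (z (s + t)) g b') +
      dist (ad_map \<beta> (\<theta> (w t)) g b') b'' + dist (ad_map \<beta> (z (s + t)) g b'') d"
    if t: "0 \<le> t" for t g b b' b'' d
  proof -
    have wt: "unitary (\<theta> (w t))" using \<theta>u[of t] t by simp
    have "dist (ad_map \<beta> (p t) g b) (ad_map \<beta> (z (s + t)) g (ad_map \<beta> (\<theta> (w t)) g b')) =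
        dist b (ad_map \<beta> (z (s + t)) g b')"
      by (simp add: ad_p dist_ad_map[OF \<beta> zs[OF t]] dist_ad_map[OF \<beta> wt] dist_ad_map_star[OF \<beta> zs[OF t]])
    moreover have "dist (ad_map \<beta> (z (s + t)) g (ad_map \<beta> (\<theta> (w t)) g b')) (ad_map \<beta> (z (s + t)) g b'') =
        dist (ad_map \<beta> (\<theta> (w t)) g b') b''"
      by (rule dist_ad_map[OF \<beta> zs[OF t]])
    moreover have "dist (ad_map \<beta> (p t) g b) d \<le>
        dist (ad_map \<beta> (p t) g b) (ad_map \<beta> (z (s + t)) g (ad_map \<beta> (\<theta> (w t)) g b')) +
        dist (ad_map \<beta> (z (s + t)) g (ad_map \<beta> (\<theta> (w t)) g b')) (ad_map \<beta> (z (s + t)) g b'') +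
        dist (ad_map \<beta> (z (s + t)) g b'') d" by (rule dist_triangle4)
    ultimately show ?thesis by linarith
  qed
  have \<Phi>w: "ad_map \<beta> (\<theta> (w t)) g (\<Phi> g a) = \<Phi> g (ad_map \<alpha> (w t) g a)" if "0 \<le> t" for t g a
    using equivariant_ad[OF \<Phi> wu[of t]] that by simp
  show ?thesis
  proof
    show "unitary_path {0..} p" unfolding p_def
      by (rule unitary_path_mult[OF unitary_path_mult unitary_path_star])
        (rule unitary_path_shift[OF z(1) s(1)] equivariant_path[OF \<Phi> w(1)])+
    show "p 0 = 1" using zs[of 0] by (simp add: p_def w equivariant_one[OF \<Phi>] unitary_def)
    \<comment> \<open>\<open>4 = 1 + 1 + 2\<close> in the three terms of \<open>est\<close>: the
      choice of \<open>s\<close>, the estimate for \<open>w\<close> at time \<open>t\<close>, and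
      for the last term the choice of \<open>s\<close> together with the estimate at time 0, where
      \<open>w 0 = 1\<close>.\<close>
    show "dist (ad_map \<beta> (p t) g (\<Phi> g a)) (\<Phi> g a) \<le> 4 * \<epsilon>" if t: "0 \<le> t" and a: "a \<in> F" and g: "g \<in> K" for t a g
    proof -
      let ?x = "\<Phi> g (\<Psi> g (\<Phi> g a))"
      have 1: "dist (\<Phi> g a) (ad_map \<beta> (z (s + t)) g ?x) \<le> \<epsilon>"
        using s(2)[OF _ a g, of "s + t"] t by (simp add: dist_commute)
      have 2: "dist (ad_map \<beta> (\<theta> (w t)) g ?x) (\<Phi> g a) \<le> \<epsilon>"
        unfolding \<Phi>w[OF t] by (rule order_trans[OF dist\<Phi> good[OF t a g]])
      have "dist ?x (\<Phi> g a) \<le> \<epsilon>"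
        using order_trans[OF dist\<Phi> good[of 0, OF _ a g]] by (simp add: w(3) ad_map_one[OF \<alpha>])
      then have "dist (ad_map \<beta> (z (s + t)) g (\<Phi> g a)) (ad_map \<beta> (z (s + t)) g ?x) \<le> \<epsilon>"
        by (simp add: dist_ad_map[OF \<beta> zs[OF t]] dist_commute)
      then have 3: "dist (ad_map \<beta> (z (s + t)) g (\<Phi> g a)) (\<Phi> g a) \<le> 2 * \<epsilon>"
        using 1 dist_triangle[of "ad_map \<beta> (z (s + t)) g (\<Phi> g a)" "\<Phi> g a" "ad_map \<beta> (z (s + t)) g ?x"]
        by (simp add: dist_commute)
      show ?thesis using est[OF t, where b' = ?x and b'' = "\<Phi> g a" and d = "\<Phi> g a" and b = "\<Phi> g a" and g = g] 1 2 3
        by linarith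
    qed
    show "ucc_lim (\<lambda>t g b. ad_map \<beta> (p t) g (\<Phi> g (\<Psi> g b))) (\<lambda>g b. b)"
      unfolding ucc_lim_def
    proof (intro allI impI)
      fix b and L :: "'g set" and e :: real assume L: "compact L" and e: "0 < e"
      have e3: "0 < e / 3" using e by simp
      obtain T1 where T1: "0 \<le> T1" "\<And>t g. T1 \<le> t \<Longrightarrow> g \<in> L \<Longrightarrow>
          dist (ad_map \<beta> (z t) g (\<Phi> g (\<Psi> g (\<Phi> g (\<Psi> g b))))) (\<Phi> g (\<Psi> g b)) \<le> e / 3"
        using secB[OF _ L cont(3) e3, of b] by blast
      obtain T2 where T2: "0 \<le> T2" "\<And>t g. T2 \<le> t \<Longrightarrow> g \<in> L \<Longrightarrow>
          dist (ad_map \<alpha> (w t) g (\<Psi> g (\<Phi> g (\<Psi> g b)))) (\<Psi> g b) \<le> e / 3"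
        using secA[OF _ L cont(2) e3, of b] by blast
      obtain T3 where T3: "0 \<le> T3" "\<And>t g. T3 \<le> t \<Longrightarrow> g \<in> L \<Longrightarrow>
          dist (ad_map \<beta> (z t) g (\<Phi> g (\<Psi> g b))) b \<le> e / 3"
        using ucc_limD[OF z(2) L e3, of b] by blast
      show "\<exists>T\<ge>0. \<forall>t\<ge>T. \<forall>g\<in>L. dist (ad_map \<beta> (p t) g (\<Phi> g (\<Psi> g b))) b \<le> e"
      proof (intro exI[of _ "max T1 (max T2 T3)"] conjI allI impI ballI)
        fix t g assume t: "max T1 (max T2 T3) \<le> t" and g: "g \<in> L"
        have t0: "0 \<le> t" using t T1(1) by simp
        have "dist (ad_map \<beta> (\<theta> (w t)) g (\<Phi> g (\<Psi> g (\<Phi> g (\<Psi> g b))))) (\<Phi> g (\<Psi> g b)) \<le> e / 3"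
          unfolding \<Phi>w[OF t0] by (rule order_trans[OF dist\<Phi> T2(2)[OF _ g]]) (use t in simp)
        then show "dist (ad_map \<beta> (p t) g (\<Phi> g (\<Psi> g b))) b \<le> e"
          using est[OF t0, where b = "\<Phi> g (\<Psi> g b)" and b' = "\<Phi> g (\<Psi> g (\<Phi> g (\<Psi> g b)))" and b'' = "\<Phi> g (\<Psi> g b)"
              and d = b and g = g] T1(2)[OF _ g, of "s + t"] T3(2)[OF _ g, of "s + t"] t s(1)
          by (simp add: dist_commute)
      qed (use T1(1) in simp)
    qed
  qed
qed

text \<open>The path is cut at a time \<open>S\<close> after which it keeps the conjugated
  \<open>\<Phi>\<Psi>\<close> within \<open>\<delta>\<close> of the identity on \<open>G\<close> and
  \<open>L\<close>. The part before \<open>S\<close>, run over \<open>{0..1}\<close>, will be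
  concatenated; the part after \<open>S\<close> is the well-behaved path of the next state.\<close>

lemma intertwined_step:
  fixes \<alpha> :: "'g::topological_space \<Rightarrow> 'a::cstar_algebra \<Rightarrow> 'a" and \<beta> :: "'g \<Rightarrow> 'b::cstar_algebra \<Rightarrow> 'b"
  assumes \<Phi>: "equivariant \<alpha> \<beta> \<Phi> \<theta>" and \<Psi>: "equivariant \<beta> \<alpha> \<Psi> \<eta>"
    and I: "intertwined \<alpha> \<beta> \<Phi> \<Psi> F K \<epsilon> w z"
    and F: "finite F" "compact K" "0 < \<epsilon>" and G: "finite G" "compact L" "0 < \<delta>"
  obtains p w' z' where "unitary_path {0..1 :: real} p" "p 0 = 1"
    "\<And>t a g. t \<in> {0..1} \<Longrightarrow> a \<in> F \<Longrightarrow> g \<in> K \<Longrightarrow> dist (ad_map \<beta> (p t) g (\<Phi> g a)) (\<Phi> g a) \<le> 4 * \<epsilon>"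
    "intertwined \<beta> \<alpha> \<Psi> (\<lambda>g a. ad_map \<beta> (p 1) g (\<Phi> g a)) G L \<delta> w' z'"
proof -
  obtain p where p: "unitary_path {0..} p" "p 0 = 1"
    "ucc_lim (\<lambda>t g b. ad_map \<beta> (p t) g (\<Phi> g (\<Psi> g b))) (\<lambda>g b. b)"
    "\<And>t a g. 0 \<le> t \<Longrightarrow> a \<in> F \<Longrightarrow> g \<in> K \<Longrightarrow> dist (ad_map \<beta> (p t) g (\<Phi> g a)) (\<Phi> g a) \<le> 4 * \<epsilon>"
    using intertwined_path[OF \<Phi> \<Psi> I F] by blast
  have "\<exists>T\<ge>0. \<forall>t\<ge>T. \<forall>b\<in>G. \<forall>g\<in>L. dist (ad_map \<beta> (p t) g (\<Phi> g (\<Psi> g b))) b \<le> \<delta>"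
    by (rule finite_threshold[OF G(1)]) (use ucc_limD[OF p(3) G(2,3)] in auto)
  then obtain S where S: "0 \<le> S" "\<And>t b g. S \<le> t \<Longrightarrow> b \<in> G \<Longrightarrow> g \<in> L \<Longrightarrow>
      dist (ad_map \<beta> (p t) g (\<Phi> g (\<Psi> g b))) b \<le> \<delta>" by blast
  have w: "unitary_path {0..} w" "ucc_lim (\<lambda>t g a. ad_map \<alpha> (w t) g (\<Psi> g (\<Phi> g a))) (\<lambda>g a. a)"
    using I by (auto simp: intertwined_def)
  show ?thesis
  proof
    show "unitary_path {0..1} (\<lambda>t. p (S * t))"
      by (rule unitary_path_compose[OF p(1)]) (use S(1) in \<open>auto intro!: continuous_intros\<close>)
    show "intertwined \<beta> \<alpha> \<Psi> (\<lambda>g a. ad_map \<beta> (p (S * 1)) g (\<Phi> g a)) G L \<delta>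
        (\<lambda>t. p (S + t) * star (p S)) (\<lambda>t. w t * star (\<eta> (p S)))"
      using intertwined_cut[OF \<Phi> \<Psi> p(1,3) w S] by simp
  qed (use p S(1) in auto)
qed

section \<open>The alternating sequence of unitaries\<close>

definition slow_path ::
    "('g::topological_space \<Rightarrow> 'b::cstar_algebra \<Rightarrow> 'b) \<Rightarrow> ('g \<Rightarrow> 'a \<Rightarrow> 'b) \<Rightarrow> (nat \<Rightarrow> 'a) \<Rightarrow> (nat \<Rightarrow> 'g set) \<Rightarrow>
     nat \<Rightarrow> 'b multiplier \<Rightarrow> (real \<Rightarrow> 'b multiplier) \<Rightarrow> bool" where
  "slow_path \<beta> \<Phi> a K n x p \<longleftrightarrow> unitary_path {0..1} p \<and> p 0 = 1 \<and>
     (\<forall>t\<in>{0..1}. \<forall>i\<le>n. \<forall>g\<in>K n.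
        dist (ad_map \<beta> (p t) g (ad_map \<beta> x g (\<Phi> g (a i)))) (ad_map \<beta> x g (\<Phi> g (a i))) \<le> 4 / 2 ^ n)"

text \<open>\<open>x\<close> and \<open>y\<close> are the unitaries accumulated so far. The paths
  are hidden in an existential, as later stages only need that some such paths exist.\<close>

definition stage ::
    "('g::topological_space \<Rightarrow> 'a::cstar_algebra \<Rightarrow> 'a) \<Rightarrow> ('g \<Rightarrow> 'b::cstar_algebra \<Rightarrow> 'b) \<Rightarrow>
     ('g \<Rightarrow> 'a \<Rightarrow> 'b) \<Rightarrow> ('g \<Rightarrow> 'b \<Rightarrow> 'a) \<Rightarrow> (nat \<Rightarrow> 'a) \<Rightarrow> (nat \<Rightarrow> 'g set) \<Rightarrow> nat \<Rightarrow>
     'b multiplier \<Rightarrow> 'a multiplier \<Rightarrow> bool" where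
  "stage \<alpha> \<beta> \<Phi> \<Psi> a K n x y \<longleftrightarrow> unitary x \<and> unitary y \<and>
     (\<exists>w z. intertwined \<alpha> \<beta> (\<lambda>g a. ad_map \<beta> x g (\<Phi> g a)) (\<lambda>g b. ad_map \<alpha> y g (\<Psi> g b))
        (a ` {..n}) (K n) (1 / 2 ^ n) w z)"

text \<open>At time 0 the path in \<open>intertwined\<close> is \<open>1\<close>, so its estimate
  speaks about the two conjugated families themselves.\<close>

lemma stage_dist:
  assumes "nondegenerate_action \<alpha>" "stage \<alpha> \<beta> \<Phi> \<Psi> a K n x y" "i \<le> n" "g \<in> K n"
  shows "dist (ad_map \<alpha> y g (\<Psi> g (ad_map \<beta> x g (\<Phi> g (a i))))) (a i) \<le> 1 / 2 ^ n"
proof -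
  obtain w z where I: "intertwined \<alpha> \<beta> (\<lambda>g a. ad_map \<beta> x g (\<Phi> g a)) (\<lambda>g b. ad_map \<alpha> y g (\<Psi> g b))
      (a ` {..n}) (K n) (1 / 2 ^ n) w z"
    using assms(2) by (auto simp: stage_def)
  then have w0: "w 0 = 1" by (simp add: intertwined_def)
  have "\<forall>t\<ge>0. \<forall>c\<in>a ` {..n}. \<forall>g\<in>K n.
      dist (ad_map \<alpha> (w t) g (ad_map \<alpha> y g (\<Psi> g (ad_map \<beta> x g (\<Phi> g c))))) c \<le> 1 / 2 ^ n"
    using I unfolding intertwined_def by (elim conjE)
  from this[rule_format, of 0 "a i" g] show ?thesis using assms(3,4) by (simp add: w0 ad_map_one[OF assms(1)])
qed

text \<open>The new index \<open>m\<close> is left free because a round consists of two such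
  half-steps: the first keeps the index, the second raises it.\<close>

lemma stage_step:
  assumes \<Phi>: "equivariant \<alpha> \<beta> \<Phi> \<theta>" and \<Psi>: "equivariant \<beta> \<alpha> \<Psi> \<eta>"
    and K: "\<And>n. compact (K n)" and st: "stage \<alpha> \<beta> \<Phi> \<Psi> a K n x y"
  obtains p where "slow_path \<beta> \<Phi> a K n x p" "stage \<beta> \<alpha> \<Psi> \<Phi> b K m y (p 1 * x)"
proof -
  obtain w z where x: "unitary x" and y: "unitary y"
    and I: "intertwined \<alpha> \<beta> (\<lambda>g a. ad_map \<beta> x g (\<Phi> g a)) (\<lambda>g b. ad_map \<alpha> y g (\<Psi> g b))
      (a ` {..n}) (K n) (1 / 2 ^ n) w z"
    using st by (auto simp: stage_def)
  obtain p w' z' where p: "unitary_path {0..1 :: real} p" "p 0 = 1"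
    "\<And>t c g. t \<in> {0..1} \<Longrightarrow> c \<in> a ` {..n} \<Longrightarrow> g \<in> K n \<Longrightarrow>
      dist (ad_map \<beta> (p t) g (ad_map \<beta> x g (\<Phi> g c))) (ad_map \<beta> x g (\<Phi> g c)) \<le> 4 * (1 / 2 ^ n)"
    "intertwined \<beta> \<alpha> (\<lambda>g b. ad_map \<alpha> y g (\<Psi> g b)) (\<lambda>g a. ad_map \<beta> (p 1) g (ad_map \<beta> x g (\<Phi> g a)))
      (b ` {..m}) (K m) (1 / 2 ^ m) w' z'"
    by (rule intertwined_step[OF equivariant_conjugate[OF \<Phi> x] equivariant_conjugate[OF \<Psi> y] I _ K _ _ K,
          of "b ` {..m}" "1 / 2 ^ m" m]) auto
  show ?thesis
  proof
    show "slow_path \<beta> \<Phi> a K n x p" using p by (auto simp: slow_path_def)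
    have "unitary (p 1)" using unitary_path_unitary[OF p(1)] by simp
    then show "stage \<beta> \<alpha> \<Psi> \<Phi> b K m y (p 1 * x)"
      using p(4) x y unfolding stage_def ad_map_mult[OF equivariant_codomain[OF \<Phi>]]
      by (auto intro: unitary_mult)
  qed
qed

text \<open>The given paths may start anywhere. Cutting \<open>w\<close> at a late time
  \<open>S\<close> and absorbing \<open>w S\<close> into \<open>\<Psi>\<close> leaves a remainder
  that starts at \<open>1\<close>; this is \<open>intertwined_cut\<close> with the roles
  exchanged.\<close>

lemma stage_initial:
  assumes \<Phi>: "equivariant \<alpha> \<beta> \<Phi> \<theta>" and \<Psi>: "equivariant \<beta> \<alpha> \<Psi> \<eta>"
    and K: "\<And>n. compact (K n)"
    and w: "unitary_path {0..} w" "ucc_lim (\<lambda>t g a. ad_map \<alpha> (w t) g (\<Psi> g (\<Phi> g a))) (\<lambda>g a. a)"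
    and z: "unitary_path {0..} z" "ucc_lim (\<lambda>t g b. ad_map \<beta> (z t) g (\<Phi> g (\<Psi> g b))) (\<lambda>g b. b)"
  obtains y where "stage \<alpha> \<beta> \<Phi> \<Psi> a K 0 1 y"
proof -
  obtain S where S: "0 \<le> S" "\<And>t g. S \<le> t \<Longrightarrow> g \<in> K 0 \<Longrightarrow> dist (ad_map \<alpha> (w t) g (\<Psi> g (\<Phi> g (a 0)))) (a 0) \<le> 1"
    using ucc_limD[OF w(2) K, of 1 0 "a 0"] by auto
  have "intertwined \<alpha> \<beta> \<Phi> (\<lambda>g b. ad_map \<alpha> (w S) g (\<Psi> g b)) {a 0} (K 0) 1
      (\<lambda>t. w (S + t) * star (w S)) (\<lambda>t. z t * star (\<theta> (w S)))"
    by (rule intertwined_cut[OF \<Psi> \<Phi> w z S(1)]) (use S(2) in auto)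
  then have "stage \<alpha> \<beta> \<Phi> \<Psi> a K 0 1 (w S)"
    using unitary_path_unitary[OF w(1)] S(1)
    by (auto simp: stage_def ad_map_one[OF equivariant_codomain[OF \<Phi>]])
  then show ?thesis using that by blast
qed

text \<open>Within a round \<open>x\<close> moves first and \<open>y\<close> is then adjusted to the
  new \<open>x\<close>; hence the stage for \<open>\<Psi>\<close> at index \<open>n\<close> already
  refers to \<open>x (Suc n)\<close>.\<close>

lemma intertwining_sequence:
  fixes K :: "nat \<Rightarrow> 'g::topological_space set" and \<alpha> :: "'g \<Rightarrow> 'a::cstar_algebra \<Rightarrow> 'a" and \<beta> :: "'g \<Rightarrow> 'b::cstar_algebra \<Rightarrow> 'b"
  assumes \<Phi>: "equivariant \<alpha> \<beta> \<Phi> \<theta>" and \<Psi>: "equivariant \<beta> \<alpha> \<Psi> \<eta>"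
    and K: "\<And>n. compact (K n)"
    and w: "unitary_path {0..} w" "ucc_lim (\<lambda>t g a. ad_map \<alpha> (w t) g (\<Psi> g (\<Phi> g a))) (\<lambda>g a. a)"
    and z: "unitary_path {0..} z" "ucc_lim (\<lambda>t g b. ad_map \<beta> (z t) g (\<Phi> g (\<Psi> g b))) (\<lambda>g b. b)"
  obtains x y p q where "\<And>n. stage \<alpha> \<beta> \<Phi> \<Psi> a K n (x n) (y n)" "\<And>n. stage \<beta> \<alpha> \<Psi> \<Phi> b K n (y n) (x (Suc n))"
    "\<And>n. slow_path \<beta> \<Phi> a K n (x n) (p n)" "\<And>n. x (Suc n) = p n 1 * x n"
    "\<And>n. slow_path \<alpha> \<Psi> b K n (y n) (q n)" "\<And>n. y (Suc n) = q n 1 * y n"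
proof -
  define Q where "Q n = (\<lambda>(x, y) (x', y'). stage \<beta> \<alpha> \<Psi> \<Phi> b K n y x' \<and>
    (\<exists>p. slow_path \<beta> \<Phi> a K n x p \<and> x' = p 1 * x) \<and> (\<exists>q. slow_path \<alpha> \<Psi> b K n y q \<and> y' = q 1 * y))" for n
  have "\<exists>f. \<forall>n. (case f n of (x, y) \<Rightarrow> stage \<alpha> \<beta> \<Phi> \<Psi> a K n x y) \<and> Q n (f n) (f (Suc n))"
  proof (rule dependent_nat_choice)
    show "\<exists>xy. case xy of (x, y) \<Rightarrow> stage \<alpha> \<beta> \<Phi> \<Psi> a K 0 x y"
    proof -
      obtain y where "stage \<alpha> \<beta> \<Phi> \<Psi> a K 0 1 y" using stage_initial[of _ _ _ _ _ _ K, OF \<Phi> \<Psi> K w z] .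
      then show ?thesis by auto
    qed
    fix xy n assume "case xy of (x, y) \<Rightarrow> stage \<alpha> \<beta> \<Phi> \<Psi> a K n x y"
    then obtain x y where xy: "xy = (x, y)" "stage \<alpha> \<beta> \<Phi> \<Psi> a K n x y" by (cases xy) auto
    obtain p where p: "slow_path \<beta> \<Phi> a K n x p" "stage \<beta> \<alpha> \<Psi> \<Phi> b K n y (p 1 * x)"
      using stage_step[OF \<Phi> \<Psi> K xy(2)] .
    obtain q where q: "slow_path \<alpha> \<Psi> b K n y q" "stage \<alpha> \<beta> \<Phi> \<Psi> a K (Suc n) (p 1 * x) (q 1 * y)"
      using stage_step[OF \<Psi> \<Phi> K p(2)] .
    show "\<exists>xy'. (case xy' of (x, y) \<Rightarrow> stage \<alpha> \<beta> \<Phi> \<Psi> a K (Suc n) x y) \<and> Q n xy xy'"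
      using p q by (intro exI[of _ "(p 1 * x, q 1 * y)"]) (auto simp: Q_def xy)
  qed
  then obtain f where "\<forall>n. (case f n of (x, y) \<Rightarrow> stage \<alpha> \<beta> \<Phi> \<Psi> a K n x y) \<and> Q n (f n) (f (Suc n))" ..
  then have f: "case f n of (x, y) \<Rightarrow> stage \<alpha> \<beta> \<Phi> \<Psi> a K n x y" "Q n (f n) (f (Suc n))" for n
    by simp_all
  define x y where "x n = fst (f n)" and "y n = snd (f n)" for n
  have fxy: "f n = (x n, y n)" for n by (simp add: x_def y_def)
  have "\<exists>p. slow_path \<beta> \<Phi> a K n (x n) p \<and> x (Suc n) = p 1 * x n"
    "\<exists>q. slow_path \<alpha> \<Psi> b K n (y n) q \<and> y (Suc n) = q 1 * y n" for n
    using f(2)[of n] by (auto simp: Q_def fxy)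
  then obtain p q where "\<And>n. slow_path \<beta> \<Phi> a K n (x n) (p n)" "\<And>n. x (Suc n) = p n 1 * x n"
    "\<And>n. slow_path \<alpha> \<Psi> b K n (y n) (q n)" "\<And>n. y (Suc n) = q n 1 * y n" by metis
  moreover have "stage \<alpha> \<beta> \<Phi> \<Psi> a K n (x n) (y n)" "stage \<beta> \<alpha> \<Psi> \<Phi> b K n (y n) (x (Suc n))" for n
    using f[of n] by (auto simp: Q_def fxy)
  ultimately show ?thesis using that by blast
qed

section \<open>Concatenation and convergence of the paths\<close>

lemma continuous_on_nonneg_pieces:
  fixes f :: "real \<Rightarrow> 'b::topological_space"
  assumes f: "\<And>n. continuous_on {real n..real (Suc n)} f"
  shows "continuous_on {0..} f"
proof -
  have c: "continuous_on {0..real n} f" for n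
  proof (induction n)
    case (Suc n)
    have "{0..real (Suc n)} = {0..real n} \<union> {real n..real (Suc n)}" by auto
    then show ?case using continuous_on_closed_Un[OF _ _ Suc f] by simp
  qed simp
  show ?thesis
    unfolding continuous_on_def
  proof
    fix t :: real assume t: "t \<in> {0..}"
    obtain n where n: "t < real n" using reals_Archimedean2 by blast
    have "(f \<longlongrightarrow> f t) (at t within {0..real n})"
      using c[of n] t n by (auto simp: continuous_on_def)
    moreover have "at t within {0..real n} = at t within {0..}"
      by (rule at_within_nhd[of _ "{..<real n}"]) (use n in auto)
    ultimately show "(f \<longlongrightarrow> f t) (at t within {0..})" by simp
  qed
qed

lemma unitary_path_concatenate:
  assumes x: "\<And>n. unitary (x n)" and p: "\<And>n. unitary_path {0..1 :: real} (p n)" "\<And>n. p n 0 = 1"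
    and step: "\<And>n. x (Suc n) = p n 1 * x n"
  obtains X where "unitary_path {0..} X" "\<And>n t. t \<in> {0..1} \<Longrightarrow> X (real n + t) = p n t * x n"
proof
  define X where "X t = p (nat \<lfloor>t\<rfloor>) (t - \<lfloor>t\<rfloor>) * x (nat \<lfloor>t\<rfloor>)" for t :: real
  show X: "X (real n + t) = p n t * x n" if t: "t \<in> {0..1}" for n t
  \<comment> \<open>The floor assigns the right end point of a piece to the next piece; the values
    agree because \<open>p (Suc n) 0 = 1\<close>.\<close>
  proof (cases "t = 1")
    case True
    have k: "\<lfloor>real n + 1\<rfloor> = int (Suc n)" by linarith
    have "X (real n + 1) = p (Suc n) 0 * x (Suc n)" unfolding X_def k nat_int by simp
    then show ?thesis using True by (simp add: p(2) step)
  next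
    case False
    then have "\<lfloor>real n + t\<rfloor> = int n" using t by (simp add: floor_eq_iff)
    then show ?thesis by (simp add: X_def)
  qed
  show "unitary_path {0..} X"
  proof (rule unitary_pathI_ract)
    show "unitary (X t)" if "t \<in> {0..}" for t
    proof -
      have "t - \<lfloor>t\<rfloor> \<in> {0..1}" by (simp add: of_int_floor_le) linarith
      then show ?thesis using unitary_path_unitary[OF p(1)] x by (simp add: X_def unitary_mult)
    qed
    show "continuous_on {0..} (\<lambda>t. ract a (X t))" for a
    proof (rule continuous_on_nonneg_pieces)
      fix n
      have "unitary_path {real n..real (Suc n)} (\<lambda>t. p n (t - real n) * x n)"
        by (intro unitary_path_mult unitary_path_const x unitary_path_compose[OF p(1)])
          (auto intro!: continuous_intros)
      note unitary_path_ract[OF this, of a]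
      moreover have "ract a (p n (t - real n) * x n) = ract a (X t)" if "t \<in> {real n..real (Suc n)}" for t
        using X[of "t - real n" n] that by simp
      ultimately show "continuous_on {real n..real (Suc n)} (\<lambda>t. ract a (X t))"
        by (metis (mono_tags, lifting) continuous_on_cong)
    qed
  qed
qed

text \<open>On the dense sequence the movement during the piece \<open>n\<close> is eventually at
  most \<open>4 / 2 ^ n\<close>, uniformly over \<open>K n\<close>, hence summable. Nonexpansiveness
  carries the Cauchy property to all arguments, and every compact set lies in some
  \<open>K n\<close>.\<close>

lemma slow_path_limit:
  fixes K :: "nat \<Rightarrow> 'g::topological_space set" and \<beta> :: "'g::topological_space \<Rightarrow> 'b::cstar_algebra \<Rightarrow> 'b" and \<Phi> :: "'g \<Rightarrow> 'a::metric_space \<Rightarrow> 'b"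
  assumes \<beta>: "nondegenerate_action \<beta>" and \<Phi>: "\<And>g a b. dist (\<Phi> g a) (\<Phi> g b) \<le> dist a b"
    and x: "\<And>n. unitary (x n)" and p: "\<And>n. slow_path \<beta> \<Phi> a K n (x n) (p n)" "\<And>n. x (Suc n) = p n 1 * x n"
    and a: "closure (range a) = UNIV" and K: "mono K" "\<And>C. compact C \<Longrightarrow> \<exists>n. C \<subseteq> K n"
  obtains X \<Phi>\<^sub>0 where "unitary_path {0..} X" "\<And>n. X (real n) = x n"
    "ucc_lim (\<lambda>t g a. ad_map \<beta> (X t) g (\<Phi> g a)) \<Phi>\<^sub>0"
proof -
  have pp: "\<And>n. unitary_path {0..1 :: real} (p n)" "\<And>n. p n 0 = 1"
    and slow: "\<And>n t i g. t \<in> {0..1} \<Longrightarrow> i \<le> n \<Longrightarrow> g \<in> K n \<Longrightarrow>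
      dist (ad_map \<beta> (p n t) g (ad_map \<beta> (x n) g (\<Phi> g (a i)))) (ad_map \<beta> (x n) g (\<Phi> g (a i))) \<le> 4 / 2 ^ n"
    using p(1) by (auto simp: slow_path_def)
  obtain X where Xp: "unitary_path {0..} X" and X: "\<And>n t. t \<in> {0..1} \<Longrightarrow> X (real n + t) = p n t * x n"
    using unitary_path_concatenate[of x p, OF x pp p(2)] by blast
  have Xn: "X (real n) = x n" for n using X[of 0 n] pp(2) by simp
  define \<Theta> where "\<Theta> t g a = ad_map \<beta> (X t) g (\<Phi> g a)" for t g a
  have ne: "dist (\<Theta> t g a) (\<Theta> t g b) \<le> dist a b" if "0 \<le> t" for t g a b
    using \<Phi> unitary_path_unitary[OF Xp, of t] that by (simp add: \<Theta>_def dist_ad_map[OF \<beta>])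
  have piece: "dist (\<Theta> (real n + t) g (a i)) (\<Theta> (real n) g (a i)) \<le> 4 / 2 ^ n"
    if "t \<in> {0..1}" "i \<le> n" "g \<in> K n" for n t i g
    using slow[OF that] X[OF that(1)] by (simp add: \<Theta>_def Xn ad_map_mult[OF \<beta>])
  have Kmono: "g \<in> K m" if "g \<in> K n" "n \<le> m" for g n m using K(1) that by (auto simp: mono_def)
  \<comment> \<open>The bound is the sum of \<open>4 / 2 ^ j\<close> for
    \<open>n \<le> j < n + k\<close>; the subtracted term leaves room for an unfinished last
    piece.\<close>
  have tele: "dist (\<Theta> (real (n + k)) g (a i)) (\<Theta> (real n) g (a i)) \<le> 8 / 2 ^ n - 8 / 2 ^ (n + k)"
    if "i \<le> n" "g \<in> K n" for n k i g
  proof (induction k)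
    case (Suc k)
    have "real (n + Suc k) = real (n + k) + 1" by simp
    moreover have "dist (\<Theta> (real (n + k) + 1) g (a i)) (\<Theta> (real (n + k)) g (a i)) \<le> 4 / 2 ^ (n + k)"
      using that Kmono by (intro piece) auto
    ultimately have "dist (\<Theta> (real (n + Suc k)) g (a i)) (\<Theta> (real (n + k)) g (a i)) \<le> 4 / 2 ^ (n + k)"
      by (simp only:)
    moreover have "8 / 2 ^ (n + k) - 8 / 2 ^ (n + Suc k) = 4 / (2 ^ (n + k) :: real)" by (simp add: field_simps)
    ultimately show ?case
      using Suc dist_triangle[of "\<Theta> (real (n + Suc k)) g (a i)" "\<Theta> (real n) g (a i)" "\<Theta> (real (n + k)) g (a i)"]
      by linarith
  qed simp
  have near: "dist (\<Theta> t g (a i)) (\<Theta> (real n) g (a i)) \<le> 8 / 2 ^ n"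
    if t: "real n \<le> t" and i: "i \<le> n" and g: "g \<in> K n" for n t i g
  proof -
    define m where "m = nat \<lfloor>t\<rfloor>"
    have m: "n \<le> m" "t - real m \<in> {0..1}"
      using t unfolding m_def by (auto simp: le_nat_floor) linarith
    have "dist (\<Theta> (real m + (t - real m)) g (a i)) (\<Theta> (real m) g (a i)) \<le> 4 / 2 ^ m"
      by (rule piece) (use i m g Kmono in auto)
    moreover have "dist (\<Theta> (real m) g (a i)) (\<Theta> (real n) g (a i)) \<le> 8 / 2 ^ n - 8 / 2 ^ m"
      using tele[OF i g, of "m - n"] m(1) by simp
    moreover have "(4 :: real) / 2 ^ m \<le> 8 / 2 ^ m" by (simp add: divide_right_mono)
    ultimately show ?thesis
      using dist_triangle[of "\<Theta> t g (a i)" "\<Theta> (real n) g (a i)" "\<Theta> (real m) g (a i)"] by simp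
  qed
  have cauchy: "\<exists>n. \<forall>t\<ge>real n. \<forall>s\<ge>real n. \<forall>g\<in>C. dist (\<Theta> t g b) (\<Theta> s g b) \<le> e"
    if C: "compact C" and e: "0 < e" for b C e
  proof -
    obtain i where i: "dist (a i) b < e / 4"
      using a e closure_approachable[of b "range a"] by (metis UNIV_I rangeE zero_less_divide_iff zero_less_numeral)
    obtain k where k: "C \<subseteq> K k" using K(2)[OF C] by blast
    \<comment> \<open>Four errors of \<open>e / 4\<close> will be added, and
      \<open>32 / e < 2 ^ n\<close> amounts to \<open>8 / 2 ^ n < e / 4\<close>.\<close>
    obtain l where l: "32 / e < 2 ^ l" using real_arch_pow[of 2 "32 / e"] by auto
    define n where "n = max i (max k l)"
    have "(2 :: real) ^ l \<le> 2 ^ n" by (rule power_increasing) (auto simp: n_def)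
    then have "32 / e < 2 ^ n" using l by linarith
    then have n: "8 / 2 ^ n \<le> e / 4" using e by (simp add: field_simps)
    have "dist (\<Theta> t g b) (\<Theta> s g b) \<le> e" if t: "real n \<le> t" and s: "real n \<le> s" and g: "g \<in> C" for t s g
    proof -
      have g': "g \<in> K n" using Kmono[of g k n] k g by (auto simp: n_def)
      have 0: "0 \<le> t" "0 \<le> s" using t s by (auto intro: order_trans[OF of_nat_0_le_iff])
      have "dist (\<Theta> t g b) (\<Theta> t g (a i)) \<le> e / 4" "dist (\<Theta> s g b) (\<Theta> s g (a i)) \<le> e / 4"
        using ne[OF 0(1), of g b "a i"] ne[OF 0(2), of g b "a i"] i by (simp_all add: dist_commute)
      moreover have "dist (\<Theta> t g (a i)) (\<Theta> (real n) g (a i)) \<le> e / 4" "dist (\<Theta> s g (a i)) (\<Theta> (real n) g (a i)) \<le> e / 4"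
        using near[OF t _ g', of i] near[OF s _ g', of i] n by (simp_all add: n_def)
      ultimately show ?thesis
        using dist_triangle4[of "\<Theta> t g b" "\<Theta> s g b" "\<Theta> t g (a i)" "\<Theta> s g (a i)"]
          dist_triangle2[of "\<Theta> t g (a i)" "\<Theta> s g (a i)" "\<Theta> (real n) g (a i)"]
        by (simp add: dist_commute)
    qed
    then show ?thesis by blast
  qed
  define \<Phi>\<^sub>0 where "\<Phi>\<^sub>0 g b = lim (\<lambda>n. \<Theta> (real n) g b)" for g b
  have lim: "(\<lambda>n. \<Theta> (real n) g b) \<longlonglongrightarrow> \<Phi>\<^sub>0 g b" for g b
  proof -
    have "Cauchy (\<lambda>n. \<Theta> (real n) g b)"
    proof (rule metric_CauchyI)
      fix e :: real assume "0 < e"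
      then obtain n where n: "\<forall>t\<ge>real n. \<forall>s\<ge>real n. \<forall>g\<in>{g}. dist (\<Theta> t g b) (\<Theta> s g b) \<le> e / 2"
        using cauchy[of "{g}" "e / 2" b] by auto
      have "dist (\<Theta> (real i) g b) (\<Theta> (real j) g b) < e" if "i \<ge> n" "j \<ge> n" for i j
        using n[rule_format, of "real i" "real j" g] that \<open>0 < e\<close> by simp
      then show "\<exists>M. \<forall>i\<ge>M. \<forall>j\<ge>M. dist (\<Theta> (real i) g b) (\<Theta> (real j) g b) < e" by blast
    qed
    then show ?thesis unfolding \<Phi>\<^sub>0_def by (rule Cauchy_convergent[THEN convergent_LIMSEQ_iff[THEN iffD1]])
  qed
  have "ucc_lim \<Theta> \<Phi>\<^sub>0"
    unfolding ucc_lim_def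
  proof (intro allI impI)
    fix b and C :: "'g set" and e :: real assume "compact C" "0 < e"
    then obtain n where n: "\<And>t s g. real n \<le> t \<Longrightarrow> real n \<le> s \<Longrightarrow> g \<in> C \<Longrightarrow> dist (\<Theta> t g b) (\<Theta> s g b) \<le> e"
      using cauchy[of C e b] by blast
    have "dist (\<Theta> t g b) (\<Phi>\<^sub>0 g b) \<le> e" if t: "real n \<le> t" and g: "g \<in> C" for t g
    proof (rule tendsto_upperbound)
      show "(\<lambda>m. dist (\<Theta> t g b) (\<Theta> (real m) g b)) \<longlonglongrightarrow> dist (\<Theta> t g b) (\<Phi>\<^sub>0 g b)"
        by (intro tendsto_intros lim)
      show "\<forall>\<^sub>F m in sequentially. dist (\<Theta> t g b) (\<Theta> (real m) g b) \<le> e"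
        using n[OF t _ g] by (intro eventually_sequentiallyI[of n]) auto
    qed simp
    then show "\<exists>T\<ge>0. \<forall>t\<ge>T. \<forall>g\<in>C. dist (\<Theta> t g b) (\<Phi>\<^sub>0 g b) \<le> e" by (intro exI[of _ "real n"]) auto
  qed
  then show ?thesis using that[OF Xp Xn, of \<Phi>\<^sub>0] unfolding \<Theta>_def by blast
qed

section \<open>The limit maps are mutually inverse\<close>

lemma ucc_lim_pointwise:
  fixes \<Theta> :: "real \<Rightarrow> 'g::topological_space \<Rightarrow> 'a \<Rightarrow> 'b::metric_space"
  assumes "ucc_lim \<Theta> \<Theta>\<^sub>0"
  shows "((\<lambda>t. \<Theta> t g a) \<longlongrightarrow> \<Theta>\<^sub>0 g a) at_top"
proof (rule tendstoI)
  fix e :: real assume "0 < e"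
  then obtain T where "\<forall>t\<ge>T. dist (\<Theta> t g a) (\<Theta>\<^sub>0 g a) \<le> e / 2"
    using ucc_limD[OF assms, of "{g}" "e / 2" a] by auto
  then show "\<forall>\<^sub>F t in at_top. dist (\<Theta> t g a) (\<Theta>\<^sub>0 g a) < e"
    using \<open>0 < e\<close> by (intro eventually_at_top_linorderI[of T]) force
qed

lemma ucc_lim_sequence:
  fixes \<Theta> :: "real \<Rightarrow> 'g::topological_space \<Rightarrow> 'a \<Rightarrow> 'b::metric_space"
  assumes "ucc_lim \<Theta> \<Theta>\<^sub>0"
  shows "(\<lambda>n. \<Theta> (real n) g a) \<longlonglongrightarrow> \<Theta>\<^sub>0 g a"
  using filterlim_compose[OF ucc_lim_pointwise[OF assms] filterlim_real_sequentially] .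

lemma nonexpansive_limit:
  fixes f :: "nat \<Rightarrow> 'a::metric_space \<Rightarrow> 'b::metric_space"
  assumes "\<And>n x y. dist (f n x) (f n y) \<le> dist x y" "\<And>x. (\<lambda>n. f n x) \<longlonglongrightarrow> f' x"
  shows "dist (f' x) (f' y) \<le> dist x y"
  by (rule tendsto_upperbound[OF tendsto_dist[OF assms(2) assms(2)]]) (simp_all add: assms(1))

text \<open>Since \<open>h n\<close> is nonexpansive, \<open>h n (f n x)\<close> differs from
  \<open>h' (f' x)\<close> by at most
  \<open>dist (f n x) (f' x) + dist (h n (f' x)) (h' (f' x))\<close>. So compositions converge to
  the composition, and equality on the dense sequence extends by continuity.\<close>

lemma contraction_limits_inverse:
  fixes f :: "nat \<Rightarrow> 'a::metric_space \<Rightarrow> 'b::metric_space" and h :: "nat \<Rightarrow> 'b \<Rightarrow> 'a"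
  assumes f: "\<And>n x y. dist (f n x) (f n y) \<le> dist x y" "\<And>x. (\<lambda>n. f n x) \<longlonglongrightarrow> f' x"
    and h: "\<And>n x y. dist (h n x) (h n y) \<le> dist x y" "\<And>x. (\<lambda>n. h n x) \<longlonglongrightarrow> h' x"
    and a: "closure (range a) = UNIV" "\<And>i. (\<lambda>n. h n (f n (a i))) \<longlonglongrightarrow> a i"
  shows "h' (f' x) = x"
proof (rule dense_closed_induct[OF a(1), where P = "\<lambda>x. h' (f' x) = x"])
  show "closed {x. h' (f' x) = x}"
  proof (intro closed_Collect_eq continuous_on_id)
    have "continuous_on UNIV f'"
      using continuous_on_nonexpansive[of UNIV "\<lambda>_. f'" "\<lambda>x. x"] nonexpansive_limit[OF f] by simp
    then show "continuous_on UNIV (\<lambda>x. h' (f' x))"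
      using continuous_on_nonexpansive[of UNIV "\<lambda>_. h'" f'] nonexpansive_limit[OF h] by simp
  qed
  fix x assume "x \<in> range a"
  then obtain i where x: "x = a i" by blast
  have "(\<lambda>n. dist (f n x) (f' x) + dist (h n (f' x)) (h' (f' x))) \<longlonglongrightarrow> dist (f' x) (f' x) + dist (h' (f' x)) (h' (f' x))"
    by (intro tendsto_intros f h)
  then have "(\<lambda>n. dist (f n x) (f' x) + dist (h n (f' x)) (h' (f' x))) \<longlonglongrightarrow> 0" by simp
  then have "(\<lambda>n. h n (f n x)) \<longlonglongrightarrow> h' (f' x)"
  proof (rule metric_tendsto_imp_tendsto)
    have "dist (h n (f n x)) (h' (f' x)) \<le> dist (f n x) (f' x) + dist (h n (f' x)) (h' (f' x))" for n
      using dist_triangle[of "h n (f n x)" "h' (f' x)" "h n (f' x)"] h(1)[of n "f n x" "f' x"] by simp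
    then show "\<forall>\<^sub>F n in sequentially. dist (h n (f n x)) (h' (f' x)) \<le>
        dist (dist (f n x) (f' x) + dist (h n (f' x)) (h' (f' x))) 0" by (simp add: dist_real_def)
  qed
  then show "h' (f' x) = x" using LIMSEQ_unique a(2) x by blast
qed

theorem intertwining:
  fixes K :: "nat \<Rightarrow> 'g::topological_space set" and \<alpha> :: "'g \<Rightarrow> 'a::cstar_algebra \<Rightarrow> 'a" and \<beta> :: "'g \<Rightarrow> 'b::cstar_algebra \<Rightarrow> 'b"
  assumes \<Phi>: "equivariant \<alpha> \<beta> \<Phi> \<theta>" and \<Psi>: "equivariant \<beta> \<alpha> \<Psi> \<eta>"
    and w: "unitary_path {0..} w" "ucc_lim (\<lambda>t g a. ad_map \<alpha> (w t) g (\<Psi> g (\<Phi> g a))) (\<lambda>g a. a)"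
    and z: "unitary_path {0..} z" "ucc_lim (\<lambda>t g b. ad_map \<beta> (z t) g (\<Phi> g (\<Psi> g b))) (\<lambda>g b. b)"
    and a: "closure (range (a :: nat \<Rightarrow> 'a)) = UNIV" and b: "closure (range (b :: nat \<Rightarrow> 'b)) = UNIV"
    and K: "\<And>n. compact (K n)" "mono K" "\<And>C. compact C \<Longrightarrow> \<exists>n. C \<subseteq> K n"
  obtains X Y \<Phi>\<^sub>0 \<Psi>\<^sub>0 where "unitary_path {0..} X" "ucc_lim (\<lambda>t g a. ad_map \<beta> (X t) g (\<Phi> g a)) \<Phi>\<^sub>0"
    "unitary_path {0..} Y" "ucc_lim (\<lambda>t g b. ad_map \<alpha> (Y t) g (\<Psi> g b)) \<Psi>\<^sub>0"
    "\<And>g a. \<Psi>\<^sub>0 g (\<Phi>\<^sub>0 g a) = a" "\<And>g b. \<Phi>\<^sub>0 g (\<Psi>\<^sub>0 g b) = b"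
proof -
  note \<alpha> = equivariant_domain[OF \<Phi>] and \<beta> = equivariant_codomain[OF \<Phi>]
  obtain x y p q where st: "\<And>n. stage \<alpha> \<beta> \<Phi> \<Psi> a K n (x n) (y n)" "\<And>n. stage \<beta> \<alpha> \<Psi> \<Phi> b K n (y n) (x (Suc n))"
    and p: "\<And>n. slow_path \<beta> \<Phi> a K n (x n) (p n)" "\<And>n. x (Suc n) = p n 1 * x n"
    and q: "\<And>n. slow_path \<alpha> \<Psi> b K n (y n) (q n)" "\<And>n. y (Suc n) = q n 1 * y n"
    by (rule intertwining_sequence[of _ _ _ _ _ _ K _ _ a b, OF \<Phi> \<Psi> K(1) w z]) (rule that)
  have x: "unitary (x n)" and y: "unitary (y n)" for n using st(1)[of n] by (auto simp: stage_def)
  obtain X \<Phi>\<^sub>0 where X: "unitary_path {0..} X" "\<And>n. X (real n) = x n" "ucc_lim (\<lambda>t g a. ad_map \<beta> (X t) g (\<Phi> g a)) \<Phi>\<^sub>0"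
    by (rule slow_path_limit[OF \<beta> equivariant_dist[OF \<Phi>] x p a K(2,3)]) (assumption, rule that)
  obtain Y \<Psi>\<^sub>0 where Y: "unitary_path {0..} Y" "\<And>n. Y (real n) = y n" "ucc_lim (\<lambda>t g b. ad_map \<alpha> (Y t) g (\<Psi> g b)) \<Psi>\<^sub>0"
    by (rule slow_path_limit[OF \<alpha> equivariant_dist[OF \<Psi>] y q b K(2,3)]) (assumption, rule that)
  note limX = ucc_lim_sequence[OF X(3), unfolded X(2)] and limY = ucc_lim_sequence[OF Y(3), unfolded Y(2)]
  have lim: "f \<longlonglongrightarrow> c"
    if "\<And>n. i \<le> n \<Longrightarrow> g \<in> K n \<Longrightarrow> dist (f n) c \<le> 1 / 2 ^ n" for f :: "nat \<Rightarrow> 'c::metric_space" and c i g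
  proof (rule metric_tendsto_imp_tendsto)
    show "(\<lambda>n. (1 / 2 :: real) ^ n) \<longlonglongrightarrow> 0" by (rule LIMSEQ_power_zero) simp
    obtain k where k: "g \<in> K k" using K(3)[of "{g}"] by auto
    have "dist (f n) c \<le> dist ((1 / 2 :: real) ^ n) 0" if "n \<ge> max i k" for n
    proof -
      have "g \<in> K n" using k monoD[OF K(2), of k n] that by auto
      then show ?thesis using \<open>\<And>n. i \<le> n \<Longrightarrow> g \<in> K n \<Longrightarrow> dist (f n) c \<le> 1 / 2 ^ n\<close>[of n] that
        by (simp add: power_divide)
    qed
    then show "\<forall>\<^sub>F n in sequentially. dist (f n) c \<le> dist ((1 / 2 :: real) ^ n) 0"
      by (auto intro: eventually_sequentiallyI[of "max i k"])
  qed
  have dX: "dist (ad_map \<beta> (x n) g (\<Phi> g c)) (ad_map \<beta> (x n) g (\<Phi> g d)) \<le> dist c d" for n g c d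
    by (simp add: dist_ad_map[OF \<beta> x] equivariant_dist[OF \<Phi>])
  have dY: "dist (ad_map \<alpha> (y n) g (\<Psi> g c)) (ad_map \<alpha> (y n) g (\<Psi> g d)) \<le> dist c d" for n g c d
    by (simp add: dist_ad_map[OF \<alpha> y] equivariant_dist[OF \<Psi>])
  have "\<Psi>\<^sub>0 g (\<Phi>\<^sub>0 g c) = c" for g c
    by (rule contraction_limits_inverse[OF dX limX dY limY a]) (rule lim, rule stage_dist[OF \<alpha> st(1)])
  \<comment> \<open>The stages for this composition pair \<open>y n\<close> with
    \<open>x (Suc n)\<close>, which is why the limit along \<open>x\<close> is shifted.\<close>
  moreover have "\<Phi>\<^sub>0 g (\<Psi>\<^sub>0 g c) = c" for g c
    by (rule contraction_limits_inverse[OF dY limY dX LIMSEQ_Suc[OF limX] b])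
      (rule lim, rule stage_dist[OF \<beta> st(2)])
  ultimately show ?thesis using that X Y by blast
qed

section \<open>Topological preliminaries\<close>

text \<open>By local compactness the basic open sets contained in compact sets cover the space.
  \<open>K n\<close> collects compact hulls of the sets with index up to \<open>n\<close>; a compact
  set needs only finitely many of them.\<close>

lemma compact_exhaustion:
  assumes lc: "locally_compact_space (euclidean :: 'g::second_countable_topology topology)"
  obtains K :: "nat \<Rightarrow> 'g::second_countable_topology set" where "\<And>n. compact (K n)" "mono K" "\<And>C. compact C \<Longrightarrow> \<exists>n. C \<subseteq> K n"
proof -
  obtain B :: "'g set set" where B: "countable B" "topological_basis B"
    using ex_countable_basis by blast
  \<comment> \<open>The empty set keeps the family nonempty, so that it can be enumerated.\<close>
  define B' where "B' = insert {} {U \<in> B. \<exists>C. compact C \<and> U \<subseteq> C}"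
  have "\<exists>C. \<forall>U\<in>B'. compact (C U) \<and> U \<subseteq> C U"
    by (intro bchoice) (auto simp: B'_def)
  then obtain C where C: "\<And>U. U \<in> B' \<Longrightarrow> compact (C U)" "\<And>U. U \<in> B' \<Longrightarrow> U \<subseteq> C U" by blast
  have B': "countable B'" "B' \<noteq> {}" using B(1) by (auto simp: B'_def)
  define b where "b = from_nat_into B'"
  have b: "range b = B'" unfolding b_def by (rule range_from_nat_into[OF B'(2,1)])
  have op: "open U" if "U \<in> B'" for U
    using that topological_basis_open[OF B(2)] by (auto simp: B'_def)
  have cover: "\<exists>i. x \<in> b i" for x
  proof -
    obtain U D where U: "open U" "compact D" "x \<in> U" "U \<subseteq> D"
      using lc[unfolded locally_compact_space_def] by simp metis
    obtain V where V: "V \<in> B" "x \<in> V" "V \<subseteq> U"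
      using topological_basisE[OF B(2) U(1,3)] by blast
    moreover have "V \<subseteq> D" using V(3) U(4) by blast
    ultimately have "V \<in> B'" using U(2) unfolding B'_def by blast
    then have "V \<in> range b" by (simp add: b)
    then show ?thesis using V(2) by blast
  qed
  define K where "K n = (\<Union>i\<le>n. C (b i))" for n
  have bB: "b i \<in> B'" for i using b by blast
  show ?thesis
  proof
    show "compact (K n)" for n unfolding K_def using C(1)[OF bB] by (intro compact_UN) auto
    show "mono K" by (rule monoI) (force simp: K_def)
    fix D :: "'g set" assume "compact D"
    then obtain I where I: "finite I" "D \<subseteq> (\<Union>i\<in>I. b i)"
      using cover op[OF bB] by (elim compactE_image[where C = UNIV and f = b]) auto
    have "D \<subseteq> K (Max (insert 0 I))"
    proof
      fix x assume "x \<in> D"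
      then obtain i where i: "i \<in> I" "x \<in> b i" using I by blast
      then have "i \<le> Max (insert 0 I)" using I(1) by simp
      then show "x \<in> K (Max (insert 0 I))" using i(2) C(2)[OF bB] by (force simp: K_def)
    qed
    then show "\<exists>n. D \<subseteq> K n" by blast
  qed
qed

lemma separable_space_dense_sequence:
  assumes "separable_space (euclidean :: 'a::topological_space topology)"
  obtains a :: "nat \<Rightarrow> 'a::topological_space" where "closure (range a) = UNIV"
proof -
  obtain C :: "'a set" where C: "countable C" "closure C = UNIV"
    using assms unfolding separable_space_def by auto
  then have "C \<noteq> {}" by auto
  then have "range (from_nat_into C) = C" using C(1) by (rule range_from_nat_into)
  then show ?thesis using that C(2) by metis
qed

text \<open>Uniform convergence is available on compact sets only; local compactness puts a
  neighbourhood of \<open>g\<close> inside one.\<close>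

lemma ucc_lim_continuous:
  fixes \<Theta> :: "real \<Rightarrow> 'g::topological_space \<Rightarrow> 'a \<Rightarrow> 'b::metric_space"
  assumes lc: "locally_compact_space (euclidean :: 'g topology)" and lim: "ucc_lim \<Theta> \<Theta>\<^sub>0"
    and cont: "\<And>t. 0 \<le> t \<Longrightarrow> continuous_on UNIV (\<lambda>g. \<Theta> t g a)"
  shows "continuous_on UNIV (\<lambda>g. \<Theta>\<^sub>0 g a)"
  unfolding continuous_on_def
proof (intro ballI tendstoI)
  fix g :: 'g and e :: real assume e: "0 < e"
  obtain U D where U: "open U" "compact D" "g \<in> U" "U \<subseteq> D"
    using lc[unfolded locally_compact_space_def] by simp metis
  obtain T where T: "T \<ge> 0" "\<And>g. g \<in> D \<Longrightarrow> dist (\<Theta> T g a) (\<Theta>\<^sub>0 g a) \<le> e / 4"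
    using ucc_limD[OF lim U(2), of "e / 4" a] e by auto
  have "\<forall>\<^sub>F h in at g. dist (\<Theta> T h a) (\<Theta> T g a) < e / 4"
    by (rule tendstoD) (use cont[OF T(1)] e in \<open>auto simp: continuous_on_def\<close>)
  moreover have "\<forall>\<^sub>F h in at g. h \<in> U" using U by (intro eventually_at_in_open') auto
  ultimately show "\<forall>\<^sub>F h in at g within UNIV. dist (\<Theta>\<^sub>0 h a) (\<Theta>\<^sub>0 g a) < e"
  proof eventually_elim
    case (elim h)
    then show ?case
      using dist_triangle4[of "\<Theta>\<^sub>0 h a" "\<Theta>\<^sub>0 g a" "\<Theta> T h a" "\<Theta> T g a"] T(2)[of h] T(2)[of g] U e
      by (force simp: dist_commute)
  qed
qed

section \<open>Cocycle morphisms as equivariant families\<close>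

lemma subspace_closure:
  fixes S :: "'a::real_normed_vector set"
  assumes S: "subspace S"
  shows "subspace (closure S)"
proof (rule subspaceI)
  show "0 \<in> closure S" using subspace_0[OF S] closure_subset by blast
  show "x + y \<in> closure S" if xy: "x \<in> closure S" "y \<in> closure S" for x y
  proof -
    obtain f h where "\<forall>n. f n \<in> S" "f \<longlonglongrightarrow> x" "\<forall>n. h n \<in> S" "h \<longlonglongrightarrow> y"
      using xy unfolding closure_sequential by blast
    then show ?thesis unfolding closure_sequential
      by (intro exI[of _ "\<lambda>n. f n + h n"]) (auto intro: subspace_add[OF S] tendsto_add)
  qed
  show "r *\<^sub>R x \<in> closure S" if x: "x \<in> closure S" for r x
  proof -
    obtain f where "\<forall>n. f n \<in> S" "f \<longlonglongrightarrow> x" using x unfolding closure_sequential by blast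
    then show ?thesis unfolding closure_sequential
      by (intro exI[of _ "\<lambda>n. r *\<^sub>R f n"]) (auto intro: subspace_scale[OF S] tendsto_scaleR)
  qed
qed

text \<open>Elements \<open>c\<close> are approximated by sums of \<open>\<phi> a * c'\<close>, and
  \<open>\<psi> (\<phi> a * c') * b = (\<psi> \<circ> \<phi>) a * (\<psi> c' * b)\<close> is again a
  generator.\<close>

lemma nondegenerate_comp:
  assumes \<psi>: "star_hom \<psi>" "nondegenerate \<psi>" and \<phi>: "nondegenerate \<phi>"
  shows "nondegenerate (\<psi> \<circ> \<phi>)"
proof -
  let ?V = "closure (span {(\<psi> \<circ> \<phi>) a * b |a b. True})"
  have V: "subspace ?V" by (intro subspace_closure) auto
  have "\<psi> c * b \<in> ?V" for c b
  proof (rule nondegenerate_induct[OF \<phi>, where P = "\<lambda>c. \<psi> c * b \<in> ?V"])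
    have bl: "bounded_linear (\<lambda>c. \<psi> c * b)"
      by (rule bounded_linear_compose[OF bounded_linear_mult_left star_hom_bounded_linear[OF \<psi>(1)]])
    show "subspace {c. \<psi> c * b \<in> ?V}"
      using linear_subspace_vimage[OF bounded_linear.linear[OF bl] V] by (simp add: vimage_def)
    show "closed {c. \<psi> c * b \<in> ?V}"
      using continuous_closed_vimage[OF closed_closure linear_continuous_at[OF bl]] by (simp add: vimage_def)
    show "\<psi> (\<phi> a * c) * b \<in> ?V" for a c
      by (rule subsetD[OF closure_subset], rule span_base)
        (auto simp: star_hom_mult[OF \<psi>(1)] mult.assoc)
  qed
  then have "span {\<psi> c * b |c b. True} \<subseteq> ?V"
    by (intro span_minimal V) blast
  then have "closure (span {\<psi> c * b |c b. True}) \<subseteq> ?V" by (rule closure_minimal) simp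
  then show ?thesis using \<psi>(2) unfolding nondegenerate_def by blast
qed

lemma star_hom_comp: "star_hom \<psi> \<Longrightarrow> star_hom \<phi> \<Longrightarrow> star_hom (\<psi> \<circ> \<phi>)"
  by (simp add: star_hom_def)

lemma mext_comp:
  assumes \<psi>: "star_hom \<psi>" "nondegenerate \<psi>" and \<phi>: "star_hom \<phi>" "nondegenerate \<phi>"
  shows "mext (\<psi> \<circ> \<phi>) m = mext \<psi> (mext \<phi> m)"
proof -
  note c = star_hom_comp[OF \<psi>(1) \<phi>(1)] nondegenerate_comp[OF \<psi> \<phi>(2)]
  have "ract ((\<psi> \<circ> \<phi>) a) (mext (\<psi> \<circ> \<phi>) m) = ract ((\<psi> \<circ> \<phi>) a) (mext \<psi> (mext \<phi> m))" for a
    unfolding ract_mext[OF c] by (simp add: ract_mext[OF \<psi>] ract_mext[OF \<phi>])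
  then show ?thesis by (rule multiplier_eq_nondegenerateI[OF c])
qed

lemma ract_Ad_unitary: "unitary u \<Longrightarrow> ract (Ad u b) u = lact u b"
  by (simp only: Ad_def ract_star_unitary)

text \<open>Right multiplication by \<open>u\<close> turns \<open>Ad u (h a)\<close> into
  \<open>lact u (h a)\<close>, on which \<open>mext h\<close> can act from the right; by
  nondegeneracy it is enough to test on the elements \<open>f a\<close>.\<close>

lemma mext_Ad:
  assumes f: "star_hom f" "nondegenerate f" and h: "star_hom h" "nondegenerate h"
    and u: "unitary u" and Ad: "\<And>a. f a = Ad u (h a)"
  shows "mext f m * u = u * mext h m"
proof (rule multiplier_eq_nondegenerateI[OF f])
  fix a
  have "ract (f a) (mext f m * u) = ract (f (ract a m)) u" by (simp add: ract_mext[OF f])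
  also have "\<dots> = lact u (h (ract a m))" unfolding Ad ract_Ad_unitary[OF u] ..
  also have "\<dots> = ract (lact u (h a)) (mext h m)" by (simp add: lact_ract ract_mext[OF h] flip: lact_ract)
  also have "\<dots> = ract (f a) (u * mext h m)" by (simp add: Ad ract_Ad_unitary[OF u])
  finally show "ract (f a) (mext f m * u) = ract (f a) (u * mext h m)" .
qed

context
  fixes \<alpha> :: "'g::topological_group_add \<Rightarrow> 'a::cstar_algebra \<Rightarrow> 'a" and \<uu>
    and \<beta> :: "'g \<Rightarrow> 'b::cstar_algebra \<Rightarrow> 'b" and \<vv> and \<phi> u
  assumes \<alpha>: "nondegenerate_action \<alpha>" and \<beta>: "nondegenerate_action \<beta>"
    and \<alpha>\<uu>: "twisted_action (\<alpha>, \<uu>)" and \<beta>\<vv>: "twisted_action (\<beta>, \<vv>)"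
    and morph: "cocycle_morphism (\<alpha>, \<uu>) (\<beta>, \<vv>) (\<phi>, u)"
begin

lemma cm_hom: "star_hom \<phi>" "nondegenerate \<phi>"
  and cm_unitary: "unitary (u g)"
  and cm_path: "unitary_path UNIV u"
  and cm_Ad: "\<phi> (\<alpha> g a) = Ad (u g) (\<beta> g (\<phi> a))"
  and cm_cocycle: "mext \<phi> (\<uu> g h) = u g * mext (\<beta> g) (u h) * \<vv> g h * star (u (g + h))"
  using morph by (auto simp: unitary_path_def fun_eq_iff)

text \<open>The cocycle identity at \<open>(0, 0)\<close> reads
  \<open>1 = u 0 * u 0 * star (u 0)\<close>. Consequently the component of the family at
  \<open>g = 0\<close> is \<open>\<phi>\<close> itself.\<close>

lemma cm_zero: "u 0 = 1"
proof -
  have z: "\<beta> 0 = id" "\<vv> 0 0 = 1" "\<uu> 0 0 = 1" using \<alpha>\<uu> \<beta>\<vv> by auto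
  have b: "star_hom (\<beta> 0)" "nondegenerate (\<beta> 0)" by (rule action_hom[OF \<beta>])+
  have "mext (\<beta> 0) (u 0) = u 0"
    by (rule multiplier_eq_nondegenerateI[OF b]) (unfold ract_mext[OF b], simp add: z)
  then have "1 = u 0 * (u 0 * star (u 0))"
    using cm_cocycle[of 0 0] by (simp add: z mext_one[OF cm_hom] mult.assoc)
  then show ?thesis using cm_unitary[of 0] by (simp add: unitary_def)
qed

lemma cm_intertwine: "mext \<phi> (mext (\<alpha> g) m) * u g = u g * mext (\<beta> g) (mext \<phi> m)"
proof -
  note a = action_hom[OF \<alpha>, of g] and b = action_hom[OF \<beta>, of g]
  have "mext (\<phi> \<circ> \<alpha> g) m * u g = u g * mext (\<beta> g \<circ> \<phi>) m"
    by (intro mext_Ad star_hom_comp nondegenerate_comp cm_hom a b cm_unitary) (simp add: cm_Ad)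
  then show ?thesis by (simp only: mext_comp[OF cm_hom a] mext_comp[OF b cm_hom])
qed

text \<open>The substantial clause is the last one: \<open>u g\<close> has to be moved past the
  extension of \<open>\<phi>\<close> at \<open>star w\<close>, which is
  \<open>cm_intertwine\<close>.\<close>

lemma equivariant_cocycle_map: "equivariant \<alpha> \<beta> (cocycle_map (\<phi>, u)) (mext \<phi>)"
  unfolding equivariant_def
proof (intro conjI allI impI \<alpha> \<beta>)
  show "dist (cocycle_map (\<phi>, u) g a) (cocycle_map (\<phi>, u) g b) \<le> dist a b" for g a b
    by (simp add: cocycle_map_apply dist_ract_unitary[OF cm_unitary] star_hom_dist_le[OF cm_hom(1)])
  show "continuous_on UNIV (\<lambda>g. cocycle_map (\<phi>, u) g a)" for a
    unfolding cocycle_map_apply by (rule unitary_path_ract[OF cm_path])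
  show "unitary_path {0..} (\<lambda>t. mext \<phi> (w t))" if "unitary_path {0..} w" for w :: "real \<Rightarrow> 'a multiplier"
    by (rule unitary_path_mext[OF cm_hom that])
  fix w :: "'a multiplier" and g a assume w: "unitary w"
  have "u g * star (mext (\<beta> g) (mext \<phi> w)) = star (mext \<phi> (mext (\<alpha> g) w)) * u g"
    using cm_intertwine[of g "star w"]
    by (simp only: star_hom_star[OF mext_star_hom[OF cm_hom]] star_hom_star[OF mext_star_hom[OF action_hom[OF \<alpha>]]]
        star_hom_star[OF mext_star_hom[OF action_hom[OF \<beta>]]])
  then have "ract (ract b (u g)) (star (mext (\<beta> g) (mext \<phi> w))) = ract (ract b (star (mext \<phi> (mext (\<alpha> g) w)))) (u g)" for b
    by (simp only: flip: ract_times')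
  moreover have "\<phi> (ract (lact w a) (star (mext (\<alpha> g) w))) = ract (lact (mext \<phi> w) (\<phi> a)) (star (mext \<phi> (mext (\<alpha> g) w)))"
    by (simp only: lact_mext[OF cm_hom] ract_mext[OF cm_hom] flip: star_hom_star[OF mext_star_hom[OF cm_hom]])
  ultimately show "cocycle_map (\<phi>, u) g (ad_map \<alpha> w g a) = ad_map \<beta> (mext \<phi> w) g (cocycle_map (\<phi>, u) g a)"
    by (simp only: cocycle_map_apply ad_map_def lact_ract)
qed (simp_all add: mext_one[OF cm_hom] unitary_mext[OF cm_hom])

end

lemma cocycle_map_comp:
  assumes "star_hom \<psi>" "nondegenerate \<psi>"
  shows "cocycle_map (cocycle_comp (\<psi>, v) (\<phi>, u)) g a = cocycle_map (\<psi>, v) g (cocycle_map (\<phi>, u) g a)"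
  by (simp add: cocycle_map_apply ract_mext[OF assms])

section \<open>Asymptotic conjugacy in terms of the families\<close>

lemma ract_minus: "ract b (m - n) = ract b m - ract b n"
  unfolding minus_multiplier_def ract_add' ract_uminus' by simp

text \<open>Insert \<open>star w * w\<close> between \<open>b\<close> and \<open>u g\<close>. This
  separates the two conditions of asymptotic conjugacy: one factor concerns the homomorphism, the
  other the cocycle.\<close>

lemma ad_map_ract:
  assumes "unitary w"
  shows "ad_map \<beta> w g (ract b (u g)) = ract (Ad w b) (w * u g * star (mext (\<beta> g) w))"
  unfolding ad_map_def Ad_def ract_times' ract_star_unitary[OF assms] lact_ract ..

context
  fixes \<beta> :: "'g::topological_group_add \<Rightarrow> 'b::cstar_algebra \<Rightarrow> 'b"
    and \<phi> \<psi> :: "'a::cstar_algebra \<Rightarrow> 'b" and u v :: "'g \<Rightarrow> 'b multiplier"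
  assumes \<beta>: "nondegenerate_action \<beta>" and u: "\<And>g. unitary (u g)" and v: "\<And>g. unitary (v g)"
begin

lemma unitary_conjugate_cocycle: "unitary w \<Longrightarrow> unitary (w * u g * star (mext (\<beta> g) w))"
  by (intro unitary_mult unitary_star unitary_mext action_hom[OF \<beta>] u)

text \<open>Makes the supremum in asymptotic conjugacy one over a bounded set, so that it bounds
  each of its members.\<close>

lemma norm_ract_unitary_diff_le:
  assumes "unitary w"
  shows "norm (ract b (v g - w * u g * star (mext (\<beta> g) w))) \<le> 2 * norm b"
  using norm_triangle_ineq4[of "ract b (v g)" "ract b (w * u g * star (mext (\<beta> g) w))"]
  by (simp only: ract_minus norm_ract_unitary[OF v] norm_ract_unitary[OF unitary_conjugate_cocycle[OF assms]])

text \<open>By \<open>ad_map_ract\<close> the error is at most that of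
  \<open>Ad (w t) (\<phi> a)\<close> against \<open>\<psi> a\<close>, the same for all
  \<open>g\<close> by isometry, plus the cocycle condition tested at
  \<open>b = \<psi> a\<close>.\<close>

lemma conjugate_imp_ucc_lim:
  assumes "asymptotic_unitary_conjugate (\<beta>, \<vv>) (\<psi>, v) (\<phi>, u)"
  obtains w where "unitary_path {0..} w"
    "ucc_lim (\<lambda>t g a. ad_map \<beta> (w t) g (cocycle_map (\<phi>, u) g a)) (cocycle_map (\<psi>, v))"
proof -
  obtain w :: "real \<Rightarrow> 'b multiplier" where w: "\<And>t. t \<ge> 0 \<Longrightarrow> unitary (w t)" "strictly_continuous_on {0..} w"
    "\<And>a. ((\<lambda>t. Ad (w t) (\<phi> a)) \<longlongrightarrow> \<psi> a) at_top"
    "\<And>b K. compact K \<Longrightarrow> K \<noteq> {} \<Longrightarrow>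
       ((\<lambda>t. SUP g\<in>K. norm (ract b (v g - w t * u g * star (mext (\<beta> g) (w t))))) \<longlongrightarrow> 0) at_top"
    using assms by (simp, elim exE conjE) (rule that, blast, assumption, blast, blast)
  have "ucc_lim (\<lambda>t g a. ad_map \<beta> (w t) g (cocycle_map (\<phi>, u) g a)) (cocycle_map (\<psi>, v))"
    unfolding ucc_lim_def
  proof (intro allI impI)
    fix a and K :: "'g set" and e :: real assume K: "compact K" and e: "0 < e"
    show "\<exists>T\<ge>0. \<forall>t\<ge>T. \<forall>g\<in>K. dist (ad_map \<beta> (w t) g (cocycle_map (\<phi>, u) g a)) (cocycle_map (\<psi>, v) g a) \<le> e"
    proof (cases "K = {}")
      case False
      have "\<forall>\<^sub>F t in at_top. dist (Ad (w t) (\<phi> a)) (\<psi> a) < e / 2"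
        using w(3)[of a] e by (intro tendstoD) auto
      moreover have "\<forall>\<^sub>F t in at_top. dist (SUP g\<in>K. norm (ract (\<psi> a) (v g - w t * u g * star (mext (\<beta> g) (w t))))) 0 < e / 2"
        using w(4)[OF K False, of "\<psi> a"] e by (intro tendstoD) auto
      ultimately have "\<forall>\<^sub>F t in at_top. dist (Ad (w t) (\<phi> a)) (\<psi> a) < e / 2 \<and>
          dist (SUP g\<in>K. norm (ract (\<psi> a) (v g - w t * u g * star (mext (\<beta> g) (w t))))) 0 < e / 2"
        by (rule eventually_conj)
      then obtain T where T: "\<And>t. t \<ge> T \<Longrightarrow> dist (Ad (w t) (\<phi> a)) (\<psi> a) < e / 2"
        "\<And>t. t \<ge> T \<Longrightarrow> dist (SUP g\<in>K. norm (ract (\<psi> a) (v g - w t * u g * star (mext (\<beta> g) (w t))))) 0 < e / 2"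
        unfolding eventually_at_top_linorder by blast
      have "dist (ad_map \<beta> (w t) g (cocycle_map (\<phi>, u) g a)) (cocycle_map (\<psi>, v) g a) \<le> e"
        if t: "max T 0 \<le> t" and g: "g \<in> K" for t g
      proof -
        have wt: "unitary (w t)" using w(1) t by simp
        let ?x = "w t * u g * star (mext (\<beta> g) (w t))"
        have "norm (ract (\<psi> a) (v g - ?x)) \<le> (SUP g\<in>K. norm (ract (\<psi> a) (v g - w t * u g * star (mext (\<beta> g) (w t)))))"
          using g norm_ract_unitary_diff_le[OF wt] by (intro cSUP_upper bdd_aboveI2) auto
        also have "\<dots> \<le> e / 2" using T(2)[of t] t by (simp add: dist_real_def)
        finally have "dist (ract (\<psi> a) ?x) (ract (\<psi> a) (v g)) \<le> e / 2"
          by (simp only: ract_minus dist_norm norm_minus_commute)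
        moreover have "dist (ract (Ad (w t) (\<phi> a)) ?x) (ract (\<psi> a) ?x) \<le> e / 2"
          using T(1)[of t] t by (simp only: dist_ract_unitary[OF unitary_conjugate_cocycle[OF wt]]) simp
        ultimately show ?thesis
          using dist_triangle[of "ract (Ad (w t) (\<phi> a)) ?x" "ract (\<psi> a) (v g)" "ract (\<psi> a) ?x"]
          unfolding cocycle_map_apply ad_map_ract[OF wt] by linarith
      qed
      then show ?thesis by (intro exI[of _ "max T 0"]) auto
    qed (auto intro: exI[of _ 0])
  qed
  then show ?thesis using that[of w] w(1,2) by (simp add: unitary_path_def)
qed

text \<open>
  Since \<open>\<psi>\<close> is non-degenerate, it is enough to test the cocycle condition on \<open>b \<psi>(a)\<close>.
\<close>

lemma ucc_lim_imp_conjugate: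
  assumes \<psi>: "star_hom \<psi>" "nondegenerate \<psi>" and zero: "\<beta> 0 = id" "u 0 = 1" "v 0 = 1"
    and w: "unitary_path {0..} w"
    and lim: "ucc_lim (\<lambda>t g a. ad_map \<beta> (w t) g (cocycle_map (\<phi>, u) g a)) (cocycle_map (\<psi>, v))"
  shows "asymptotic_unitary_conjugate (\<beta>, \<vv>) (\<psi>, v) (\<phi>, u)"
proof -
  define x where "x t g = w t * u g * star (mext (\<beta> g) (w t))" for t g
  note wu = unitary_path_unitary[OF w]
  have xu: "unitary (x t g)" if "0 \<le> t" for t g
    unfolding x_def using unitary_conjugate_cocycle wu that by simp
  have b0: "star_hom (\<beta> 0)" "nondegenerate (\<beta> 0)" by (rule action_hom[OF \<beta>])+
  have "mext (\<beta> 0) m = m" for m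
    by (rule multiplier_eq_nondegenerateI[OF b0]) (unfold ract_mext[OF b0], simp add: zero)
  \<comment> \<open>At \<open>g = 0\<close> the families are the homomorphisms themselves, so the
    assumed convergence contains that of \<open>Ad (w t) (\<phi> a)\<close>.\<close>
  then have Ad: "Ad (w t) (\<phi> a) = ad_map \<beta> (w t) 0 (cocycle_map (\<phi>, u) 0 a)" for t a
    by (simp add: ad_map_def Ad_def cocycle_map_apply zero del: ract_star')
  have "((\<lambda>t. Ad (w t) (\<phi> a)) \<longlongrightarrow> \<psi> a) at_top" for a
    using ucc_lim_pointwise[OF lim, of 0 a] unfolding Ad by (simp add: cocycle_map_apply zero)
  moreover
  have small: "\<exists>T\<ge>0. \<forall>t\<ge>T. \<forall>g\<in>K. norm (ract b (v g - x t g)) \<le> e" if K: "compact K" and e: "0 < e" for b K e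
  proof -
    define D where "D t g b = ract b (v g - x t g)" for t g b
    have Dlin: "linear (D t g)" for t g
      unfolding D_def by (rule bounded_linear.linear[OF bounded_linear_ract])
    \<comment> \<open>This bound, uniform in \<open>t\<close> and \<open>g\<close>, makes
      \<open>P\<close> a closed condition.\<close>
    have Dn: "norm (D t g b) \<le> 2 * norm b" if "0 \<le> t" for t g b
      unfolding D_def x_def using norm_ract_unitary_diff_le wu that by simp
    define P where "P b \<longleftrightarrow> (\<forall>e>0. \<exists>T\<ge>0. \<forall>t\<ge>T. \<forall>g\<in>K. norm (D t g b) \<le> e)" for b
    have "P b"
    proof (rule nondegenerate_induct_right[OF \<psi>, where P = P])
      show "subspace {b. P b}"
      proof (rule subspaceI; clarsimp)
        show "P 0" by (auto simp: P_def linear_0[OF Dlin] intro: exI[of _ 0])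
        fix b assume b: "P b"
        show "P (b + c)" if c: "P c" for c
          unfolding P_def
        proof (intro allI impI)
          fix e :: real assume "0 < e"
          then obtain T T' where "T \<ge> 0" "\<forall>t\<ge>T. \<forall>g\<in>K. norm (D t g b) \<le> e / 2"
            "T' \<ge> 0" "\<forall>t\<ge>T'. \<forall>g\<in>K. norm (D t g c) \<le> e / 2"
            using b c unfolding P_def by (metis half_gt_zero)
          then have "norm (D t g b) \<le> e / 2" "norm (D t g c) \<le> e / 2" if "t \<ge> max T T'" "g \<in> K" for t g
            using that by simp_all
          then have "norm (D t g (b + c)) \<le> e" if "t \<ge> max T T'" "g \<in> K" for t g
            using norm_triangle_ineq[of "D t g b" "D t g c"] that unfolding linear_add[OF Dlin] by fastforce
          then show "\<exists>T\<ge>0. \<forall>t\<ge>T. \<forall>g\<in>K. norm (D t g (b + c)) \<le> e"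
            using \<open>T \<ge> 0\<close> by (intro exI[of _ "max T T'"]) auto
        qed
        show "P (r *\<^sub>R b)" for r
          unfolding P_def
        proof (intro allI impI)
          fix e :: real assume e: "0 < e"
          then obtain T where T: "T \<ge> 0" "\<forall>t\<ge>T. \<forall>g\<in>K. norm (D t g b) \<le> e / (\<bar>r\<bar> + 1)"
            using b unfolding P_def by (metis abs_ge_zero add_nonneg_pos zero_less_divide_iff zero_less_one)
          have "norm (D t g (r *\<^sub>R b)) \<le> e" if "t \<ge> T" "g \<in> K" for t g
          proof -
            have "\<bar>r\<bar> * norm (D t g b) \<le> (\<bar>r\<bar> + 1) * (e / (\<bar>r\<bar> + 1))"
              using T(2) that e by (intro mult_mono) auto
            then show ?thesis by (simp add: linear_scale[OF Dlin])
          qed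
          then show "\<exists>T\<ge>0. \<forall>t\<ge>T. \<forall>g\<in>K. norm (D t g (r *\<^sub>R b)) \<le> e" using T(1) by blast
        qed
      qed
      have "P b" if b: "b \<in> closure {b. P b}" for b
        unfolding P_def
      proof (intro allI impI)
        fix e :: real assume e: "0 < e"
        then obtain c where c: "P c" "dist c b < e / 4"
          using b unfolding closure_approachable by (metis mem_Collect_eq zero_less_divide_iff zero_less_numeral)
        obtain T where T: "T \<ge> 0" "\<forall>t\<ge>T. \<forall>g\<in>K. norm (D t g c) \<le> e / 2"
          using c(1) e unfolding P_def by (metis half_gt_zero)
        have "norm (D t g b) \<le> e" if "t \<ge> T" "g \<in> K" for t g
        proof -
          have "D t g b = D t g c + D t g (b - c)" by (simp add: linear_diff[OF Dlin])
          then have "norm (D t g b) \<le> norm (D t g c) + norm (D t g (b - c))" by (metis norm_triangle_ineq)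
          moreover have "norm (D t g (b - c)) \<le> e / 2"
            using Dn[of t g "b - c"] c(2) that T(1) by (simp add: dist_norm norm_minus_commute)
          ultimately show ?thesis using T(2) that by force
        qed
        then show "\<exists>T\<ge>0. \<forall>t\<ge>T. \<forall>g\<in>K. norm (D t g b) \<le> e" using T(1) by blast
      qed
      then have "closure {b. P b} \<subseteq> {b. P b}" by blast
      then show "closed {b. P b}" by (rule closure_subset_eq[THEN iffD1])
      show "P (b * \<psi> a)" for a b
        unfolding P_def
      proof (intro allI impI)
        fix e :: real assume e: "0 < e"
        \<comment> \<open>Two errors of size \<open>\<delta>\<close> get multiplied by
          \<open>norm b\<close>; adding 1 avoids a zero denominator.\<close>
        define \<delta> where "\<delta> = e / (2 * (norm b + 1))"
        have nb: "0 < 2 * (norm b + 1)" by (simp add: add_nonneg_pos)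
        have \<delta>: "\<delta> > 0" unfolding \<delta>_def using e nb by (rule divide_pos_pos)
        \<comment> \<open>The estimate at \<open>g\<close> compares values at
          \<open>Ad (w t) (\<phi> a)\<close>; that this element is close to \<open>\<psi> a\<close>
          is the estimate at \<open>0\<close>.\<close>
        have "compact (insert 0 K)" using K by simp
        then obtain T where T: "T \<ge> 0" "\<And>t g. t \<ge> T \<Longrightarrow> g \<in> insert 0 K \<Longrightarrow>
            dist (ad_map \<beta> (w t) g (cocycle_map (\<phi>, u) g a)) (cocycle_map (\<psi>, v) g a) \<le> \<delta>"
          using ucc_limD[OF lim _ \<delta>, of "insert 0 K" a] by blast
        have "norm (D t g (b * \<psi> a)) \<le> e" if t: "t \<ge> T" and g: "g \<in> K" for t g
        proof -
          have t0: "0 \<le> t" using t T(1) by simp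
          have "dist (ract (\<psi> a) (x t g)) (ract (Ad (w t) (\<phi> a)) (x t g)) \<le> \<delta>"
            using T(2)[OF t, of 0]
            by (simp add: dist_ract_unitary[OF xu[OF t0]] Ad cocycle_map_apply zero dist_commute)
          moreover have "dist (ract (Ad (w t) (\<phi> a)) (x t g)) (ract (\<psi> a) (v g)) \<le> \<delta>"
          proof -
            have "unitary (w t)" using wu[of t] t0 by simp
            from ad_map_ract[OF this, of \<beta> g "\<phi> a" u] show ?thesis
              using T(2)[OF t, of g] g by (simp only: cocycle_map_apply x_def insert_iff simp_thms)
          qed
          ultimately have "dist (ract (\<psi> a) (v g)) (ract (\<psi> a) (x t g)) \<le> 2 * \<delta>"
            using dist_triangle[of "ract (\<psi> a) (x t g)" "ract (\<psi> a) (v g)" "ract (Ad (w t) (\<phi> a)) (x t g)"]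
            by (simp add: dist_commute)
          then have "norm (ract (\<psi> a) (v g) - ract (\<psi> a) (x t g)) \<le> 2 * \<delta>" by (simp only: dist_norm)
          then have "norm (b * (ract (\<psi> a) (v g) - ract (\<psi> a) (x t g))) \<le> norm b * (2 * \<delta>)"
            by (rule order_trans[OF norm_mult_ineq mult_left_mono]) simp
          moreover have "D t g (b * \<psi> a) = b * (ract (\<psi> a) (v g) - ract (\<psi> a) (x t g))"
            by (simp add: D_def ract_mult ract_minus right_diff_distrib)
          ultimately have "norm (D t g (b * \<psi> a)) \<le> norm b * (2 * \<delta>)" by (simp only:)
          also have "\<dots> \<le> (norm b + 1) * (2 * \<delta>)" using \<delta> by (intro mult_right_mono) auto
          also have "\<dots> = e" using nb unfolding \<delta>_def by (simp add: field_simps)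
          finally show ?thesis .
        qed
        then show "\<exists>T\<ge>0. \<forall>t\<ge>T. \<forall>g\<in>K. norm (D t g (b * \<psi> a)) \<le> e" using T(1) by blast
      qed
    qed
    then show ?thesis using e unfolding P_def D_def by blast
  qed
  have "((\<lambda>t. SUP g\<in>K. norm (ract b (v g - x t g))) \<longlongrightarrow> 0) at_top" if K: "compact K" "K \<noteq> {}" for b K
  proof (rule tendstoI)
    fix e :: real assume e: "0 < e"
    obtain T where T: "T \<ge> 0" "\<And>t g. t \<ge> T \<Longrightarrow> g \<in> K \<Longrightarrow> norm (ract b (v g - x t g)) \<le> e / 2"
      using small[OF K(1), of "e / 2" b] e by auto
    have "dist (SUP g\<in>K. norm (ract b (v g - x t g))) 0 < e" if t: "t \<ge> T" for t
    proof -
      have "(SUP g\<in>K. norm (ract b (v g - x t g))) \<le> e / 2"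
        using T(2)[OF t] K(2) by (intro cSUP_least)
      moreover obtain g where g: "g \<in> K" using K(2) by blast
      have "norm (ract b (v g - x t g)) \<le> (SUP g\<in>K. norm (ract b (v g - x t g)))"
        using T(2)[OF t] by (intro cSUP_upper g bdd_aboveI2[where M = "e / 2"]) auto
      then have "0 \<le> (SUP g\<in>K. norm (ract b (v g - x t g)))" using norm_ge_zero order_trans by blast
      ultimately show ?thesis using e by (simp add: dist_real_def)
    qed
    then show "\<forall>\<^sub>F t in at_top. dist (SUP g\<in>K. norm (ract b (v g - x t g))) 0 < e"
      by (intro eventually_at_top_linorderI[of T])
  qed
  ultimately show ?thesis using w by (auto simp: unitary_path_def x_def intro!: exI[of _ w])
qed

end

section \<open>Recovering a cocycle conjugacy from the limit\<close>

text \<open>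
  Multiplicativity on the Fell bundle \<open>A \<times> G\<close> with product
  \<open>(a, g) (b, h) = (a \<alpha>\<^sub>g(b) \<uu>\<^sub>g\<^sub>,\<^sub>h, gh)\<close>; unlike the cocycle identity, this does not mention multipliers
  that vary with the map, and therefore passes to pointwise limits.
\<close>

definition fell_map ::
    "('g::topological_group_add, 'a::cstar_algebra) twisted_pair \<Rightarrow>
     ('g, 'b::cstar_algebra) twisted_pair \<Rightarrow> ('g \<Rightarrow> 'a \<Rightarrow> 'b) \<Rightarrow> bool" where
  "fell_map = (\<lambda>(\<alpha>, \<uu>) (\<beta>, \<vv>) \<Phi>.
     (\<forall>g a b. \<Phi> g (a + b) = \<Phi> g a + \<Phi> g b) \<and> (\<forall>g c a. \<Phi> g (c *\<^sub>C a) = c *\<^sub>C \<Phi> g a) \<and>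
     (\<forall>g h a b. \<Phi> (g + h) (ract (a * \<alpha> g b) (\<uu> g h)) = ract (\<Phi> g a * \<beta> g (\<Phi> h b)) (\<vv> g h)) \<and>
     (\<forall>g a b. \<Phi> g a * star (\<Phi> g b) = \<Phi> 0 (a * star b)))"

lemma
  assumes "twisted_action (\<beta>, \<vv>)"
  shows twisted_unitary: "unitary (\<vv> g h)"
    and twisted_zero: "\<beta> 0 = id" "\<vv> g 0 = 1" "\<vv> 0 g = 1"
    and twisted_comp: "\<beta> g (\<beta> h b) = Ad (\<vv> g h) (\<beta> (g + h) b)"
  using assms by (auto simp: fun_eq_iff)

lemma multiplier_eq_ractI:
  assumes "\<And>a. ract a m = ract a n"
  shows "m = n"
proof (rule multiplier_eqI[OF _ assms])
  show "lact m a = lact n a" for a by (rule left_cancel) (simp add: assms flip: ract_mult_lact)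
qed

lemma mext_twisted_zero:
  assumes "nondegenerate_action \<beta>" "twisted_action (\<beta>, \<vv>)"
  shows "mext (\<beta> 0) m = m"
proof (rule multiplier_eq_ractI)
  show "ract b (mext (\<beta> 0) m) = ract b m" for b
    using ract_mext[OF action_hom[OF assms(1)], of 0 b m] by (simp add: twisted_zero[OF assms(2)])
qed

lemma ract_mult_star_ract:
  assumes "unitary u"
  shows "ract a u * star (ract b u) = a * star b"
  unfolding star_ract ract_mult_lact lact_unitary_star[OF assms] ..

text \<open>Multiply the cocycle identity on the right by \<open>u (g + h)\<close>; covariance moves
  \<open>u g\<close> across \<open>\<beta> g (\<phi> b)\<close>.\<close>

lemma cocycle_map_fell_map:
  assumes \<alpha>: "nondegenerate_action \<alpha>" and \<beta>: "nondegenerate_action \<beta>"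
    and \<alpha>\<uu>: "twisted_action (\<alpha>, \<uu>)" and \<beta>\<vv>: "twisted_action (\<beta>, \<vv>)"
    and morph: "cocycle_morphism (\<alpha>, \<uu>) (\<beta>, \<vv>) (\<phi>, u)"
  shows "fell_map (\<alpha>, \<uu>) (\<beta>, \<vv>) (cocycle_map (\<phi>, u))"
proof -
  note hom = cm_hom[OF \<alpha> \<beta> \<alpha>\<uu> \<beta>\<vv> morph] and un = cm_unitary[OF \<alpha> \<beta> \<alpha>\<uu> \<beta>\<vv> morph]
    and cov = cm_Ad[OF \<alpha> \<beta> \<alpha>\<uu> \<beta>\<vv> morph] and coc = cm_cocycle[OF \<alpha> \<beta> \<alpha>\<uu> \<beta>\<vv> morph]
    and zero = cm_zero[OF \<alpha> \<beta> \<alpha>\<uu> \<beta>\<vv> morph]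
  have mul: "ract (\<phi> (ract (a * \<alpha> g b) (\<uu> g h))) (u (g + h)) =
      ract (ract (\<phi> a) (u g) * \<beta> g (ract (\<phi> b) (u h))) (\<vv> g h)" for g h a b
  proof -
    have "mext \<phi> (\<uu> g h) * u (g + h) = u g * mext (\<beta> g) (u h) * \<vv> g h"
      using un[of "g + h"] by (simp add: coc mult.assoc unitary_def)
    then have "ract (\<phi> (ract (a * \<alpha> g b) (\<uu> g h))) (u (g + h)) =
        ract (\<phi> (a * \<alpha> g b)) (u g * mext (\<beta> g) (u h) * \<vv> g h)"
      by (simp flip: ract_mext[OF hom] ract_times')
    also have "\<dots> = \<phi> a * ract (ract (ract (\<phi> (\<alpha> g b)) (u g)) (mext (\<beta> g) (u h))) (\<vv> g h)"
      by (simp add: star_hom_mult[OF hom(1)] ract_mult)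
    also have "ract (\<phi> (\<alpha> g b)) (u g) = lact (u g) (\<beta> g (\<phi> b))"
      by (simp only: cov ract_Ad_unitary[OF un])
    also have "ract (lact (u g) (\<beta> g (\<phi> b))) (mext (\<beta> g) (u h)) = lact (u g) (\<beta> g (ract (\<phi> b) (u h)))"
      by (simp only: lact_ract[symmetric] ract_mext[OF action_hom[OF \<beta>]])
    finally show ?thesis by (simp only: ract_mult ract_mult_lact)
  qed
  show ?thesis
    unfolding fell_map_def
    by (simp add: cocycle_map_apply mul zero ract_mult_star_ract[OF un] star_hom_add[OF hom(1)]
        star_hom_scaleC[OF hom(1)] star_hom_mult[OF hom(1)] star_hom_star[OF hom(1)] ract_add ract_scaleC)
qed

text \<open>In a product the inner factors \<open>star (m g x)\<close> and \<open>m g x\<close>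
  cancel. The remaining \<open>m g (m h (star x))\<close> becomes \<open>m (g + h) (star x)\<close>
  when it passes the twist, by \<open>tw\<close>.\<close>

lemma ad_map_fell_map:
  assumes \<beta>: "nondegenerate_action \<beta>" and \<beta>\<vv>: "twisted_action (\<beta>, \<vv>)"
    and \<Phi>: "fell_map (\<alpha>, \<uu>) (\<beta>, \<vv>) \<Phi>" and x: "unitary x"
  shows "fell_map (\<alpha>, \<uu>) (\<beta>, \<vv>) (\<lambda>g a. ad_map \<beta> x g (\<Phi> g a))"
proof -
  define m where "m g = mext (\<beta> g)" for g
  have mu: "unitary (m g w)" if "unitary w" for g w
    unfolding m_def by (intro unitary_mext action_hom[OF \<beta>] that)
  have ms: "star (m g w) = m g (star w)" for g w
    unfolding m_def by (simp only: star_hom_star[OF mext_star_hom[OF action_hom[OF \<beta>]]])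
  have ad: "ad_map \<beta> x g b = ract (lact x b) (m g (star x))" for g b
    by (simp only: ad_map_def flip: m_def ms)
  have ml: "\<beta> g (lact w b) = lact (m g w) (\<beta> g b)" and mr: "\<beta> g (ract b w) = ract (\<beta> g b) (m g w)" for g b w
    unfolding m_def by (simp_all only: lact_mext[OF action_hom[OF \<beta>]] ract_mext[OF action_hom[OF \<beta>]])
  have tw: "m g (m h w) * \<vv> g h = \<vv> g h * m (g + h) w" for g h w
  proof -
    note h = action_hom[OF \<beta>]
    have "mext (\<beta> g \<circ> \<beta> h) w * \<vv> g h = \<vv> g h * mext (\<beta> (g + h)) w"
      by (intro mext_Ad star_hom_comp nondegenerate_comp h twisted_unitary[OF \<beta>\<vv>])
        (simp add: twisted_comp[OF \<beta>\<vv>])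
    then show ?thesis unfolding m_def by (simp only: mext_comp[OF h h])
  qed
  have mul: "ad_map \<beta> x (g + h) (ract (a * \<beta> g b) (\<vv> g h)) =
      ract (ad_map \<beta> x g a * \<beta> g (ad_map \<beta> x h b)) (\<vv> g h)" for g h a b
  proof -
    have "ad_map \<beta> x g a * \<beta> g (ad_map \<beta> x h b) =
        lact x a * lact (m g (star x)) (lact (m g x) (ract (\<beta> g b) (m g (m h (star x)))))"
      by (simp only: ad mr ml ract_mult_lact lact_ract)
    also have "\<dots> = ract (lact x (a * \<beta> g b)) (m g (m h (star x)))"
      using lact_star_unitary[OF mu[OF x]] by (simp only: flip: ms) (simp only: ract_mult lact_mult)
    finally have "ract (ad_map \<beta> x g a * \<beta> g (ad_map \<beta> x h b)) (\<vv> g h) =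
        ract (lact x (a * \<beta> g b)) (m g (m h (star x)) * \<vv> g h)" by simp
    then show ?thesis by (simp only: tw ad lact_ract ract_times')
  qed
  have st: "ad_map \<beta> x g a * star (ad_map \<beta> x g b) = ad_map \<beta> x 0 (a * star b)" for g a b
  proof -
    have "ad_map \<beta> x g a * star (ad_map \<beta> x g b) = lact x a * star (lact x b)"
      unfolding ad by (rule ract_mult_star_ract[OF mu[OF unitary_star[OF x]]])
    also have "\<dots> = ad_map \<beta> x 0 (a * star b)"
      unfolding ad m_def mext_twisted_zero[OF \<beta> \<beta>\<vv>] lact_mult ract_mult star_lact ..
    finally show ?thesis .
  qed
  show ?thesis
    using \<Phi> unfolding fell_map_def
    by (simp add: mul st) (simp add: ad_map_def lact_add ract_add lact_scaleC ract_scaleC del: ract_star')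
qed

lemma fell_map_limit:
  assumes \<beta>: "nondegenerate_action \<beta>"
    and \<Phi>: "\<And>n. fell_map (\<alpha>, \<uu>) (\<beta>, \<vv>) (\<Phi> n)" and lim: "\<And>g a. (\<lambda>n. \<Phi> n g a) \<longlonglongrightarrow> \<Phi>\<^sub>0 g a"
  shows "fell_map (\<alpha>, \<uu>) (\<beta>, \<vv>) \<Phi>\<^sub>0"
proof -
  note bl = bounded_linear.tendsto[OF bounded_linear_scaleC] bounded_linear.tendsto[OF bounded_linear_ract]
    bounded_linear.tendsto[OF star_hom_bounded_linear[OF nondegenerate_action_star_hom[OF \<beta>]]]
  have "\<Phi>\<^sub>0 g (a + b) = \<Phi>\<^sub>0 g a + \<Phi>\<^sub>0 g b" for g a b
    by (rule LIMSEQ_unique[OF lim]) (use \<Phi> in \<open>simp add: fell_map_def tendsto_add lim\<close>)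
  moreover have "\<Phi>\<^sub>0 g (c *\<^sub>C a) = c *\<^sub>C \<Phi>\<^sub>0 g a" for g c a
    by (rule LIMSEQ_unique[OF lim]) (use \<Phi> in \<open>simp add: fell_map_def bl lim\<close>)
  moreover have "\<Phi>\<^sub>0 (g + h) (ract (a * \<alpha> g b) (\<uu> g h)) = ract (\<Phi>\<^sub>0 g a * \<beta> g (\<Phi>\<^sub>0 h b)) (\<vv> g h)" for g h a b
    by (rule LIMSEQ_unique[OF lim]) (use \<Phi> in \<open>simp add: fell_map_def bl lim tendsto_mult\<close>)
  moreover have "\<Phi>\<^sub>0 g a * star (\<Phi>\<^sub>0 g b) = \<Phi>\<^sub>0 0 (a * star b)" for g a b
    by (rule LIMSEQ_unique[OF _ lim, symmetric, THEN sym])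
      (use tendsto_mult[OF lim[of g a] tendsto_star[OF lim[of g b]]] \<Phi> in \<open>simp add: fell_map_def\<close>)
  ultimately show ?thesis by (simp add: fell_map_def)
qed

text \<open>The homomorphism is the component at \<open>0\<close>. If \<open>u g\<close> exists,
  then \<open>b u g = \<Phi> g (inv \<phi> b)\<close> and, by covariance, \<open>u g \<beta> g
  (\<phi> a) = \<phi> (\<alpha> g a) u g = \<Phi> g (\<alpha> g a)\<close>; these formulas are taken
  as a double centralizer.\<close>

lemma fell_map_cocycle_conjugacy:
  fixes \<alpha> :: "'g::topological_group_add \<Rightarrow> 'a::cstar_algebra \<Rightarrow> 'a" and \<beta> :: "'g \<Rightarrow> 'b::cstar_algebra \<Rightarrow> 'b"
  assumes \<alpha>: "nondegenerate_action \<alpha>" and \<beta>: "nondegenerate_action \<beta>"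
    and \<alpha>\<uu>: "twisted_action (\<alpha>, \<uu>)" and \<beta>\<vv>: "twisted_action (\<beta>, \<vv>)"
    and \<Phi>: "fell_map (\<alpha>, \<uu>) (\<beta>, \<vv>) \<Phi>" and bij: "\<And>g. bij (\<Phi> g)"
    and ne: "\<And>g a b. dist (\<Phi> g a) (\<Phi> g b) \<le> dist a b" and cont: "\<And>a. continuous_on UNIV (\<lambda>g. \<Phi> g a)"
  obtains \<phi> u where "cocycle_conjugacy (\<alpha>, \<uu>) (\<beta>, \<vv>) (\<phi>, u)" "cocycle_map (\<phi>, u) = \<Phi>"
proof -
  define \<phi> where "\<phi> = \<Phi> 0"
  have add: "\<Phi> g (a + b) = \<Phi> g a + \<Phi> g b" and scale: "\<Phi> g (c *\<^sub>C a) = c *\<^sub>C \<Phi> g a"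
    and mul: "\<Phi> (g + h) (ract (a * \<alpha> g b) (\<uu> g h)) = ract (\<Phi> g a * \<beta> g (\<Phi> h b)) (\<vv> g h)"
    and st: "\<Phi> g a * star (\<Phi> g b) = \<phi> (a * star b)" for g h a b c
    using \<Phi> by (auto simp: fell_map_def \<phi>_def)
  \<comment> \<open>Setting one group element to \<open>0\<close> in the product rule gives the two
    module laws behind \<open>L\<close> and \<open>R\<close>.\<close>
  have mul_right: "\<Phi> g (a * \<alpha> g b) = \<Phi> g a * \<beta> g (\<phi> b)" for g a b
    using mul[of g 0 a b] by (simp add: \<phi>_def twisted_zero[OF \<alpha>\<uu>] twisted_zero[OF \<beta>\<vv>])
  have mul_left: "\<Phi> g (a * b) = \<phi> a * \<Phi> g b" for g a b
    using mul[of 0 g a b] by (simp add: \<phi>_def twisted_zero[OF \<alpha>\<uu>] twisted_zero[OF \<beta>\<vv>])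
  have \<phi>b: "bij \<phi>" unfolding \<phi>_def by (rule bij)
  have \<phi>s: "\<phi> (inv \<phi> b) = b" "inv \<phi> (\<phi> a) = a" for a b
    using \<phi>b by (simp_all add: bij_is_surj surj_f_inv_f bij_is_inj)
  have \<phi>mult: "\<phi> (a * b) = \<phi> a * \<phi> b" for a b unfolding \<phi>_def using mul_left[of 0] by (simp add: \<phi>_def)
  have "\<phi> (star a) = star (\<phi> a)" for a
  proof (rule left_cancel)
    fix b
    have "\<phi> (inv \<phi> b) * \<phi> (star a) = \<phi> (inv \<phi> b) * star (\<phi> a)"
      using st[of 0 "inv \<phi> b" a] by (simp add: \<phi>mult flip: \<phi>_def)
    then show "b * \<phi> (star a) = b * star (\<phi> a)" by (simp add: \<phi>s)
  qed
  then have \<phi>: "star_hom \<phi>" by (simp add: star_hom_def \<phi>_def add scale flip: \<phi>mult[unfolded \<phi>_def])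
  have \<phi>n: "nondegenerate \<phi>"
    by (rule nondegenerate_surj[OF nondegenerate_action_nondegenerate[OF \<beta>] bij_is_surj[OF \<phi>b]])
  have \<Phi>c: "bounded_linear (\<Phi> g)" for g
  proof -
    have "\<Phi> g 0 = 0" using add[of g 0 0] by simp
    then have "norm (\<Phi> g a) \<le> norm a" for a using ne[of g a 0] by simp
    then show ?thesis
      by (auto intro!: bounded_linear_intro[where K = 1] simp: add scale scaleR_scaleC)
  qed
  have i\<phi>: "star_hom (inv \<phi>)" by (rule star_hom_inv[OF \<phi> \<phi>b])
  have i\<beta>: "star_hom (inv (\<beta> g))" for g
    by (intro star_hom_inv nondegenerate_action_star_hom[OF \<beta>] nondegenerate_action_bij[OF \<beta>])
  have \<beta>s: "\<beta> g (inv (\<beta> g) b) = b" "inv (\<beta> g) (\<beta> g b) = b" for g b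
    using nondegenerate_action_bij[OF \<beta>, of g] by (simp_all add: bij_is_surj surj_f_inv_f bij_is_inj)
  define L where "L g b = \<Phi> g (\<alpha> g (inv \<phi> (inv (\<beta> g) b)))" for g b
  define R where "R g b = \<Phi> g (inv \<phi> b)" for g b
  have Lc: "bounded_clinear (L g)" and Rc: "bounded_clinear (R g)" for g
  proof -
    have c: "bounded_clinear (\<lambda>b. \<Phi> g (s b))" if s: "star_hom s" for s :: "'b \<Rightarrow> 'a"
      by (simp add: bounded_clinear_def bounded_linear_compose[OF \<Phi>c star_hom_bounded_linear[OF s]]
          star_hom_scaleC[OF s] scale)
    have "star_hom (\<lambda>b. \<alpha> g (inv \<phi> (inv (\<beta> g) b)))"
      using star_hom_comp[OF nondegenerate_action_star_hom[OF \<alpha>] star_hom_comp[OF i\<phi> i\<beta>]] by (simp add: comp_def)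
    then show "bounded_clinear (L g)" "bounded_clinear (R g)"
      unfolding L_def R_def using c i\<phi> by blast+
  qed
  have dc: "double_centralizer (L g, R g)" for g
    unfolding double_centralizer_def
  proof (clarsimp simp: Lc Rc, intro conjI allI)
    fix a b
    have "L g (a * b) = \<Phi> g (\<alpha> g (inv \<phi> (inv (\<beta> g) a)) * \<alpha> g (inv \<phi> (inv (\<beta> g) b)))"
      by (simp add: L_def star_hom_mult[OF i\<beta>] star_hom_mult[OF i\<phi>]
          star_hom_mult[OF nondegenerate_action_star_hom[OF \<alpha>]])
    then show "L g (a * b) = L g a * b" by (simp add: mul_right L_def \<phi>s \<beta>s)
    show "R g (a * b) = a * R g b" by (simp add: R_def star_hom_mult[OF i\<phi>] mul_left \<phi>s)
    have "R g a * \<beta> g (\<phi> (inv \<phi> (inv (\<beta> g) b))) = \<phi> (inv \<phi> a) * L g b"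
      unfolding R_def L_def by (simp flip: mul_right mul_left)
    then show "R g a * b = a * L g b" by (simp add: \<phi>s \<beta>s)
  qed
  define u where "u g = Abs_multiplier (L g, R g)" for g
  have lact_u: "lact (u g) b = L g b" and ract_u: "ract b (u g) = R g b" for g b
    unfolding u_def using lact_Abs[OF dc] ract_Abs[OF dc] by auto
  have ract_\<phi>: "ract (\<phi> a) (u g) = \<Phi> g a" for g a by (simp add: ract_u R_def \<phi>s)
  have uu: "ract (ract b (u g)) (star (u g)) = b" for b g
  proof (rule right_cancel)
    fix c
    have "ract (ract b (u g)) (star (u g)) * c = ract b (u g) * star (ract (star c) (u g))"
      by (simp only: ract_mult_lact star_ract star_star)
    also have "\<dots> = \<phi> (inv \<phi> b * star (inv \<phi> (star c)))" by (simp only: ract_u R_def st)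
    also have "\<dots> = b * c" by (simp add: \<phi>mult star_hom_star[OF \<phi>] \<phi>s star_star)
    finally show "ract (ract b (u g)) (star (u g)) * c = b * c" .
  qed
  \<comment> \<open>The star relation gives \<open>u g * star (u g) = 1\<close>; the reverse order
    needs that \<open>\<Phi> g\<close> is onto, so that every element has the form
    \<open>ract c (u g)\<close>.\<close>
  have "ract (ract b (star (u g))) (u g) = b" for b g
  proof -
    have "b = ract (\<phi> (inv (\<Phi> g) b)) (u g)"
      using bij_is_surj[OF bij] by (simp add: ract_\<phi> surj_f_inv_f)
    then show ?thesis by (metis uu)
  qed
  then have u: "unitary (u g)" for g
    unfolding unitary_def by (intro conjI multiplier_eq_ractI) (simp_all only: ract_times' ract_one' uu)
  have "unitary_path UNIV u"
    by (rule unitary_pathI_ract) (simp_all add: u ract_u R_def cont)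
  moreover have Ad: "Ad (u g) (\<beta> g (\<phi> a)) = \<phi> (\<alpha> g a)" for g a
  proof -
    have "lact (u g) (\<beta> g (\<phi> a)) = ract (\<phi> (\<alpha> g a)) (u g)"
      by (simp add: lact_u L_def ract_\<phi> \<beta>s \<phi>s)
    then show ?thesis by (simp only: Ad_def uu)
  qed
  \<comment> \<open>Tested on \<open>\<phi> (a * \<alpha> g b)\<close>, the two sides are the two
    sides of the product rule. Such elements suffice because \<open>\<phi>\<close> and
    \<open>\<alpha> g\<close> are onto.\<close>
  moreover have "mext \<phi> (\<uu> g h) = u g * mext (\<beta> g) (u h) * \<vv> g h * star (u (g + h))" for g h
  proof -
    let ?M = "mext \<phi> (\<uu> g h) * u (g + h)" and ?N = "u g * mext (\<beta> g) (u h) * \<vv> g h"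
    have "\<phi> a * ract (\<phi> (\<alpha> g b)) ?M = \<phi> a * ract (\<phi> (\<alpha> g b)) ?N" for a b
    proof -
      have "\<phi> a * ract (\<phi> (\<alpha> g b)) ?M = ract (\<phi> (a * \<alpha> g b)) ?M"
        by (simp only: \<phi>mult ract_mult)
      also have "\<dots> = \<Phi> (g + h) (ract (a * \<alpha> g b) (\<uu> g h))"
        by (simp only: ract_times' ract_mext[OF \<phi> \<phi>n] ract_\<phi>)
      also have "\<dots> = ract (ract (\<phi> a) (u g) * \<beta> g (\<Phi> h b)) (\<vv> g h)" by (simp add: mul ract_\<phi>)
      also have "\<dots> = ract (ract (\<phi> a) (u g) * ract (\<beta> g (\<phi> b)) (mext (\<beta> g) (u h))) (\<vv> g h)"
        by (simp only: ract_mext[OF action_hom[OF \<beta>]] ract_\<phi>)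
      also have "\<dots> = ract (\<phi> a * lact (u g) (ract (\<beta> g (\<phi> b)) (mext (\<beta> g) (u h)))) (\<vv> g h)"
        by (simp only: ract_mult_lact)
      also have "\<dots> = \<phi> a * ract (ract (ract (Ad (u g) (\<beta> g (\<phi> b))) (u g)) (mext (\<beta> g) (u h))) (\<vv> g h)"
        by (simp only: ract_mult lact_ract ract_Ad_unitary[OF u])
      finally show ?thesis by (simp only: Ad ract_times')
    qed
    from this[of "inv \<phi> _" "inv (\<alpha> g) (inv \<phi> _)"] have "c * ract b ?M = c * ract b ?N" for b c
      by (simp only: \<phi>s surj_f_inv_f[OF bij_is_surj[OF nondegenerate_action_bij[OF \<alpha>]]])
    then have "ract b ?M = ract b ?N" for b by (rule left_cancel)
    then have "?M = ?N" by (rule multiplier_eq_ractI)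
    then have "?M * star (u (g + h)) = ?N * star (u (g + h))" by simp
    then show ?thesis using u[of "g + h"] by (simp add: mult.assoc unitary_def)
  qed
  ultimately have "cocycle_conjugacy (\<alpha>, \<uu>) (\<beta>, \<vv>) (\<phi>, u)"
    using \<phi> \<phi>n \<phi>b u by (simp add: unitary_path_def fun_eq_iff)
  moreover have "cocycle_map (\<phi>, u) = \<Phi>" by (intro ext) (simp add: cocycle_map_apply ract_\<phi>)
  ultimately show ?thesis using that by blast
qed

text \<open>At \<open>g = 0\<close> the hypothesis says that \<open>\<psi>\<close> inverts
  \<open>\<phi>\<close>; for general \<open>g\<close> it then says
  \<open>mext \<psi> (u g) * v g = 1\<close>.\<close>

lemma cocycle_inverse_eqI:
  assumes \<psi>: "star_hom \<psi>" "nondegenerate \<psi>" and \<phi>: "surj \<phi>"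
    and zero: "u 0 = 1" "v 0 = 1" and v: "\<And>g. unitary (v g)"
    and inv: "\<And>g a. cocycle_map (\<psi>, v) g (cocycle_map (\<phi>, u) g a) = a"
  shows "(\<psi>, v) = cocycle_inverse (\<phi>, u)"
proof -
  have \<psi>\<phi>: "\<psi> (\<phi> a) = a" for a using inv[of 0 a] by (simp add: cocycle_map_apply zero)
  then have "inj \<phi>" by (metis injI)
  then have eq: "\<psi> = inv \<phi>" by (intro ext) (metis \<psi>\<phi> \<phi> surj_f_inv_f)
  have "v g = star (mext \<psi> (u g))" for g
  proof -
    have "mext \<psi> (u g) * v g = 1"
    proof (rule multiplier_eq_ractI)
      show "ract a (mext \<psi> (u g) * v g) = ract a 1" for a
        using inv[of g a] ract_mext[OF \<psi>, of "\<phi> a" "u g"] by (simp add: cocycle_map_apply \<psi>\<phi>)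
    qed
    then have "mext \<psi> (u g) * v g * star (v g) = star (v g)" by simp
    then have "mext \<psi> (u g) = star (v g)" using v[of g] by (simp add: mult.assoc unitary_def)
    then show ?thesis by (simp add: star_star)
  qed
  then show ?thesis using eq by (simp add: fun_eq_iff)
qed

lemma conjugate_id_imp_ucc_lim:
  fixes \<alpha> :: "'g::topological_group_add \<Rightarrow> 'a::cstar_algebra \<Rightarrow> 'a"
  assumes \<alpha>: "nondegenerate_action \<alpha>" and \<psi>: "star_hom \<psi>" "nondegenerate \<psi>"
    and u: "\<And>g. unitary (u g)" and v: "\<And>g. unitary (v g)"
    and conj: "asymptotic_unitary_conjugate (\<alpha>, \<uu>) cocycle_id (cocycle_comp (\<psi>, v) (\<phi>, u))"
  obtains w where "unitary_path {0..} w"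
    "ucc_lim (\<lambda>t g a. ad_map \<alpha> (w t) g (cocycle_map (\<psi>, v) g (cocycle_map (\<phi>, u) g a))) (\<lambda>g a. a)"
proof -
  have c: "asymptotic_unitary_conjugate (\<alpha>, \<uu>) (id, \<lambda>_. 1) (\<psi> \<circ> \<phi>, \<lambda>g. mext \<psi> (u g) * v g)"
    using conj by (simp only: cocycle_id_def cocycle_comp.simps)
  have uv: "unitary (mext \<psi> (u g) * v g)" for g by (intro unitary_mult unitary_mext \<psi> u v)
  obtain w where w: "unitary_path {0..} w"
    "ucc_lim (\<lambda>t g a. ad_map \<alpha> (w t) g (cocycle_map (\<psi> \<circ> \<phi>, \<lambda>g. mext \<psi> (u g) * v g) g a)) (cocycle_map (id, \<lambda>_. 1))"
    using conjugate_imp_ucc_lim[OF \<alpha> uv unitary_one c] .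
  have "cocycle_map (\<psi> \<circ> \<phi>, \<lambda>g. mext \<psi> (u g) * v g) g a = cocycle_map (\<psi>, v) g (cocycle_map (\<phi>, u) g a)" for g a
    using cocycle_map_comp[OF \<psi>, of v \<phi> u g a] by simp
  moreover have "cocycle_map (id, \<lambda>_ :: 'g. 1) = (\<lambda>g a. a :: 'a)" by (intro ext) (simp add: cocycle_map_apply)
  ultimately show ?thesis using that[OF w(1)] w(2) by simp
qed

lemma limit_cocycle_conjugacy:
  fixes \<alpha> :: "'g::topological_group_add \<Rightarrow> 'a::cstar_algebra \<Rightarrow> 'a" and \<beta> :: "'g \<Rightarrow> 'b::cstar_algebra \<Rightarrow> 'b"
  assumes lc: "locally_compact_space (euclidean :: 'g topology)"
    and \<alpha>: "nondegenerate_action \<alpha>" and \<beta>: "nondegenerate_action \<beta>"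
    and \<alpha>\<uu>: "twisted_action (\<alpha>, \<uu>)" and \<beta>\<vv>: "twisted_action (\<beta>, \<vv>)"
    and morph: "cocycle_morphism (\<alpha>, \<uu>) (\<beta>, \<vv>) (\<phi>, u)"
    and X: "unitary_path {0..} X" and lim: "ucc_lim (\<lambda>t g a. ad_map \<beta> (X t) g (cocycle_map (\<phi>, u) g a)) \<Phi>\<^sub>0"
    and bij: "\<And>g. bij (\<Phi>\<^sub>0 g)"
  obtains \<phi>\<^sub>0 u\<^sub>0 where "cocycle_conjugacy (\<alpha>, \<uu>) (\<beta>, \<vv>) (\<phi>\<^sub>0, u\<^sub>0)" "cocycle_map (\<phi>\<^sub>0, u\<^sub>0) = \<Phi>\<^sub>0"
    "asymptotically_unitarily_equivalent (\<beta>, \<vv>) (\<phi>, u) (\<phi>\<^sub>0, u\<^sub>0)"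
proof -
  note cm = \<alpha> \<beta> \<alpha>\<uu> \<beta>\<vv> morph and E = equivariant_cocycle_map[OF \<alpha> \<beta> \<alpha>\<uu> \<beta>\<vv> morph]
  note seq = ucc_lim_sequence[OF lim]
  have Xu: "unitary (X t)" if "0 \<le> t" for t using unitary_path_unitary[OF X] that by simp
  have "fell_map (\<alpha>, \<uu>) (\<beta>, \<vv>) \<Phi>\<^sub>0"
    by (rule fell_map_limit[OF \<beta> ad_map_fell_map[OF \<beta> \<beta>\<vv> cocycle_map_fell_map[OF cm] Xu] seq]) simp
  moreover have "dist (\<Phi>\<^sub>0 g a) (\<Phi>\<^sub>0 g b) \<le> dist a b" for g a b
    by (rule nonexpansive_limit[OF _ seq])
      (simp add: dist_ad_map[OF \<beta> Xu] equivariant_dist[OF E])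
  moreover have "continuous_on UNIV (\<lambda>g. \<Phi>\<^sub>0 g a)" for a
    by (rule ucc_lim_continuous[OF lc lim])
      (intro continuous_on_ad_map \<beta> Xu equivariant_continuous[OF E] continuous_on_const)
  ultimately obtain \<phi>\<^sub>0 u\<^sub>0 where conj: "cocycle_conjugacy (\<alpha>, \<uu>) (\<beta>, \<vv>) (\<phi>\<^sub>0, u\<^sub>0)"
    and \<Phi>\<^sub>0: "cocycle_map (\<phi>\<^sub>0, u\<^sub>0) = \<Phi>\<^sub>0"
    by (rule fell_map_cocycle_conjugacy[OF \<alpha> \<beta> \<alpha>\<uu> \<beta>\<vv> _ bij])
  have "cocycle_morphism (\<alpha>, \<uu>) (\<beta>, \<vv>) (\<phi>\<^sub>0, u\<^sub>0)" using conj by simp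
  note cm0 = \<alpha> \<beta> \<alpha>\<uu> \<beta>\<vv> this
  note zero = twisted_zero(1)[OF \<beta>\<vv>] cm_zero[OF cm] cm_zero[OF cm0]
  have "asymptotic_unitary_conjugate (\<beta>, \<vv>) (\<phi>\<^sub>0, u\<^sub>0) (\<phi>, u)"
    by (rule ucc_lim_imp_conjugate[where u = u and v = u\<^sub>0, OF \<beta> cm_unitary[OF cm] cm_unitary[OF cm0] cm_hom[OF cm0] zero X])
      (simp add: \<Phi>\<^sub>0 lim)
  \<comment> \<open>The adjoint path works in the reverse direction: \<open>ad_map\<close> by a
    unitary is isometric, so it moves to the other side of the distance with the same
    \<open>T\<close>.\<close>
  moreover have "asymptotic_unitary_conjugate (\<beta>, \<vv>) (\<phi>, u) (\<phi>\<^sub>0, u\<^sub>0)"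
  proof (rule ucc_lim_imp_conjugate[where u = u\<^sub>0 and v = u, OF \<beta> cm_unitary[OF cm0] cm_unitary[OF cm] cm_hom[OF cm] zero(1,3,2)
        unitary_path_star[OF X]])
    show "ucc_lim (\<lambda>t g a. ad_map \<beta> (star (X t)) g (cocycle_map (\<phi>\<^sub>0, u\<^sub>0) g a)) (cocycle_map (\<phi>, u))"
      unfolding ucc_lim_def \<Phi>\<^sub>0
    proof (intro allI impI)
      fix a and K :: "'g set" and e :: real assume "compact K" "0 < e"
      then obtain T where "T \<ge> 0" "\<forall>t\<ge>T. \<forall>g\<in>K. dist (ad_map \<beta> (X t) g (cocycle_map (\<phi>, u) g a)) (\<Phi>\<^sub>0 g a) \<le> e"
        using ucc_limD[OF lim] by blast
      then show "\<exists>T\<ge>0. \<forall>t\<ge>T. \<forall>g\<in>K. dist (ad_map \<beta> (star (X t)) g (\<Phi>\<^sub>0 g a)) (cocycle_map (\<phi>, u) g a) \<le> e"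
        by (intro exI[of _ T]) (auto simp: dist_ad_map_star[OF \<beta> Xu] dist_commute[of "\<Phi>\<^sub>0 _ _"])
    qed
  qed
  ultimately show ?thesis using that[OF conj \<Phi>\<^sub>0] by (simp add: asymptotically_unitarily_equivalent_def)
qed

theorem theorem4p5:
  fixes \<alpha> :: "'g::{topological_group_add, t2_space, second_countable_topology} \<Rightarrow>
              'a::cstar_algebra \<Rightarrow> 'a"
    and \<uu> :: "'g \<Rightarrow> 'g \<Rightarrow> 'a multiplier"
    and \<beta> :: "'g \<Rightarrow> 'b::cstar_algebra \<Rightarrow> 'b"
    and \<vv> :: "'g \<Rightarrow> 'g \<Rightarrow> 'b multiplier"
    and \<phi> :: "'a \<Rightarrow> 'b" and u :: "'g \<Rightarrow> 'b multiplier"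
    and \<psi> :: "'b \<Rightarrow> 'a" and v :: "'g \<Rightarrow> 'a multiplier"
  assumes "locally_compact_space (euclidean :: 'g topology)"
    and "separable_space (euclidean :: 'a topology)"
    and "separable_space (euclidean :: 'b topology)"
    and "twisted_action (\<alpha>, \<uu>)"
    and "twisted_action (\<beta>, \<vv>)"
    and "cocycle_morphism (\<alpha>, \<uu>) (\<beta>, \<vv>) (\<phi>, u)"
    and "cocycle_morphism (\<beta>, \<vv>) (\<alpha>, \<uu>) (\<psi>, v)"
    and "asymptotically_unitarily_equivalent (\<alpha>, \<uu>)
           (cocycle_comp (\<psi>, v) (\<phi>, u)) cocycle_id"
    and "asymptotically_unitarily_equivalent (\<beta>, \<vv>)
           (cocycle_comp (\<phi>, u) (\<psi>, v)) cocycle_id"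
  shows "\<exists>\<phi>\<^sub>0 u\<^sub>0 \<psi>\<^sub>0 v\<^sub>0.
           cocycle_conjugacy (\<alpha>, \<uu>) (\<beta>, \<vv>) (\<phi>\<^sub>0, u\<^sub>0) \<and>
           cocycle_conjugacy (\<beta>, \<vv>) (\<alpha>, \<uu>) (\<psi>\<^sub>0, v\<^sub>0) \<and>
           (\<psi>\<^sub>0, v\<^sub>0) = cocycle_inverse (\<phi>\<^sub>0, u\<^sub>0) \<and>
           (\<phi>\<^sub>0, u\<^sub>0) = cocycle_inverse (\<psi>\<^sub>0, v\<^sub>0) \<and>
           asymptotically_unitarily_equivalent (\<beta>, \<vv>) (\<phi>, u) (\<phi>\<^sub>0, u\<^sub>0) \<and>
           asymptotically_unitarily_equivalent (\<alpha>, \<uu>) (\<psi>, v) (\<psi>\<^sub>0, v\<^sub>0)"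
proof -
  note lc = assms(1) and \<alpha>\<uu> = assms(4) and \<beta>\<vv> = assms(5) and M\<phi> = assms(6) and M\<psi> = assms(7)
  \<comment> \<open>\<open>\<psi>\<close> maps into the first algebra and \<open>\<phi>\<close> into
    the second, so they witness there that products are total; this makes the automorphisms
    nondegenerate.\<close>
  have "nondegenerate \<phi>" "nondegenerate \<psi>" using M\<phi> M\<psi> by auto
  then have \<alpha>: "nondegenerate_action \<alpha>" and \<beta>: "nondegenerate_action \<beta>"
    using twisted_action_nondegenerate \<alpha>\<uu> \<beta>\<vv> by blast+
  note cm\<phi> = \<alpha> \<beta> \<alpha>\<uu> \<beta>\<vv> M\<phi> and cm\<psi> = \<beta> \<alpha> \<beta>\<vv> \<alpha>\<uu> M\<psi>
  note E\<phi> = equivariant_cocycle_map[OF cm\<phi>] and E\<psi> = equivariant_cocycle_map[OF cm\<psi>]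
  obtain w where w: "unitary_path {0..} w"
    "ucc_lim (\<lambda>t g a. ad_map \<alpha> (w t) g (cocycle_map (\<psi>, v) g (cocycle_map (\<phi>, u) g a))) (\<lambda>g a. a)"
    using conjugate_id_imp_ucc_lim[of \<alpha> \<psi> u v \<uu> \<phi>, OF \<alpha> cm_hom[OF cm\<psi>] cm_unitary[OF cm\<phi>] cm_unitary[OF cm\<psi>]
        assms(8)[unfolded asymptotically_unitarily_equivalent_def, THEN conjunct1]] .
  obtain z where z: "unitary_path {0..} z"
    "ucc_lim (\<lambda>t g b. ad_map \<beta> (z t) g (cocycle_map (\<phi>, u) g (cocycle_map (\<psi>, v) g b))) (\<lambda>g b. b)"
    using conjugate_id_imp_ucc_lim[of \<beta> \<phi> v u \<vv> \<psi>, OF \<beta> cm_hom[OF cm\<phi>] cm_unitary[OF cm\<psi>] cm_unitary[OF cm\<phi>]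
        assms(9)[unfolded asymptotically_unitarily_equivalent_def, THEN conjunct1]] .
  obtain a :: "nat \<Rightarrow> 'a" where a: "closure (range a) = UNIV"
    using separable_space_dense_sequence[OF assms(2)] .
  obtain b :: "nat \<Rightarrow> 'b" where b: "closure (range b) = UNIV"
    using separable_space_dense_sequence[OF assms(3)] .
  obtain K :: "nat \<Rightarrow> 'g set" where K: "\<And>n. compact (K n)" "mono K" "\<And>C. compact C \<Longrightarrow> \<exists>n. C \<subseteq> K n"
    using compact_exhaustion[OF lc] by metis
  obtain X Y \<Phi>\<^sub>0 \<Psi>\<^sub>0 where X: "unitary_path {0..} X" "ucc_lim (\<lambda>t g a. ad_map \<beta> (X t) g (cocycle_map (\<phi>, u) g a)) \<Phi>\<^sub>0"
    and Y: "unitary_path {0..} Y" "ucc_lim (\<lambda>t g b. ad_map \<alpha> (Y t) g (cocycle_map (\<psi>, v) g b)) \<Psi>\<^sub>0"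
    and inv: "\<And>g a. \<Psi>\<^sub>0 g (\<Phi>\<^sub>0 g a) = a" "\<And>g b. \<Phi>\<^sub>0 g (\<Psi>\<^sub>0 g b) = b"
    by (rule intertwining[OF E\<phi> E\<psi> w z a b K]) (assumption, rule that)
  have bij: "bij (\<Phi>\<^sub>0 g)" "bij (\<Psi>\<^sub>0 g)" for g
    by (rule o_bij[of "\<Psi>\<^sub>0 g"] o_bij[of "\<Phi>\<^sub>0 g"]; simp add: fun_eq_iff inv)+
  obtain \<phi>\<^sub>0 u\<^sub>0 where \<phi>\<^sub>0: "cocycle_conjugacy (\<alpha>, \<uu>) (\<beta>, \<vv>) (\<phi>\<^sub>0, u\<^sub>0)" "cocycle_map (\<phi>\<^sub>0, u\<^sub>0) = \<Phi>\<^sub>0"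
    "asymptotically_unitarily_equivalent (\<beta>, \<vv>) (\<phi>, u) (\<phi>\<^sub>0, u\<^sub>0)"
    using limit_cocycle_conjugacy[OF lc cm\<phi> X bij(1)] .
  obtain \<psi>\<^sub>0 v\<^sub>0 where \<psi>\<^sub>0: "cocycle_conjugacy (\<beta>, \<vv>) (\<alpha>, \<uu>) (\<psi>\<^sub>0, v\<^sub>0)" "cocycle_map (\<psi>\<^sub>0, v\<^sub>0) = \<Psi>\<^sub>0"
    "asymptotically_unitarily_equivalent (\<alpha>, \<uu>) (\<psi>, v) (\<psi>\<^sub>0, v\<^sub>0)"
    using limit_cocycle_conjugacy[OF lc cm\<psi> Y bij(2)] .
  have M0: "cocycle_morphism (\<alpha>, \<uu>) (\<beta>, \<vv>) (\<phi>\<^sub>0, u\<^sub>0)" "cocycle_morphism (\<beta>, \<vv>) (\<alpha>, \<uu>) (\<psi>\<^sub>0, v\<^sub>0)"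
    and s: "surj \<phi>\<^sub>0" "surj \<psi>\<^sub>0"
    using \<phi>\<^sub>0(1) \<psi>\<^sub>0(1) by (simp_all add: bij_is_surj)
  note cm\<phi>\<^sub>0 = \<alpha> \<beta> \<alpha>\<uu> \<beta>\<vv> M0(1) and cm\<psi>\<^sub>0 = \<beta> \<alpha> \<beta>\<vv> \<alpha>\<uu> M0(2)
  have "(\<psi>\<^sub>0, v\<^sub>0) = cocycle_inverse (\<phi>\<^sub>0, u\<^sub>0)"
    by (rule cocycle_inverse_eqI[where u = u\<^sub>0 and v = v\<^sub>0, OF cm_hom[OF cm\<psi>\<^sub>0] s(1) cm_zero[OF cm\<phi>\<^sub>0] cm_zero[OF cm\<psi>\<^sub>0] cm_unitary[OF cm\<psi>\<^sub>0]])
      (simp add: \<phi>\<^sub>0(2) \<psi>\<^sub>0(2) inv)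
  moreover have "(\<phi>\<^sub>0, u\<^sub>0) = cocycle_inverse (\<psi>\<^sub>0, v\<^sub>0)"
    by (rule cocycle_inverse_eqI[where u = v\<^sub>0 and v = u\<^sub>0, OF cm_hom[OF cm\<phi>\<^sub>0] s(2) cm_zero[OF cm\<psi>\<^sub>0] cm_zero[OF cm\<phi>\<^sub>0] cm_unitary[OF cm\<phi>\<^sub>0]])
      (simp add: \<phi>\<^sub>0(2) \<psi>\<^sub>0(2) inv)
  ultimately show ?thesis using \<phi>\<^sub>0(1,3) \<psi>\<^sub>0(1,3) by blast
qed

end
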